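(* The function $\widetilde V(\delta)=\max_{\{a_i,a_j\}\subseteq\mathcal{A}}\widetilde{\mathcal{G}}_{ij}(\delta)$ is in $\widehat{\mathcal{C}}^2$. As a result, $\widetilde{\mathcal{G}}(\delta)=\widetilde V(\delta)$ for all $\delta\in[0,1]$.
   Context: $\mathcal{A}$ is a finite set of at least two actions with rewards $\mathcal{R}(a,\theta)$, $\theta\in\{\theta_0,\theta_1\}$; $\widetilde{\mathcal{R}}_a(\delta)=\delta\mathcal{R}(a,\theta_0)+(1-\delta)\mathcal{R}(a,\theta_1)$ and $G(\delta)=\max_{a\in\mathcal{A}}\widetilde{\mathcal{R}}_a(\delta)$. Standing assumptions: no action is uniformly dominated (each $a$ maximizes $\widetilde{\mathcal{R}}_a$ at some $\delta\in(0,1)$) and payoffs are nonnegative. Let $\tilde\sigma>0$, $r>0$, $\tilde\delta_t$ solve $d\tilde\delta_t=\tilde\sigma\tilde\delta_t(1-\tilde\delta_t)dW_t$, $\tilde\delta_0=\delta$, and $\widetilde{\mathcal{G}}(\delta)=\sup_\tau\mathbb{E}_\delta[e^{-r\tau}G(\tilde\delta_\tau)]$ (supremum over stopping times). For each pair of distinct actions $\{a_i,a_j\}$, $\widetilde{\mathcal{G}}_{ij}(\delta)=\sup_\tau\mathbb{E}_\delta[e^{-r\tau}\max\{\widetilde{\mathcal{R}}_{a_i},\widetilde{\mathcal{R}}_{a_j}\}(\tilde\delta_\tau)]$ is the value of the two-action problem. $\widehat{\mathcal{C}}^2$ is the set of $f\in\mathcal{C}^1[0,1]$ for which there is a finite set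 $N_f$ such that $f''$ exists on $[0,1]\setminus N_f$. *)

theory Defs
  imports "HOL-Probability.Probability"
begin

text \<open>Actions of type 'b; rewards R0 a = R(a,theta_0), R1 a = R(a,theta_1).\<close>

definition Rt :: "('b \<Rightarrow> real) \<Rightarrow> ('b \<Rightarrow> real) \<Rightarrow> 'b \<Rightarrow> real \<Rightarrow> real" where
  "Rt R0 R1 a d = d * R0 a + (1 - d) * R1 a"

definition Gmax :: "'b set \<Rightarrow> ('b \<Rightarrow> real) \<Rightarrow> ('b \<Rightarrow> real) \<Rightarrow> real \<Rightarrow> real" where
  "Gmax A R0 R1 d = Max ((\<lambda>a. Rt R0 R1 a d) ` A)"

definition hatC2 :: "(real \<Rightarrow> real) \<Rightarrow> bool" where
  "hatC2 f \<longleftrightarrow> (\<exists>f'. (\<forall>x\<in>{0..1}. (f has_real_derivative f' x) (at x within {0..1}))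
      \<and> continuous_on {0..1} f'
      \<and> (\<exists>N. finite N \<and> (\<forall>x\<in>{0..1} - N. f' differentiable (at x within {0..1}))))"

definition nn_filtration :: "'a measure \<Rightarrow> (real \<Rightarrow> 'a measure) \<Rightarrow> bool" where
  "nn_filtration M F \<longleftrightarrow>
     (\<forall>t\<ge>0. space (F t) = space M \<and> sets (F t) \<subseteq> sets M) \<and>
     (\<forall>s t. 0 \<le> s \<longrightarrow> s \<le> t \<longrightarrow> sets (F s) \<subseteq> sets (F t))"

definition brownian_motion :: "'a measure \<Rightarrow> (real \<Rightarrow> 'a measure) \<Rightarrow> (real \<Rightarrow> 'a \<Rightarrow> real) \<Rightarrow> bool" where
  "brownian_motion M F W \<longleftrightarrow>
     prob_space M \<and> nn_filtration M F \<and>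
     (\<forall>\<omega>\<in>space M. W 0 \<omega> = 0) \<and>
     (\<forall>\<omega>\<in>space M. continuous_on {0..} (\<lambda>t. W t \<omega>)) \<and>
     (\<forall>t\<ge>0. W t \<in> borel_measurable (F t)) \<and>
     (\<forall>s t. 0 \<le> s \<longrightarrow> s < t \<longrightarrow>
        distributed M lborel (\<lambda>\<omega>. W t \<omega> - W s \<omega>) (\<lambda>x. ennreal (normal_density 0 (sqrt (t - s)) x))) \<and>
     (\<forall>s t. 0 \<le> s \<longrightarrow> s \<le> t \<longrightarrow>
        (\<forall>E\<in>sets (F s). \<forall>B\<in>sets borel.
          measure M (E \<inter> {\<omega>\<in>space M. W t \<omega> - W s \<omega> \<in> B})
            = measure M E * measure M {\<omega>\<in>space M. W t \<omega> - W s \<omega> \<in> B}))"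

definition ito_sum :: "(real \<Rightarrow> real) \<Rightarrow> (real \<Rightarrow> 'a \<Rightarrow> real) \<Rightarrow> (real \<Rightarrow> 'a \<Rightarrow> real) \<Rightarrow> real \<Rightarrow> nat \<Rightarrow> 'a \<Rightarrow> real" where
  "ito_sum c X W t n \<omega> =
     (\<Sum>k<n. c (X (real k * t / real n) \<omega>) *
             (W (real (Suc k) * t / real n) \<omega> - W (real k * t / real n) \<omega>))"

text \<open>X is a (strong) solution of dX_t = sigma X_t (1 - X_t) dW_t, X_0 = d:
  continuous, F-adapted, and X_t - d equals the Ito integral, which for continuous
  adapted integrands is the limit in probability of left-point Riemann sums.\<close>

definition solves_belief_sde ::
  "'a measure \<Rightarrow> (real \<Rightarrow> 'a measure) \<Rightarrow> (real \<Rightarrow> 'a \<Rightarrow> real) \<Rightarrow> real \<Rightarrow> real \<Rightarrow> (real \<Rightarrow> 'a \<Rightarrow> real) \<Rightarrow> bool" where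
  "solves_belief_sde M F W \<sigma> d X \<longleftrightarrow>
     (\<forall>\<omega>\<in>space M. X 0 \<omega> = d) \<and>
     (\<forall>\<omega>\<in>space M. continuous_on {0..} (\<lambda>t. X t \<omega>)) \<and>
     (\<forall>t\<ge>0. X t \<in> borel_measurable (F t)) \<and>
     (\<forall>t\<ge>0. \<forall>\<epsilon>>0.
        (\<lambda>n. measure M {\<omega>\<in>space M.
               \<bar>ito_sum (\<lambda>x. \<sigma> * x * (1 - x)) X W t n \<omega> - (X t \<omega> - d)\<bar> > \<epsilon>})
        \<longlonglongrightarrow> 0)"

definition nn_stopping_time :: "'a measure \<Rightarrow> (real \<Rightarrow> 'a measure) \<Rightarrow> ('a \<Rightarrow> real) \<Rightarrow> bool" where
  "nn_stopping_time M F \<tau> \<longleftrightarrow>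
     (\<forall>\<omega>\<in>space M. 0 \<le> \<tau> \<omega>) \<and>
     (\<forall>t\<ge>0. {\<omega>\<in>space M. \<tau> \<omega> \<le> t} \<in> sets (F t))"

text \<open>Optimal stopping value sup_tau E[e^{-r tau} g(X_tau)] for the process started at d.
  (Infinite stopping times contribute e^{-r\<infinity>} = 0 and, as payoffs are nonnegative,
  do not change the supremum; we use finite-valued stopping times.)\<close>

definition stop_value ::
  "'a measure \<Rightarrow> (real \<Rightarrow> 'a measure) \<Rightarrow> (real \<Rightarrow> real \<Rightarrow> 'a \<Rightarrow> real) \<Rightarrow> real \<Rightarrow> (real \<Rightarrow> real) \<Rightarrow> real \<Rightarrow> real" where
  "stop_value M F X r g d =
     (SUP \<tau>\<in>{\<tau>. nn_stopping_time M F \<tau>}.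
        integral\<^sup>L M (\<lambda>\<omega>. exp (- r * \<tau> \<omega>) * g (X d (\<tau> \<omega>) \<omega>)))"

end

theory Submission
  imports Defs
begin

text \<open>The generator equation \<open>\<sigma>\<^sup>2 x\<^sup>2 (1 - x)\<^sup>2 / 2 * f'' = r f\<close> has the explicit solutions \<open>x powr b * (1 - x) powr (1 - b)\<close>
  and its reflection. Ito's formula, applied to these only, shows that the discounted solutions are
  martingales up to exit times; hence every combination that majorizes a payoff bounds its value from above,
  with equality at a belief lying between two beliefs where the combination meets the payoff. So the value is
  the envelope of the payoff by such combinations, that is, a concave envelope after a change of variables. In
  one dimension a minimal majorant at a given belief touches the maximum of the rewards at two points, one on each
  side, hence touches the maximum of just two rewards: the pairwise problems suffice. Rewards are concave
  relative to the solutions, so the envelope has no kinks, and each reward is optimal on an interval,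
  so that the second derivative fails to exist at finitely many points only.\<close>

section \<open>Brownian increments and discrete stochastic integrals\<close>

text \<open>The equation is given only through limits in probability of left-point sums at fixed
  times. Ito's formula is therefore rebuilt from three moments of the Brownian increments, and what
  is needed at random times is reduced to an L1 error at one terminal time. Nothing is assumed about
  where a solution lives: that beliefs remain in (0, 1), or are frozen at an end, has to be derived
  before the supremum over stopping times is known to be finite. Each of the two basic solutions
  blows up at one end. Hence martingale identities hold only up to exit from compact subintervals,
  and minimal majorants are found by compactness only after a rescaling that extends to the closed
  interval. That no action is uniformly dominated acts at the ends: it makes the reward that is best
  at an end remain optimal on a whole neighbourhood, so the value is linear there and has a
  one-sided derivative. In the interior, the derivative comes from touching and its continuity from
  uniqueness of the touching combination, without any formula for the stopping region.\<close>

lemma Int_stable_vimage: "Int_stable {f -` A \<inter> S |A. A \<in> sets N}"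
proof (rule Int_stableI, clarify)
  fix A B assume "A \<in> sets N" "B \<in> sets N"
  then have "f -` A \<inter> S \<inter> (f -` B \<inter> S) = f -` (A \<inter> B) \<inter> S" "A \<inter> B \<in> sets N" by auto
  then show "\<exists>C. f -` A \<inter> S \<inter> (f -` B \<inter> S) = f -` C \<inter> S \<and> C \<in> sets N" by blast
qed

locale bm =
  fixes M :: "'a measure" and F :: "real \<Rightarrow> 'a measure" and W :: "real \<Rightarrow> 'a \<Rightarrow> real"
  assumes BM: "brownian_motion M F W"
begin

sublocale prob_space M
  using BM by (simp add: brownian_motion_def)

lemma filtration_subalgebra: "0 \<le> t \<Longrightarrow> subalgebra M (F t)"
  using BM by (auto simp: brownian_motion_def nn_filtration_def subalgebra_def)

lemma filtration_mono: "0 \<le> s \<Longrightarrow> s \<le> t \<Longrightarrow> subalgebra (F t) (F s)"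
  using BM by (auto simp: brownian_motion_def nn_filtration_def subalgebra_def)

lemma space_filtration: "0 \<le> t \<Longrightarrow> space (F t) = space M"
  using filtration_subalgebra[of t] by (auto simp: subalgebra_def)

lemma sets_filtration: "0 \<le> t \<Longrightarrow> E \<in> sets (F t) \<Longrightarrow> E \<in> sets M"
  using filtration_subalgebra[of t] by (auto simp: subalgebra_def)

lemma sets_filtration_mono: "0 \<le> s \<Longrightarrow> s \<le> t \<Longrightarrow> E \<in> sets (F s) \<Longrightarrow> E \<in> sets (F t)"
  using filtration_mono[of s t] by (auto simp: subalgebra_def)

lemma adapted_measurable: "0 \<le> t \<Longrightarrow> Y \<in> borel_measurable (F t) \<Longrightarrow> Y \<in> borel_measurable M"
  using measurable_from_subalg[OF filtration_subalgebra] .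

lemma adapted_mono: "0 \<le> s \<Longrightarrow> s \<le> t \<Longrightarrow> Y \<in> borel_measurable (F s) \<Longrightarrow> Y \<in> borel_measurable (F t)"
  using measurable_from_subalg[OF filtration_mono] .

lemma W_adapted: "0 \<le> t \<Longrightarrow> W t \<in> borel_measurable (F t)"
  using BM by (auto simp: brownian_motion_def)

lemma W_measurable: "0 \<le> t \<Longrightarrow> W t \<in> borel_measurable M"
  using adapted_measurable W_adapted by blast

lemma increment_distributed:
  "0 \<le> s \<Longrightarrow> s < t \<Longrightarrow>
    distributed M lborel (\<lambda>\<omega>. W t \<omega> - W s \<omega>) (\<lambda>x. ennreal (normal_density 0 (sqrt (t - s)) x))"
  using BM by (auto simp: brownian_motion_def)

text \<open>The Brownian hypothesis is a product rule for single events. Both families of preimages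
  are stable under intersection, so the rule extends to the generated sigma-algebras, and
  expectations of products then factor.\<close>

lemma increment_indep:
  assumes "0 \<le> s" "s \<le> t" and Y: "Y \<in> borel_measurable (F s)"
  shows "indep_var borel Y borel (\<lambda>\<omega>. W t \<omega> - W s \<omega>)"
proof -
  have Ym: "Y \<in> borel_measurable M" using adapted_measurable assms by blast
  have Wm: "(\<lambda>\<omega>. W t \<omega> - W s \<omega>) \<in> borel_measurable M"
    using W_measurable[of t] W_measurable[of s] assms by (intro borel_measurable_diff) auto
  show ?thesis unfolding indep_var_eq
  proof (intro conjI indep_set_sigma_sets Ym Wm)
    show "Int_stable {Y -` A \<inter> space M |A. A \<in> sets borel}"
      by (rule Int_stable_vimage)
    show "Int_stable {(\<lambda>\<omega>. W t \<omega> - W s \<omega>) -` A \<inter> space M |A. A \<in> sets borel}"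
      by (rule Int_stable_vimage)
    show "indep_set {Y -` A \<inter> space M |A. A \<in> sets borel} {(\<lambda>\<omega>. W t \<omega> - W s \<omega>) -` A \<inter> space M |A. A \<in> sets borel}"
    proof (safe intro!: indep_setI)
      fix A :: "real set" assume "A \<in> sets borel"
      then show "Y -` A \<inter> space M \<in> sets M" using Ym by (auto intro: measurable_sets)
    next
      fix A :: "real set" assume "A \<in> sets borel"
      then show "(\<lambda>\<omega>. W t \<omega> - W s \<omega>) -` A \<inter> space M \<in> sets M" using Wm by (auto intro: measurable_sets)
    next
      fix A B :: "real set" assume A: "A \<in> sets borel" and B: "B \<in> sets borel"
      have "Y -` A \<inter> space M \<in> sets (F s)"
        using measurable_sets[OF Y A] space_filtration assms by simp
      then have "prob ((Y -` A \<inter> space M) \<inter> {\<omega>\<in>space M. W t \<omega> - W s \<omega> \<in> B})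
            = prob (Y -` A \<inter> space M) * prob {\<omega>\<in>space M. W t \<omega> - W s \<omega> \<in> B}"
        using BM assms B unfolding brownian_motion_def by blast
      moreover have "{\<omega>\<in>space M. W t \<omega> - W s \<omega> \<in> B} = (\<lambda>\<omega>. W t \<omega> - W s \<omega>) -` B \<inter> space M" by auto
      ultimately show "prob (Y -` A \<inter> space M \<inter> ((\<lambda>\<omega>. W t \<omega> - W s \<omega>) -` B \<inter> space M)) =
          prob (Y -` A \<inter> space M) * prob ((\<lambda>\<omega>. W t \<omega> - W s \<omega>) -` B \<inter> space M)" by simp
    qed
  qed
qed

lemma increment_moment:
  assumes "0 \<le> s" "s < t" and g: "g \<in> borel_measurable borel"
    and m: "has_bochner_integral lborel (\<lambda>x. normal_density 0 (sqrt (t - s)) x * g x) v"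
  shows "integrable M (\<lambda>\<omega>. g (W t \<omega> - W s \<omega>))"
    and "expectation (\<lambda>\<omega>. g (W t \<omega> - W s \<omega>)) = v"
proof -
  note d = increment_distributed[OF assms(1,2)]
  have g': "g \<in> borel_measurable lborel" using g by simp
  show "integrable M (\<lambda>\<omega>. g (W t \<omega> - W s \<omega>))"
    using distributed_integrable[OF d g'] has_bochner_integral_iff[THEN iffD1, OF m] by auto
  show "expectation (\<lambda>\<omega>. g (W t \<omega> - W s \<omega>)) = v"
    using distributed_integral[OF d g'] has_bochner_integral_iff[THEN iffD1, OF m] by auto
qed

text \<open>Mean and variance govern the first and second order Taylor terms. The third absolute
  moment controls the remainder: being of order \<open>(t - s) * sqrt (t - s)\<close> per step, it
  still vanishes when summed over a number of steps proportional to
  \<open>1 / (t - s)\<close>.\<close>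

lemma increment_moments:
  assumes "0 \<le> s" "s < t"
  shows "integrable M (\<lambda>\<omega>. W t \<omega> - W s \<omega>)" "expectation (\<lambda>\<omega>. W t \<omega> - W s \<omega>) = 0"
    and "integrable M (\<lambda>\<omega>. (W t \<omega> - W s \<omega>)\<^sup>2)" "expectation (\<lambda>\<omega>. (W t \<omega> - W s \<omega>)\<^sup>2) = t - s"
    and "integrable M (\<lambda>\<omega>. \<bar>W t \<omega> - W s \<omega>\<bar> ^ 3)"
        "expectation (\<lambda>\<omega>. \<bar>W t \<omega> - W s \<omega>\<bar> ^ 3) \<le> 2 * ((t - s) * sqrt (t - s))"
proof -
  have pos: "0 < sqrt (t - s)" using assms by simp
  have 1: "has_bochner_integral lborel (\<lambda>x. normal_density 0 (sqrt (t - s)) x * x) 0"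
    using normal_moment_odd[OF pos, of 0 0] by simp
  have 2: "has_bochner_integral lborel (\<lambda>x. normal_density 0 (sqrt (t - s)) x * x\<^sup>2) (t - s)"
  proof -
    have "fact (2 * 1) / ((2 / (sqrt (t - s))\<^sup>2) ^ 1 * fact 1) = t - s"
      using assms by (simp add: field_simps)
    then show ?thesis using normal_moment_even[OF pos, of 0 1] unfolding \<open>_ = t - s\<close> by (simp only: mult_1_right diff_zero)
  qed
  have 3: "has_bochner_integral lborel (\<lambda>x. normal_density 0 (sqrt (t - s)) x * \<bar>x\<bar> ^ 3) (2 * sqrt (t - s) ^ 3 * sqrt (2 / pi))"
    using normal_moment_abs_odd[OF pos, of 0 1] by (simp add: numeral_3_eq_3)
  show "integrable M (\<lambda>\<omega>. W t \<omega> - W s \<omega>)" "expectation (\<lambda>\<omega>. W t \<omega> - W s \<omega>) = 0"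
    using increment_moment[OF assms _ 1] by auto
  show "integrable M (\<lambda>\<omega>. (W t \<omega> - W s \<omega>)\<^sup>2)" "expectation (\<lambda>\<omega>. (W t \<omega> - W s \<omega>)\<^sup>2) = t - s"
    using increment_moment[OF assms _ 2] by auto
  show "integrable M (\<lambda>\<omega>. \<bar>W t \<omega> - W s \<omega>\<bar> ^ 3)"
    using increment_moment[OF assms _ 3] by auto
  have "sqrt (2 / pi) \<le> 1" using pi_gt3 by simp
  then have "2 * sqrt (t - s) ^ 3 * sqrt (2 / pi) \<le> 2 * sqrt (t - s) ^ 3"
    using pos by (intro mult_left_le) auto
  also have "\<dots> = 2 * ((t - s) * sqrt (t - s))"
    using assms by (simp add: power3_eq_cube)
  finally show "expectation (\<lambda>\<omega>. \<bar>W t \<omega> - W s \<omega>\<bar> ^ 3) \<le> 2 * ((t - s) * sqrt (t - s))"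
    using increment_moment(2)[OF assms _ 3] by auto
qed

text \<open>The substitute for conditional expectations: a multiplier known at time \<open>s\<close>
  sees an increment of mean 0 and a squared increment of mean \<open>t - s\<close>.\<close>

lemma increment_mult:
  assumes st: "0 \<le> s" "s < t" and Y: "Y \<in> borel_measurable (F s)" "integrable M Y"
  shows "integrable M (\<lambda>\<omega>. Y \<omega> * (W t \<omega> - W s \<omega>))" "expectation (\<lambda>\<omega>. Y \<omega> * (W t \<omega> - W s \<omega>)) = 0"
    and "integrable M (\<lambda>\<omega>. Y \<omega> * (W t \<omega> - W s \<omega>)\<^sup>2)"
        "expectation (\<lambda>\<omega>. Y \<omega> * (W t \<omega> - W s \<omega>)\<^sup>2) = expectation Y * (t - s)"
proof -
  have i1: "indep_var borel Y borel (\<lambda>\<omega>. W t \<omega> - W s \<omega>)"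
    using increment_indep st Y by auto
  have i2: "indep_var borel Y borel (\<lambda>\<omega>. (W t \<omega> - W s \<omega>)\<^sup>2)"
    using indep_var_compose[OF i1, of id borel "\<lambda>x. x\<^sup>2" borel] by (simp add: comp_def)
  note m = increment_moments[OF st]
  show "integrable M (\<lambda>\<omega>. Y \<omega> * (W t \<omega> - W s \<omega>))" "expectation (\<lambda>\<omega>. Y \<omega> * (W t \<omega> - W s \<omega>)) = 0"
    using indep_var_integrable[OF i1 Y(2) m(1)] indep_var_lebesgue_integral[OF i1 Y(2) m(1)] m(2) by auto
  show "integrable M (\<lambda>\<omega>. Y \<omega> * (W t \<omega> - W s \<omega>)\<^sup>2)"
        "expectation (\<lambda>\<omega>. Y \<omega> * (W t \<omega> - W s \<omega>)\<^sup>2) = expectation Y * (t - s)"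
    using indep_var_integrable[OF i2 Y(2) m(3)] indep_var_lebesgue_integral[OF i2 Y(2) m(3)] m(4) by auto
qed

section \<open>Martingale transforms on a grid\<close>

definition transform :: "real \<Rightarrow> (nat \<Rightarrow> 'a \<Rightarrow> real) \<Rightarrow> nat \<Rightarrow> 'a \<Rightarrow> real" where
  "transform \<delta> \<xi> k \<omega> = (\<Sum>j<k. \<xi> j \<omega> * (W (real (Suc j) * \<delta>) \<omega> - W (real j * \<delta>) \<omega>))"

lemma transform_0 [simp]: "transform \<delta> \<xi> 0 \<omega> = 0"
  by (simp add: transform_def)

lemma transform_Suc:
  "transform \<delta> \<xi> (Suc k) \<omega> = transform \<delta> \<xi> k \<omega> + \<xi> k \<omega> * (W (real (Suc k) * \<delta>) \<omega> - W (real k * \<delta>) \<omega>)"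
  by (simp add: transform_def)

text \<open>The discrete Ito isometry. When the square is expanded, the cross term multiplies the
  next increment by a quantity known before it and so has mean zero; the bound on
  \<open>\<xi>\<close> supplies integrability.\<close>

lemma transform_moments:
  assumes \<delta>: "\<delta> > 0" and \<xi>: "\<And>j. \<xi> j \<in> borel_measurable (F (real j * \<delta>))"
    and C: "\<And>j \<omega>. \<omega> \<in> space M \<Longrightarrow> \<bar>\<xi> j \<omega>\<bar> \<le> C"
  shows "transform \<delta> \<xi> k \<in> borel_measurable (F (real k * \<delta>))"
    and "integrable M (transform \<delta> \<xi> k)"
    and "integrable M (\<lambda>\<omega>. (transform \<delta> \<xi> k \<omega>)\<^sup>2)"
    and "expectation (\<lambda>\<omega>. (transform \<delta> \<xi> k \<omega>)\<^sup>2) = (\<Sum>j<k. expectation (\<lambda>\<omega>. (\<xi> j \<omega>)\<^sup>2)) * \<delta>"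
proof -
  have step: "real k * \<delta> \<ge> 0" "real k * \<delta> < real (Suc k) * \<delta>" for k
    using \<delta> by (auto simp: mult_strict_right_mono)
  have "transform \<delta> \<xi> k \<in> borel_measurable (F (real k * \<delta>)) \<and> integrable M (transform \<delta> \<xi> k) \<and>
     integrable M (\<lambda>\<omega>. (transform \<delta> \<xi> k \<omega>)\<^sup>2) \<and>
     expectation (\<lambda>\<omega>. (transform \<delta> \<xi> k \<omega>)\<^sup>2) = (\<Sum>j<k. expectation (\<lambda>\<omega>. (\<xi> j \<omega>)\<^sup>2)) * \<delta>"
  proof (induction k)
    case 0
    then show ?case by (simp add: transform_def[abs_def])
  next
    case (Suc k)
    let ?t = "real k * \<delta>" and ?t' = "real (Suc k) * \<delta>"
    let ?S = "transform \<delta> \<xi> k" and ?D = "\<lambda>\<omega>. W ?t' \<omega> - W ?t \<omega>"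
    have le: "?t \<le> ?t'" using step[of k] by simp
    have S: "?S \<in> borel_measurable (F ?t)" "integrable M ?S" "integrable M (\<lambda>\<omega>. (?S \<omega>)\<^sup>2)"
      "expectation (\<lambda>\<omega>. (?S \<omega>)\<^sup>2) = (\<Sum>j<k. expectation (\<lambda>\<omega>. (\<xi> j \<omega>)\<^sup>2)) * \<delta>"
      using Suc by auto
    have \<xi>M: "\<xi> k \<in> borel_measurable M" using \<xi> adapted_measurable step(1) by blast
    have Sm: "?S \<in> borel_measurable M" using S(1) adapted_measurable step(1) by blast
    have eq: "transform \<delta> \<xi> (Suc k) = (\<lambda>\<omega>. ?S \<omega> + \<xi> k \<omega> * ?D \<omega>)"
      by (auto simp: transform_Suc)
    have Wm: "W ?t' \<in> borel_measurable (F ?t')" "W ?t \<in> borel_measurable (F ?t')"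
      using W_adapted[OF step(1)[of "Suc k"]] adapted_mono[OF step(1) le W_adapted] step(1) by blast+
    have m: "transform \<delta> \<xi> (Suc k) \<in> borel_measurable (F ?t')"
      unfolding eq
      using Wm adapted_mono[OF step(1) le S(1)] adapted_mono[OF step(1) le \<xi>] by auto
    have i\<xi>: "integrable M (\<xi> k)"
      by (rule integrable_const_bound[of _ C]) (use C \<xi>M in auto)
    have i\<xi>2: "integrable M (\<lambda>\<omega>. (\<xi> k \<omega>)\<^sup>2)"
      by (rule integrable_const_bound[of _ "C\<^sup>2"]) (use C \<xi>M in \<open>auto intro!: AE_I2 simp: abs_le_square_iff[symmetric]\<close>, smt (verit))
    have iS\<xi>: "integrable M (\<lambda>\<omega>. ?S \<omega> * \<xi> k \<omega>)"
    proof (rule Bochner_Integration.integrable_bound[of M "\<lambda>\<omega>. C * ?S \<omega>"])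
      show "integrable M (\<lambda>\<omega>. C * ?S \<omega>)" using S(2) by simp
      show "(\<lambda>\<omega>. ?S \<omega> * \<xi> k \<omega>) \<in> borel_measurable M" using Sm \<xi>M by simp
      show "AE \<omega> in M. norm (?S \<omega> * \<xi> k \<omega>) \<le> norm (C * ?S \<omega>)"
      proof (rule AE_I2)
        fix \<omega> assume "\<omega> \<in> space M"
        from C[OF this, of k] have "\<bar>\<xi> k \<omega>\<bar> \<le> \<bar>C\<bar>" by simp
        then show "norm (?S \<omega> * \<xi> k \<omega>) \<le> norm (C * ?S \<omega>)"
          by (simp add: abs_mult mult.commute mult_right_mono)
      qed
    qed
    have S\<xi>m: "(\<lambda>\<omega>. ?S \<omega> * \<xi> k \<omega>) \<in> borel_measurable (F ?t)" using S(1) \<xi> by simp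
    have \<xi>2m: "(\<lambda>\<omega>. (\<xi> k \<omega>)\<^sup>2) \<in> borel_measurable (F ?t)" using \<xi> by simp
    note a = increment_mult[OF step \<xi> i\<xi>]
    note b = increment_mult[OF step S\<xi>m iS\<xi>]
    note c = increment_mult[OF step \<xi>2m i\<xi>2]
    have i: "integrable M (transform \<delta> \<xi> (Suc k))"
      unfolding eq using S(2) a(1) by simp
    have sq: "(\<lambda>\<omega>. (transform \<delta> \<xi> (Suc k) \<omega>)\<^sup>2) =
       (\<lambda>\<omega>. (?S \<omega>)\<^sup>2 + 2 * (?S \<omega> * \<xi> k \<omega> * ?D \<omega>) + (\<xi> k \<omega>)\<^sup>2 * (?D \<omega>)\<^sup>2)"
      by (auto simp: transform_Suc power2_eq_square algebra_simps)
    have i2: "integrable M (\<lambda>\<omega>. (transform \<delta> \<xi> (Suc k) \<omega>)\<^sup>2)"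
      unfolding sq using S(3) b(1) c(3) by (intro Bochner_Integration.integrable_add) auto
    have "expectation (\<lambda>\<omega>. (transform \<delta> \<xi> (Suc k) \<omega>)\<^sup>2) =
       expectation (\<lambda>\<omega>. (?S \<omega>)\<^sup>2) + 2 * expectation (\<lambda>\<omega>. ?S \<omega> * \<xi> k \<omega> * ?D \<omega>)
         + expectation (\<lambda>\<omega>. (\<xi> k \<omega>)\<^sup>2 * (?D \<omega>)\<^sup>2)"
      unfolding sq using S(3) b(1) c(3) by (simp add: Bochner_Integration.integral_add Bochner_Integration.integrable_add)
    also have "\<dots> = (\<Sum>j<k. expectation (\<lambda>\<omega>. (\<xi> j \<omega>)\<^sup>2)) * \<delta> + expectation (\<lambda>\<omega>. (\<xi> k \<omega>)\<^sup>2) * (?t' - ?t)"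
      using S(4) b(2) c(4) by simp
    also have "?t' - ?t = \<delta>" by (simp add: algebra_simps)
    finally show ?case using m i i2 by (simp add: algebra_simps)
  qed
  then show "transform \<delta> \<xi> k \<in> borel_measurable (F (real k * \<delta>))"
    and "integrable M (transform \<delta> \<xi> k)"
    and "integrable M (\<lambda>\<omega>. (transform \<delta> \<xi> k \<omega>)\<^sup>2)"
    and "expectation (\<lambda>\<omega>. (transform \<delta> \<xi> k \<omega>)\<^sup>2) = (\<Sum>j<k. expectation (\<lambda>\<omega>. (\<xi> j \<omega>)\<^sup>2)) * \<delta>"
    by auto
qed

text \<open>The martingale property in tested form: every increment with a nonzero integrand starts
  at time \<open>t\<close> or later, so multiplication by \<open>\<phi>\<close> keeps the integrand
  adapted.\<close>

lemma transform_orthogonal: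
  assumes \<delta>: "\<delta> > 0" and \<xi>: "\<And>j. \<xi> j \<in> borel_measurable (F (real j * \<delta>))"
    and C: "\<And>j \<omega>. \<omega> \<in> space M \<Longrightarrow> \<bar>\<xi> j \<omega>\<bar> \<le> C"
    and t: "0 \<le> t" "\<And>j \<omega>. \<omega> \<in> space M \<Longrightarrow> real j * \<delta> < t \<Longrightarrow> \<xi> j \<omega> = 0"
    and \<phi>: "\<phi> \<in> borel_measurable (F t)" "\<And>\<omega>. \<omega> \<in> space M \<Longrightarrow> \<bar>\<phi> \<omega>\<bar> \<le> B"
  shows "expectation (\<lambda>\<omega>. \<phi> \<omega> * transform \<delta> \<xi> k \<omega>) = 0"
proof -
  have step: "real k * \<delta> \<ge> 0" "real k * \<delta> < real (Suc k) * \<delta>" for k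
    using \<delta> by (auto simp: mult_strict_right_mono)
  have main: "integrable M (\<lambda>\<omega>. \<phi> \<omega> * \<xi> j \<omega> * (W (real (Suc j) * \<delta>) \<omega> - W (real j * \<delta>) \<omega>)) \<and>
    expectation (\<lambda>\<omega>. \<phi> \<omega> * \<xi> j \<omega> * (W (real (Suc j) * \<delta>) \<omega> - W (real j * \<delta>) \<omega>)) = 0" for j
  proof (cases "real j * \<delta> < t")
    case True
    have "integrable M (\<lambda>\<omega>. \<phi> \<omega> * \<xi> j \<omega> * (W (real (Suc j) * \<delta>) \<omega> - W (real j * \<delta>) \<omega>)) = integrable M (\<lambda>_. 0::real)"
      by (rule Bochner_Integration.integrable_cong) (use t True in auto)
    moreover have "expectation (\<lambda>\<omega>. \<phi> \<omega> * \<xi> j \<omega> * (W (real (Suc j) * \<delta>) \<omega> - W (real j * \<delta>) \<omega>)) = expectation (\<lambda>_. 0::real)"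
      by (rule Bochner_Integration.integral_cong) (use t True in auto)
    ultimately show ?thesis by simp
  next
    case False
    then have m: "(\<lambda>\<omega>. \<phi> \<omega> * \<xi> j \<omega>) \<in> borel_measurable (F (real j * \<delta>))"
      using adapted_mono[OF t(1) _ \<phi>(1), of "real j * \<delta>"] \<xi> by (intro borel_measurable_times) auto
    have "integrable M (\<lambda>\<omega>. \<phi> \<omega> * \<xi> j \<omega>)"
    proof (rule integrable_const_bound[of _ "\<bar>B\<bar> * \<bar>C\<bar>"])
      show "AE \<omega> in M. norm (\<phi> \<omega> * \<xi> j \<omega>) \<le> \<bar>B\<bar> * \<bar>C\<bar>"
      proof (rule AE_I2)
        fix \<omega> assume \<omega>: "\<omega> \<in> space M"
        have "\<bar>\<phi> \<omega>\<bar> \<le> \<bar>B\<bar>" "\<bar>\<xi> j \<omega>\<bar> \<le> \<bar>C\<bar>" using \<phi>(2)[OF \<omega>] C[OF \<omega>, of j] by auto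
        then show "norm (\<phi> \<omega> * \<xi> j \<omega>) \<le> \<bar>B\<bar> * \<bar>C\<bar>"
          by (simp add: abs_mult mult_mono)
      qed
    qed (use m adapted_measurable step(1) in blast)
    from increment_mult(1,2)[OF step m this] show ?thesis by simp
  qed
  have "expectation (\<lambda>\<omega>. \<phi> \<omega> * transform \<delta> \<xi> k \<omega>) =
    expectation (\<lambda>\<omega>. \<Sum>j<k. \<phi> \<omega> * \<xi> j \<omega> * (W (real (Suc j) * \<delta>) \<omega> - W (real j * \<delta>) \<omega>))"
    by (simp add: transform_def sum_distrib_left mult.assoc)
  also have "\<dots> = (\<Sum>j<k. expectation (\<lambda>\<omega>. \<phi> \<omega> * \<xi> j \<omega> * (W (real (Suc j) * \<delta>) \<omega> - W (real j * \<delta>) \<omega>)))"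
    using main by (intro Bochner_Integration.integral_sum) auto
  also have "\<dots> = 0" using main by simp
  finally show ?thesis .
qed

end

section \<open>Euler scheme of an Ito equation\<close>

lemma less_nat_ceiling_iff: "j < nat \<lceil>x\<rceil> \<longleftrightarrow> real j < x"
  by linarith

text \<open>A time with countably many values can be substituted into a process without any joint
  measurability. Rounding \<open>\<tau>\<close> up to multiples of \<open>1 / Suc n\<close> gives
  such times, and path continuity passes to the limit.\<close>

lemma measurable_eval_process:
  fixes Y :: "real \<Rightarrow> 'a \<Rightarrow> real" and \<tau> :: "'a \<Rightarrow> real"
  assumes \<tau>: "\<tau> \<in> borel_measurable M" "\<And>\<omega>. \<omega> \<in> space M \<Longrightarrow> 0 \<le> \<tau> \<omega>"
    and Y: "\<And>t. 0 \<le> t \<Longrightarrow> Y t \<in> borel_measurable M"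
    and cont: "\<And>\<omega>. \<omega> \<in> space M \<Longrightarrow> continuous_on {0..} (\<lambda>t. Y t \<omega>)"
  shows "(\<lambda>\<omega>. Y (\<tau> \<omega>) \<omega>) \<in> borel_measurable M"
proof (rule borel_measurable_LIMSEQ_real)
  let ?k = "\<lambda>n \<omega>. nat \<lceil>\<tau> \<omega> * real (Suc n)\<rceil>"
  fix n
  have "?k n \<in> measurable M (count_space UNIV)" using \<tau>(1) by measurable
  then show "(\<lambda>\<omega>. Y (real (?k n \<omega>) / real (Suc n)) \<omega>) \<in> borel_measurable M"
    by (rule measurable_compose_countable[rotated]) (use Y in auto)
next
  let ?k = "\<lambda>n \<omega>. nat \<lceil>\<tau> \<omega> * real (Suc n)\<rceil>"
  fix \<omega> assume \<omega>: "\<omega> \<in> space M"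
  have "(\<lambda>n. real (?k n \<omega>) / real (Suc n)) \<longlonglongrightarrow> \<tau> \<omega>"
  proof (rule tendsto_sandwich)
    show "\<forall>\<^sub>F n in sequentially. \<tau> \<omega> \<le> real (?k n \<omega>) / real (Suc n)"
      by (intro always_eventually allI) (simp add: field_simps real_nat_ceiling_ge)
    show "\<forall>\<^sub>F n in sequentially. real (?k n \<omega>) / real (Suc n) \<le> \<tau> \<omega> + 1 / real (Suc n)"
    proof (intro always_eventually allI)
      fix n
      have "0 \<le> \<tau> \<omega> * real (Suc n)" using \<tau>(2)[OF \<omega>] by simp
      then have "real (?k n \<omega>) \<le> \<tau> \<omega> * real (Suc n) + 1" by linarith
      then have "real (?k n \<omega>) / real (Suc n) \<le> (\<tau> \<omega> * real (Suc n) + 1) / real (Suc n)"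
        by (intro divide_right_mono) auto
      also have "\<dots> = \<tau> \<omega> + 1 / real (Suc n)" by (simp add: add_divide_distrib del: of_nat_Suc)
      finally show "real (?k n \<omega>) / real (Suc n) \<le> \<tau> \<omega> + 1 / real (Suc n)" .
    qed
    show "(\<lambda>n. \<tau> \<omega> + 1 / real (Suc n)) \<longlonglongrightarrow> \<tau> \<omega>"
      using tendsto_add[OF tendsto_const LIMSEQ_Suc[OF lim_1_over_n], of "\<tau> \<omega>"] by simp
  qed simp
  then show "(\<lambda>n. Y (real (?k n \<omega>) / real (Suc n)) \<omega>) \<longlonglongrightarrow> Y (\<tau> \<omega>) \<omega>"
    by (rule continuous_on_tendsto_compose[OF cont[OF \<omega>]])
      (simp_all only: atLeast_iff \<tau>(2)[OF \<omega>] divide_nonneg_nonneg of_nat_0_le_iff eventually_True)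
qed

section \<open>Stopping times\<close>

context bm
begin

lemma stopping_le: "nn_stopping_time M F \<tau> \<Longrightarrow> 0 \<le> t \<Longrightarrow> {\<omega>\<in>space M. \<tau> \<omega> \<le> t} \<in> sets (F t)"
  unfolding nn_stopping_time_def by blast

lemma stopping_less:
  assumes "nn_stopping_time M F \<tau>" "0 \<le> t"
  shows "{\<omega>\<in>space M. t < \<tau> \<omega>} \<in> sets (F t)"
proof -
  have "{\<omega>\<in>space M. t < \<tau> \<omega>} = space (F t) - {\<omega>\<in>space M. \<tau> \<omega> \<le> t}"
    using space_filtration[OF assms(2)] by auto
  then show ?thesis using sets.compl_sets[OF stopping_le[OF assms]] by simp
qed

lemma stopping_nonneg: "nn_stopping_time M F \<tau> \<Longrightarrow> \<omega> \<in> space M \<Longrightarrow> 0 \<le> \<tau> \<omega>"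
  by (auto simp: nn_stopping_time_def)

lemma stopping_measurable:
  assumes "nn_stopping_time M F \<tau>" shows "\<tau> \<in> borel_measurable M"
proof (rule borel_measurableI_le)
  fix t :: real
  show "{\<omega>\<in>space M. \<tau> \<omega> \<le> t} \<in> sets M"
  proof (cases "0 \<le> t")
    case True then show ?thesis using sets_filtration stopping_le[OF assms] by blast
  next
    case False
    then have "\<not> \<tau> \<omega> \<le> t" if "\<omega> \<in> space M" for \<omega> using stopping_nonneg[OF assms that] by linarith
    then have "{\<omega>\<in>space M. \<tau> \<omega> \<le> t} = {}" by blast
    then show ?thesis by (simp only: sets.empty_sets)
  qed
qed

lemma stopping_min:
  assumes "nn_stopping_time M F \<tau>" "nn_stopping_time M F \<rho>"
  shows "nn_stopping_time M F (\<lambda>\<omega>. min (\<tau> \<omega>) (\<rho> \<omega>))"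
  unfolding nn_stopping_time_def
proof (intro conjI allI impI ballI)
  fix t :: real assume t: "0 \<le> t"
  have "{\<omega>\<in>space M. min (\<tau> \<omega>) (\<rho> \<omega>) \<le> t} = {\<omega>\<in>space M. \<tau> \<omega> \<le> t} \<union> {\<omega>\<in>space M. \<rho> \<omega> \<le> t}" by auto
  then show "{\<omega>\<in>space M. min (\<tau> \<omega>) (\<rho> \<omega>) \<le> t} \<in> sets (F t)"
    using sets.Un[OF stopping_le[OF assms(1) t] stopping_le[OF assms(2) t]] by (simp only:)
qed (use stopping_nonneg assms in simp)

lemma stopping_const: "0 \<le> c \<Longrightarrow> nn_stopping_time M F (\<lambda>_. c)"
  unfolding nn_stopping_time_def
proof (intro conjI allI impI ballI)
  fix t :: real assume "0 \<le> c" "0 \<le> t"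
  then show "{\<omega>\<in>space M. c \<le> t} \<in> sets (F t)"
    using sets.top[of "F t"] space_filtration[of t] by (cases "c \<le> t") simp_all
qed simp

end

text \<open>Of the coefficient only continuity is asked: bounds come from truncating it or from
  stopping the path, not from growth conditions.\<close>

locale ito_solution = bm +
  fixes c :: "real \<Rightarrow> real" and d :: real and X :: "real \<Rightarrow> 'a \<Rightarrow> real"
  assumes c_cont: "continuous_on UNIV c"
    and X_0: "\<And>\<omega>. \<omega> \<in> space M \<Longrightarrow> X 0 \<omega> = d"
    and X_cont: "\<And>\<omega>. \<omega> \<in> space M \<Longrightarrow> continuous_on {0..} (\<lambda>t. X t \<omega>)"
    and X_adapted: "\<And>t. 0 \<le> t \<Longrightarrow> X t \<in> borel_measurable (F t)"
    and ito_sum_lim: "\<And>t \<epsilon>. 0 \<le> t \<Longrightarrow> 0 < \<epsilon> \<Longrightarrow>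
        (\<lambda>n. measure M {\<omega>\<in>space M. \<bar>ito_sum c X W t n \<omega> - (X t \<omega> - d)\<bar> > \<epsilon>}) \<longlonglongrightarrow> 0"
begin

lemma X_measurable: "0 \<le> t \<Longrightarrow> X t \<in> borel_measurable M"
  using adapted_measurable X_adapted by blast

lemma c_measurable: "c \<in> borel_measurable borel"
  using borel_measurable_continuous_onI[OF c_cont] .

lemma cX_adapted: "0 \<le> t \<Longrightarrow> (\<lambda>\<omega>. c (X t \<omega>)) \<in> borel_measurable (F t)"
  using measurable_compose[OF X_adapted c_measurable] .

lemma X_stop_measurable:
  assumes "nn_stopping_time M F \<tau>"
  shows "(\<lambda>\<omega>. X (\<tau> \<omega>) \<omega>) \<in> borel_measurable M"
  using measurable_eval_process[OF stopping_measurable[OF assms] stopping_nonneg[OF assms] X_measurable X_cont] .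

lemma ito_sum_measurable:
  assumes "0 \<le> t" shows "ito_sum c X W t n \<in> borel_measurable M"
proof -
  have "(\<lambda>\<omega>. c (X (real k * t / real n) \<omega>)) \<in> borel_measurable M"
    "W (real k * t / real n) \<in> borel_measurable M" for k
    using adapted_measurable[OF _ cX_adapted] W_measurable assms by auto
  then show ?thesis unfolding ito_sum_def[abs_def]
    by (intro borel_measurable_sum borel_measurable_times borel_measurable_diff)
qed

text \<open>The switch is decided at the left end of each cell, so the increment of the cell that
  contains \<open>\<tau>\<close> is still counted in full; the stopped sum overshoots
  \<open>\<tau>\<close> by less than one cell.\<close>

definition stopped_coeff :: "('a \<Rightarrow> real) \<Rightarrow> real \<Rightarrow> nat \<Rightarrow> 'a \<Rightarrow> real" where
  "stopped_coeff \<tau> \<delta> j \<omega> = (if real j * \<delta> < \<tau> \<omega> then c (X (real j * \<delta>) \<omega>) else 0)"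

lemma stopped_coeff_adapted:
  assumes "nn_stopping_time M F \<tau>" "\<delta> > 0"
  shows "stopped_coeff \<tau> \<delta> j \<in> borel_measurable (F (real j * \<delta>))"
proof -
  have nn: "0 \<le> real j * \<delta>" using assms by simp
  have "{\<omega>\<in>space (F (real j * \<delta>)). real j * \<delta> < \<tau> \<omega>} \<in> sets (F (real j * \<delta>))"
    using stopping_less[OF assms(1) nn] space_filtration[OF nn] by simp
  then show ?thesis unfolding stopped_coeff_def[abs_def]
    by (intro measurable_If cX_adapted[OF nn] borel_measurable_const)
qed

text \<open>Puts the sums for different deterministic end times on one common grid of mesh
  \<open>\<delta>\<close>. For \<open>i = 0\<close> both sums are empty, which disposes of the
  division by zero.\<close>

lemma ito_sum_eq_grid:
  assumes "0 < w"
  shows "ito_sum c X W (real i * (real w * \<delta>)) (i * w) \<omega> =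
    (\<Sum>j<i * w. c (X (real j * \<delta>) \<omega>) * (W (real (Suc j) * \<delta>) \<omega> - W (real j * \<delta>) \<omega>))"
proof (cases "i = 0")
  case False
  have "real k * (real i * (real w * \<delta>)) / real (i * w) = real k * \<delta>" for k
    using assms False by (simp add: field_simps)
  then show ?thesis unfolding ito_sum_def by (simp only:)
qed (simp add: ito_sum_def)

text \<open>A random time cannot be substituted into the defining limit of the Ito integral directly.
  Rounding it up to a coarse grid reduces to finitely many deterministic times, and the increments
  between the time and its rounding have small second moment once the coefficient is truncated.\<close>

lemma transform_tendsto_in_prob:
  assumes \<tau>: "nn_stopping_time M F \<tau>" and T: "0 < T" "\<And>\<omega>. \<omega> \<in> space M \<Longrightarrow> \<tau> \<omega> \<le> T" and \<epsilon>: "0 < \<epsilon>"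
  shows "(\<lambda>p. prob {\<omega>\<in>space M. \<bar>transform (T / 2 ^ p) (stopped_coeff \<tau> (T / 2 ^ p)) (2 ^ p) \<omega> - (X (\<tau> \<omega>) \<omega> - d)\<bar> > 3 * \<epsilon>}) \<longlonglongrightarrow> 0"
proof (rule LIMSEQ_I)
  fix r :: real assume "0 < r"
  \<comment> \<open>One quarter for each of four exceptional events: a large error at some coarse
    grid time, a large move of the path between \<open>\<tau>\<close> and its rounding, a large sum
    over that stretch, and a path leaving a bounded range.\<close>
  define \<eta> where "\<eta> = r / 4"
  have \<eta>: "\<eta> > 0" using \<open>0 < r\<close> by (simp add: \<eta>_def)
  define grid :: "real set" where "grid = {real j * T / 2 ^ p | j p. True}"
  have grid_c: "countable grid"
  proof -
    have "grid = (\<lambda>(j,p). real j * T / 2 ^ p) ` (UNIV :: (nat \<times> nat) set)" by (auto simp: grid_def)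
    then show ?thesis by simp
  qed
  have gridI: "real j * (T / 2 ^ p) \<in> grid" for j p by (force simp: grid_def)
  have grid_nn: "t \<in> grid \<Longrightarrow> 0 \<le> t" for t using T by (auto simp: grid_def)
  \<comment> \<open>Only grid times are inspected, so the union is countable and the event
    measurable. Paths are bounded on \<open>{0..T}\<close>, hence these events decrease to the empty
    set.\<close>
  define bad where "bad R = (\<Union>t\<in>grid \<inter> {0..T}. {\<omega>\<in>space M. real R < \<bar>X t \<omega>\<bar>})" for R :: nat
  have bad_sets: "bad R \<in> sets M" for R
    unfolding bad_def using grid_c grid_nn X_measurable
    by (intro sets.countable_UN'') (auto intro!: countable_Int1)
  have "(\<lambda>R. prob (bad R)) \<longlonglongrightarrow> prob (\<Inter>R. bad R)"
  proof (rule finite_Lim_measure_decseq)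
    show "range bad \<subseteq> sets M" using bad_sets by auto
    show "decseq bad" unfolding decseq_def
    proof (intro allI impI subsetI)
      fix m n \<omega> assume "m \<le> n" "\<omega> \<in> bad n"
      then obtain t where "t \<in> grid \<inter> {0..T}" "\<omega> \<in> space M" "real n < \<bar>X t \<omega>\<bar>" by (auto simp: bad_def)
      moreover have "real m < \<bar>X t \<omega>\<bar>" using \<open>real n < _\<close> \<open>m \<le> n\<close> by linarith
      ultimately show "\<omega> \<in> bad m" unfolding bad_def by blast
    qed
  qed
  moreover have "(\<Inter>R. bad R) = {}"
  proof -
    have "\<exists>R. \<omega> \<notin> bad R" for \<omega>
    proof (cases "\<omega> \<in> space M")
      case True
      have "compact ((\<lambda>t. X t \<omega>) ` {0..T})"
        by (intro compact_continuous_image continuous_on_subset[OF X_cont[OF True]]) auto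
      then have "bounded ((\<lambda>t. X t \<omega>) ` {0..T})" by (rule compact_imp_bounded)
      then obtain K where K: "\<And>t. t \<in> {0..T} \<Longrightarrow> \<bar>X t \<omega>\<bar> \<le> K" unfolding bounded_iff real_norm_def by blast
      obtain R where "K \<le> real R" using real_arch_simple by blast
      then have "\<omega> \<notin> bad R" using K by (force simp: bad_def)
      then show ?thesis ..
    qed (auto simp: bad_def)
    then show ?thesis by blast
  qed
  ultimately have "(\<lambda>R. prob (bad R)) \<longlonglongrightarrow> 0" by simp
  from order_tendstoD(2)[OF this \<eta>] obtain R where R: "prob (bad R) < \<eta>"
    unfolding eventually_sequentially by auto
  \<comment> \<open>The truncated coefficient is bounded everywhere, and off \<open>bad R\<close> it
    agrees with \<open>c\<close> at all grid times in use.\<close>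
  define cR where "cR x = c (max (- real R) (min (real R) x))" for x
  have cR_m: "cR \<in> borel_measurable borel"
    unfolding cR_def[abs_def] by (rule measurable_compose[OF _ c_measurable]) simp
  have "compact (c ` {- real R..real R})"
    by (intro compact_continuous_image continuous_on_subset[OF c_cont]) auto
  from compact_imp_bounded[OF this] obtain K where K: "\<And>x. x \<in> {- real R..real R} \<Longrightarrow> \<bar>c x\<bar> \<le> K"
    unfolding bounded_iff real_norm_def by blast
  have cR_K: "\<bar>cR x\<bar> \<le> K" for x unfolding cR_def by (rule K) auto
  have K0: "K \<ge> 0" using cR_K[of 0] by simp
  \<comment> \<open>\<open>\<kappa> m\<close> counts the coarse cells begun before
    \<open>\<tau>\<close>, so \<open>\<tau>m m\<close> is \<open>\<tau>\<close> rounded up. The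
    coarse level \<open>m\<close> is fixed first; only then does the fine level \<open>p\<close>
    tend to infinity.\<close>
  define \<kappa> where "\<kappa> m \<omega> = nat \<lceil>\<tau> \<omega> / (T / 2 ^ m)\<rceil>" for m :: nat and \<omega>
  define \<tau>m where "\<tau>m m \<omega> = real (\<kappa> m \<omega>) * (T / 2 ^ m)" for m :: nat and \<omega>
  have \<kappa>_iff: "j < \<kappa> m \<omega> \<longleftrightarrow> real j * (T / 2 ^ m) < \<tau> \<omega>" for j m \<omega>
    unfolding \<kappa>_def less_nat_ceiling_iff by (rule pos_less_divide_eq) (use T in simp)
  have \<kappa>_le: "\<kappa> m \<omega> \<le> 2 ^ m" if "\<omega> \<in> space M" for m \<omega>
  proof -
    have "\<not> (2 ^ m < \<kappa> m \<omega>)" using \<kappa>_iff[of "2^m" m \<omega>] T(2)[OF that] T(1) by simp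
    then show ?thesis by simp
  qed
  have \<tau>m_ge: "\<tau> \<omega> \<le> \<tau>m m \<omega>" for m \<omega>
    using \<kappa>_iff[of "\<kappa> m \<omega>" m \<omega>] by (simp add: \<tau>m_def)
  have \<tau>m_le: "\<tau>m m \<omega> \<le> \<tau> \<omega> + T / 2 ^ m" if "\<omega> \<in> space M" for m \<omega>
  proof (cases "\<kappa> m \<omega>")
    case 0 then show ?thesis using stopping_nonneg[OF \<tau> that] T by (simp add: \<tau>m_def)
  next
    case (Suc j)
    then have "real j * (T / 2 ^ m) < \<tau> \<omega>" using \<kappa>_iff[of j m \<omega>] by simp
    then show ?thesis unfolding \<tau>m_def Suc by (simp add: field_simps)
  qed
  have \<tau>m_nn: "0 \<le> \<tau>m m \<omega>" for m \<omega> using T by (simp add: \<tau>m_def)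
  have \<kappa>_meas: "\<kappa> m \<in> measurable M (count_space UNIV)" for m
    unfolding \<kappa>_def[abs_def] using stopping_measurable[OF \<tau>] by measurable
  have X\<tau>m: "(\<lambda>\<omega>. X (\<tau>m m \<omega>) \<omega>) \<in> borel_measurable M" for m
    unfolding \<tau>m_def
    by (rule measurable_compose_countable[OF _ \<kappa>_meas]) (use X_measurable T in auto)
  have T2: "(\<lambda>m. T / 2 ^ m) \<longlonglongrightarrow> 0"
    using tendsto_mult[OF tendsto_const LIMSEQ_power_zero[of "1/2::real"], of T] by (simp add: power_one_over)
  have X\<tau>m_lim: "(\<lambda>m. X (\<tau>m m \<omega>) \<omega>) \<longlonglongrightarrow> X (\<tau> \<omega>) \<omega>" if "\<omega> \<in> space M" for \<omega>
  proof (rule continuous_on_tendsto_compose[OF X_cont[OF that]])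
    show "(\<lambda>m. \<tau>m m \<omega>) \<longlonglongrightarrow> \<tau> \<omega>"
    proof (rule tendsto_sandwich[OF _ _ tendsto_const])
      show "(\<lambda>m. \<tau> \<omega> + T / 2 ^ m) \<longlonglongrightarrow> \<tau> \<omega>" using tendsto_add[OF tendsto_const T2, of "\<tau> \<omega>"] by simp
      show "\<forall>\<^sub>F m in sequentially. \<tau> \<omega> \<le> \<tau>m m \<omega>" using \<tau>m_ge by simp
      show "\<forall>\<^sub>F m in sequentially. \<tau>m m \<omega> \<le> \<tau> \<omega> + T / 2 ^ m" using \<tau>m_le that by simp
    qed
  qed (use \<tau>m_nn stopping_nonneg[OF \<tau> that] in auto)
  have "(\<lambda>m. expectation (\<lambda>\<omega>. if \<epsilon> < \<bar>X (\<tau>m m \<omega>) \<omega> - X (\<tau> \<omega>) \<omega>\<bar> then 1 else 0 :: real)) \<longlonglongrightarrow> expectation (\<lambda>\<omega>. 0)"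
  proof (rule integral_dominated_convergence[where w = "\<lambda>_. 1"])
    fix m show "(\<lambda>\<omega>. if \<epsilon> < \<bar>X (\<tau>m m \<omega>) \<omega> - X (\<tau> \<omega>) \<omega>\<bar> then 1 else 0 :: real) \<in> borel_measurable M"
      using X\<tau>m X_stop_measurable[OF \<tau>] by measurable
    show "AE \<omega> in M. (\<lambda>m. if \<epsilon> < \<bar>X (\<tau>m m \<omega>) \<omega> - X (\<tau> \<omega>) \<omega>\<bar> then 1 else 0 :: real) \<longlonglongrightarrow> 0"
    proof (rule AE_I2)
      fix \<omega> assume \<omega>: "\<omega> \<in> space M"
      from tendstoD[OF X\<tau>m_lim[OF \<omega>] \<epsilon>]
      have "\<forall>\<^sub>F m in sequentially. (if \<epsilon> < \<bar>X (\<tau>m m \<omega>) \<omega> - X (\<tau> \<omega>) \<omega>\<bar> then 1 else 0 :: real) = 0"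
        by eventually_elim (auto simp: dist_real_def)
      then show "(\<lambda>m. if \<epsilon> < \<bar>X (\<tau>m m \<omega>) \<omega> - X (\<tau> \<omega>) \<omega>\<bar> then 1 else 0 :: real) \<longlonglongrightarrow> 0"
        by (rule tendsto_eventually)
    qed
  qed auto
  moreover have "expectation (\<lambda>\<omega>. if \<epsilon> < \<bar>X (\<tau>m m \<omega>) \<omega> - X (\<tau> \<omega>) \<omega>\<bar> then 1 else 0 :: real)
     = prob {\<omega>\<in>space M. \<epsilon> < \<bar>X (\<tau>m m \<omega>) \<omega> - X (\<tau> \<omega>) \<omega>\<bar>}" for m
  proof -
    have "expectation (\<lambda>\<omega>. if \<epsilon> < \<bar>X (\<tau>m m \<omega>) \<omega> - X (\<tau> \<omega>) \<omega>\<bar> then 1 else 0 :: real)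
      = expectation (indicator {\<omega>\<in>space M. \<epsilon> < \<bar>X (\<tau>m m \<omega>) \<omega> - X (\<tau> \<omega>) \<omega>\<bar>})"
      by (rule Bochner_Integration.integral_cong) (auto simp: indicator_def)
    moreover have "{\<omega>\<in>space M. \<epsilon> < \<bar>X (\<tau>m m \<omega>) \<omega> - X (\<tau> \<omega>) \<omega>\<bar>} \<in> sets M"
      using X\<tau>m[of m] X_stop_measurable[OF \<tau>] by measurable
    ultimately show ?thesis by simp
  qed
  ultimately have "(\<lambda>m. prob {\<omega>\<in>space M. \<epsilon> < \<bar>X (\<tau>m m \<omega>) \<omega> - X (\<tau> \<omega>) \<omega>\<bar>}) \<longlonglongrightarrow> 0" by simp
  from order_tendstoD(2)[OF this \<eta>] have ev1: "\<forall>\<^sub>F m in sequentially. prob {\<omega>\<in>space M. \<epsilon> < \<bar>X (\<tau>m m \<omega>) \<omega> - X (\<tau> \<omega>) \<omega>\<bar>} < \<eta>" .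
  \<comment> \<open>The later Chebyshev bound for the sum between \<open>\<tau>\<close> and its
    rounding, a stretch of at most one coarse cell.\<close>
  have "(\<lambda>m. K\<^sup>2 * (T / 2 ^ m) / \<epsilon>\<^sup>2) \<longlonglongrightarrow> K\<^sup>2 * 0 / \<epsilon>\<^sup>2"
    by (intro tendsto_intros T2) (use \<epsilon> in auto)
  then have "(\<lambda>m. K\<^sup>2 * (T / 2 ^ m) / \<epsilon>\<^sup>2) \<longlonglongrightarrow> 0" by simp
  from order_tendstoD(2)[OF this \<eta>] have ev2: "\<forall>\<^sub>F m in sequentially. K\<^sup>2 * (T / 2 ^ m) / \<epsilon>\<^sup>2 < \<eta>" .
  from eventually_conj[OF ev1 ev2] obtain m
    where m1: "prob {\<omega>\<in>space M. \<epsilon> < \<bar>X (\<tau>m m \<omega>) \<omega> - X (\<tau> \<omega>) \<omega>\<bar>} < \<eta>"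
      and m2: "K\<^sup>2 * (T / 2 ^ m) / \<epsilon>\<^sup>2 < \<eta>"
    unfolding eventually_sequentially by blast
  \<comment> \<open>At the coarse time number \<open>i\<close>, the sum with
    \<open>i * 2 ^ (p - m)\<close> points uses exactly the fine grid of mesh
    \<open>T / 2 ^ p\<close>. Only finitely many \<open>i\<close> occur, so one threshold for
    \<open>p\<close> serves all of them.\<close>
  let ?E = "\<lambda>i p. {\<omega>\<in>space M. \<epsilon> < \<bar>ito_sum c X W (real i * (T / 2 ^ m)) (i * 2 ^ (p - m)) \<omega> - (X (real i * (T / 2 ^ m)) \<omega> - d)\<bar>}"
  have E0: "(\<lambda>p. prob (?E i p)) \<longlonglongrightarrow> 0" for i
  proof (cases "i = 0")
    case True
    then have "?E i p = {}" for p using \<epsilon> X_0 by (auto simp: ito_sum_def)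
    then show ?thesis by (simp only: measure_empty tendsto_const)
  next
    case False
    have 1: "filterlim (\<lambda>k. i * 2 ^ k) sequentially sequentially"
    proof (rule filterlim_at_top_mono)
      show "filterlim (\<lambda>k::nat. k) at_top sequentially" by (rule filterlim_ident)
      show "\<forall>\<^sub>F k in sequentially. k \<le> i * 2 ^ k"
      proof (intro always_eventually allI)
        fix k
        have "k \<le> 2 ^ k" by (simp add: less_imp_le)
        also have "\<dots> \<le> i * 2 ^ k" using False by simp
        finally show "k \<le> i * 2 ^ k" .
      qed
    qed
    have 2: "filterlim (\<lambda>p. i * 2 ^ (p - m)) sequentially sequentially"
      by (rule filterlim_compose[OF 1]) (rule filterlim_minus_const_nat_at_top)
    have "0 \<le> real i * (T / 2 ^ m)" using T by simp
    from filterlim_compose[OF ito_sum_lim[OF this \<epsilon>] 2] show ?thesis by simp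
  qed
  then have "(\<lambda>p. \<Sum>i\<le>2 ^ m. prob (?E i p)) \<longlonglongrightarrow> (\<Sum>i\<le>(2::nat) ^ m. 0)" by (intro tendsto_sum)
  then have "(\<lambda>p. \<Sum>i\<le>2 ^ m. prob (?E i p)) \<longlonglongrightarrow> 0" by simp
  from order_tendstoD(2)[OF this \<eta>] have "\<forall>\<^sub>F p in sequentially. (\<Sum>i\<le>2 ^ m. prob (?E i p)) < \<eta>" .
  then obtain P where P: "\<And>p. P \<le> p \<Longrightarrow> (\<Sum>i\<le>2 ^ m. prob (?E i p)) < \<eta>"
    unfolding eventually_sequentially by auto
  let ?Z = "\<lambda>p \<omega>. transform (T / 2 ^ p) (stopped_coeff \<tau> (T / 2 ^ p)) (2 ^ p) \<omega>"
  have "prob {\<omega>\<in>space M. \<bar>?Z p \<omega> - (X (\<tau> \<omega>) \<omega> - d)\<bar> > 3 * \<epsilon>} < r" if p: "max P m \<le> p" for p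
  proof -
    define \<delta> where "\<delta> = T / 2 ^ p"
    have \<delta>: "\<delta> > 0" using T by (simp add: \<delta>_def)
    define w :: nat where "w = 2 ^ (p - m)"
    have w: "0 < w" by (simp add: w_def)
    have pm: "(2::nat) ^ p = 2 ^ m * w" using p by (simp add: w_def power_add[symmetric])
    have pmr: "(2::real) ^ p = 2 ^ m * real w" using pm by (metis of_nat_mult of_nat_numeral of_nat_power)
    have wd: "T / 2 ^ m = real w * \<delta>" using w unfolding \<delta>_def pmr by simp
    \<comment> \<open>The integrand on the fine grid points from \<open>\<tau>\<close> to its
      rounding: what separates the sum up to the rounded time from the stopped sum.\<close>
    define \<xi> where "\<xi> j \<omega> = (if \<tau> \<omega> \<le> real j * \<delta> \<and> j < \<kappa> m \<omega> * w then cR (X (real j * \<delta>) \<omega>) else 0)" for j \<omega>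
    have jkw: "j < \<kappa> m \<omega> * w \<longleftrightarrow> real (j div w) * (T / 2 ^ m) < \<tau> \<omega>" for j \<omega>
      using \<kappa>_iff[of "j div w" m \<omega>] w by (simp add: less_mult_imp_div_less div_less_iff_less_mult)
    \<comment> \<open>Whether \<open>j\<close> lies before the rounded time is settled by comparing
      \<open>\<tau>\<close> with the coarse grid point at or below \<open>j * \<delta>\<close>,
      hence is known at time \<open>j * \<delta>\<close>.\<close>
    have \<xi>_adapted: "\<xi> j \<in> borel_measurable (F (real j * \<delta>))" for j
    proof -
      have nn: "0 \<le> real j * \<delta>" using \<delta> by simp
      have le: "real (j div w) * (T / 2 ^ m) \<le> real j * \<delta>"
      proof -
        have "real (j div w) * real w \<le> real j" by (metis div_times_less_eq_dividend of_nat_le_iff of_nat_mult)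
        then show ?thesis unfolding wd using \<delta> by (simp add: mult.assoc[symmetric] mult_right_mono)
      qed
      have "{\<omega>\<in>space M. \<tau> \<omega> \<le> real j * \<delta>} \<in> sets (F (real j * \<delta>))"
        by (rule stopping_le[OF \<tau> nn])
      moreover have "{\<omega>\<in>space M. real (j div w) * (T / 2 ^ m) < \<tau> \<omega>} \<in> sets (F (real j * \<delta>))"
        by (rule sets_filtration_mono[OF _ le stopping_less[OF \<tau>]]) (use T in auto)
      ultimately have "{\<omega>\<in>space M. \<tau> \<omega> \<le> real j * \<delta>} \<inter> {\<omega>\<in>space M. real (j div w) * (T / 2 ^ m) < \<tau> \<omega>} \<in> sets (F (real j * \<delta>))"
        by (rule sets.Int)
      moreover have "{\<omega>\<in>space M. \<tau> \<omega> \<le> real j * \<delta>} \<inter> {\<omega>\<in>space M. real (j div w) * (T / 2 ^ m) < \<tau> \<omega>}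
        = {\<omega>\<in>space (F (real j * \<delta>)). \<tau> \<omega> \<le> real j * \<delta> \<and> j < \<kappa> m \<omega> * w}"
        using space_filtration[OF nn] jkw by auto
      ultimately have "{\<omega>\<in>space (F (real j * \<delta>)). \<tau> \<omega> \<le> real j * \<delta> \<and> j < \<kappa> m \<omega> * w} \<in> sets (F (real j * \<delta>))" by simp
      then show ?thesis unfolding \<xi>_def[abs_def]
        by (intro measurable_If measurable_compose[OF X_adapted[OF nn] cR_m] borel_measurable_const)
    qed
    have \<xi>_K: "\<bar>\<xi> j \<omega>\<bar> \<le> K" for j \<omega> using cR_K K0 by (simp add: \<xi>_def)
    note tm = transform_moments[OF \<delta> \<xi>_adapted \<xi>_K, of "2^p"]
    have \<xi>M: "\<xi> j \<in> borel_measurable M" for j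
      by (rule adapted_measurable[OF _ \<xi>_adapted]) (use \<delta> in simp)
    have i\<xi>: "integrable M (\<lambda>\<omega>. (\<xi> j \<omega>)\<^sup>2)" for j
    proof (rule integrable_const_bound[of _ "K\<^sup>2"])
      show "AE \<omega> in M. norm ((\<xi> j \<omega>)\<^sup>2) \<le> K\<^sup>2"
        using power_mono[OF \<xi>_K, of _ _ 2] by (intro AE_I2) simp
    qed (use \<xi>M in simp)
    have "(\<Sum>j<2 ^ p. expectation (\<lambda>\<omega>. (\<xi> j \<omega>)\<^sup>2)) = expectation (\<lambda>\<omega>. \<Sum>j<2 ^ p. (\<xi> j \<omega>)\<^sup>2)"
      using i\<xi> by simp
    also have "\<dots> \<le> expectation (\<lambda>\<omega>. real w * K\<^sup>2)"
    proof (rule integral_mono)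
      show "integrable M (\<lambda>\<omega>. \<Sum>j<2 ^ p. (\<xi> j \<omega>)\<^sup>2)" using i\<xi> by simp
      fix \<omega> assume "\<omega> \<in> space M"
      \<comment> \<open>All active points fall into the last coarse cell, so there are at most
        \<open>w\<close> of them.\<close>
      let ?J = "{(\<kappa> m \<omega> - 1) * w..<\<kappa> m \<omega> * w}"
      have J: "j \<in> ?J" if "\<xi> j \<omega> \<noteq> 0" for j
      proof -
        have j: "\<tau> \<omega> \<le> real j * \<delta>" "j < \<kappa> m \<omega> * w" using that by (auto simp: \<xi>_def split: if_splits)
        have "(\<kappa> m \<omega> - 1) * w \<le> j"
        proof (rule ccontr)
          assume a: "\<not> ?thesis"
          then have "\<kappa> m \<omega> - 1 < \<kappa> m \<omega>" by (cases "\<kappa> m \<omega>") auto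
          then have "real (\<kappa> m \<omega> - 1) * (T / 2 ^ m) < \<tau> \<omega>" using \<kappa>_iff by blast
          then have "real (\<kappa> m \<omega> - 1) * (real w * \<delta>) < real j * \<delta>" using j unfolding wd by simp
          then have "real (\<kappa> m \<omega> - 1) * real w < real j" using \<delta> by (simp add: mult.assoc[symmetric])
          then show False using a by (metis of_nat_less_iff of_nat_mult order_less_imp_le)
        qed
        then show ?thesis using j by simp
      qed
      have "(\<Sum>j<2 ^ p. (\<xi> j \<omega>)\<^sup>2) = (\<Sum>j\<in>{..<2 ^ p} \<inter> ?J. (\<xi> j \<omega>)\<^sup>2)"
        by (rule sum.mono_neutral_right) (use J in force)+
      also have "\<dots> \<le> (\<Sum>j\<in>?J. K\<^sup>2)"
      proof -
        have "(\<Sum>j\<in>{..<2 ^ p} \<inter> ?J. (\<xi> j \<omega>)\<^sup>2) \<le> (\<Sum>j\<in>?J. (\<xi> j \<omega>)\<^sup>2)"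
          by (rule sum_mono2) auto
        also have "\<dots> \<le> (\<Sum>j\<in>?J. K\<^sup>2)"
          using power_mono[OF \<xi>_K, of _ _ 2] by (intro sum_mono) simp
        finally show ?thesis .
      qed
      also have "\<dots> = real (\<kappa> m \<omega> * w - (\<kappa> m \<omega> - 1) * w) * K\<^sup>2" by simp
      also have "\<dots> \<le> real w * K\<^sup>2"
        by (intro mult_right_mono) (cases "\<kappa> m \<omega>"; auto)+
      finally show "(\<Sum>j<2 ^ p. (\<xi> j \<omega>)\<^sup>2) \<le> real w * K\<^sup>2" .
    qed simp
    also have "\<dots> = real w * K\<^sup>2" by (simp add: prob_space)
    finally have "(\<Sum>j<2 ^ p. expectation (\<lambda>\<omega>. (\<xi> j \<omega>)\<^sup>2)) * \<delta> \<le> real w * K\<^sup>2 * \<delta>"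
      using \<delta> by (intro mult_right_mono) auto
    then have var: "expectation (\<lambda>\<omega>. (transform \<delta> \<xi> (2 ^ p) \<omega>)\<^sup>2) \<le> K\<^sup>2 * (T / 2 ^ m)"
      unfolding tm(4) wd by (simp add: algebra_simps)
    have tmM: "transform \<delta> \<xi> (2 ^ p) \<in> borel_measurable M"
      by (rule adapted_measurable[OF _ tm(1)]) (use \<delta> in simp)
    have cheb: "prob {\<omega>\<in>space M. \<epsilon> < \<bar>transform \<delta> \<xi> (2 ^ p) \<omega>\<bar>} < \<eta>"
    proof -
      have "prob {\<omega>\<in>space M. \<epsilon> < \<bar>transform \<delta> \<xi> (2 ^ p) \<omega>\<bar>} \<le> prob {\<omega>\<in>space M. \<epsilon>\<^sup>2 \<le> (transform \<delta> \<xi> (2 ^ p) \<omega>)\<^sup>2}"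
        using \<epsilon> tmM by (intro finite_measure_mono) (auto simp: abs_le_square_iff[symmetric])
      also have "\<dots> \<le> expectation (\<lambda>\<omega>. (transform \<delta> \<xi> (2 ^ p) \<omega>)\<^sup>2) / \<epsilon>\<^sup>2"
        using integral_Markov_inequality_measure[OF tm(3), of "{}" "\<epsilon>\<^sup>2"] \<epsilon> by simp
      also have "\<dots> \<le> K\<^sup>2 * (T / 2 ^ m) / \<epsilon>\<^sup>2"
        using var \<epsilon> by (intro divide_right_mono) auto
      also note m2
      finally show ?thesis .
    qed
    have Zm: "?Z p \<in> borel_measurable M"
    proof -
      have "stopped_coeff \<tau> \<delta> j \<in> borel_measurable M" for j
        by (rule adapted_measurable[OF _ stopped_coeff_adapted[OF \<tau> \<delta>]]) (use \<delta> in simp)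
      then show ?thesis using W_measurable \<delta>
        unfolding transform_def[abs_def] \<delta>_def[symmetric]
        by (intro borel_measurable_sum borel_measurable_times borel_measurable_diff) auto
    qed
    have split: "?Z p \<omega> = ito_sum c X W (real (\<kappa> m \<omega>) * (T / 2 ^ m)) (\<kappa> m \<omega> * w) \<omega> - transform \<delta> \<xi> (2 ^ p) \<omega>"
      if \<omega>: "\<omega> \<in> space M" "\<omega> \<notin> bad R" for \<omega>
    proof -
      let ?D = "\<lambda>j. W (real (Suc j) * \<delta>) \<omega> - W (real j * \<delta>) \<omega>"
      have kw: "\<kappa> m \<omega> * w \<le> 2 ^ p" unfolding pm using \<kappa>_le[OF \<omega>(1)] by simp
      have cc: "cR (X (real j * \<delta>) \<omega>) = c (X (real j * \<delta>) \<omega>)" if "j < 2 ^ p" for j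
      proof -
        have "real j \<le> 2 ^ p" using that by (metis less_imp_le of_nat_le_iff of_nat_numeral of_nat_power)
        then have "real j * \<delta> \<le> T" unfolding \<delta>_def using T by (simp add: field_simps)
        then have "real j * \<delta> \<in> grid \<inter> {0..T}" using \<delta> gridI[of j p] unfolding \<delta>_def by (simp only: Int_iff atLeastAtMost_iff grid_nn simp_thms)
        then have "\<bar>X (real j * \<delta>) \<omega>\<bar> \<le> real R" using \<omega> unfolding bad_def by force
        then have "max (- real R) (min (real R) (X (real j * \<delta>) \<omega>)) = X (real j * \<delta>) \<omega>" by linarith
        then show ?thesis by (simp add: cR_def)
      qed
      have lt: "j < \<kappa> m \<omega> * w" if "real j * \<delta> < \<tau> \<omega>" for j
      proof -
        have "real j * \<delta> < real (\<kappa> m \<omega>) * (real w * \<delta>)" using that \<tau>m_ge[of \<omega> m] unfolding \<tau>m_def wd by simp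
        then have "real j < real (\<kappa> m \<omega>) * real w" using \<delta> by (simp add: mult.assoc[symmetric])
        then show ?thesis by (metis of_nat_less_iff of_nat_mult)
      qed
      have "ito_sum c X W (real (\<kappa> m \<omega>) * (T / 2 ^ m)) (\<kappa> m \<omega> * w) \<omega> = (\<Sum>j<\<kappa> m \<omega> * w. c (X (real j * \<delta>) \<omega>) * ?D j)"
        unfolding wd by (rule ito_sum_eq_grid[OF w])
      also have "\<dots> = (\<Sum>j<\<kappa> m \<omega> * w. stopped_coeff \<tau> \<delta> j \<omega> * ?D j + \<xi> j \<omega> * ?D j)"
        using kw cc by (intro sum.cong) (auto simp: stopped_coeff_def \<xi>_def)
      also have "\<dots> = (\<Sum>j<2 ^ p. stopped_coeff \<tau> \<delta> j \<omega> * ?D j + \<xi> j \<omega> * ?D j)"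
      proof (rule sum.mono_neutral_left)
        show "\<forall>j\<in>{..<2 ^ p} - {..<\<kappa> m \<omega> * w}. stopped_coeff \<tau> \<delta> j \<omega> * ?D j + \<xi> j \<omega> * ?D j = 0"
        proof
          fix j assume "j \<in> {..<2 ^ p} - {..<\<kappa> m \<omega> * w}"
          then have "\<not> j < \<kappa> m \<omega> * w" by simp
          moreover from this have "\<not> real j * \<delta> < \<tau> \<omega>" using lt by blast
          ultimately show "stopped_coeff \<tau> \<delta> j \<omega> * ?D j + \<xi> j \<omega> * ?D j = 0"
            by (simp only: stopped_coeff_def \<xi>_def) simp
        qed
      qed (use kw in auto)
      also have "\<dots> = ?Z p \<omega> + transform \<delta> \<xi> (2 ^ p) \<omega>"
        by (simp add: transform_def sum.distrib \<delta>_def)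
      finally show ?thesis by simp
    qed
    let ?G = "{\<omega>\<in>space M. \<epsilon> < \<bar>X (\<tau>m m \<omega>) \<omega> - X (\<tau> \<omega>) \<omega>\<bar>}"
    let ?H = "{\<omega>\<in>space M. \<epsilon> < \<bar>transform \<delta> \<xi> (2 ^ p) \<omega>\<bar>}"
    have Em: "?E i p \<in> sets M" for i
      using ito_sum_measurable[of "real i * (T / 2 ^ m)" "i * 2 ^ (p - m)"] X_measurable[of "real i * (T / 2 ^ m)"] T by simp
    have Gm: "?G \<in> sets M" using X\<tau>m[of m] X_stop_measurable[OF \<tau>] by simp
    have Hm: "?H \<in> sets M" using tmM by simp
    have EUm: "(\<Union>i\<in>{..2 ^ m}. ?E i p) \<in> sets M" using Em by auto
    have "{\<omega>\<in>space M. \<bar>?Z p \<omega> - (X (\<tau> \<omega>) \<omega> - d)\<bar> > 3 * \<epsilon>} \<subseteq> (\<Union>i\<in>{..2 ^ m}. ?E i p) \<union> ?G \<union> ?H \<union> bad R"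
    proof (rule subsetI, rule ccontr)
      fix \<omega> assume \<omega>: "\<omega> \<in> {\<omega>\<in>space M. \<bar>?Z p \<omega> - (X (\<tau> \<omega>) \<omega> - d)\<bar> > 3 * \<epsilon>}"
        and n: "\<omega> \<notin> (\<Union>i\<in>{..2 ^ m}. ?E i p) \<union> ?G \<union> ?H \<union> bad R"
      have \<omega>M: "\<omega> \<in> space M" using \<omega> by simp
      have "\<omega> \<notin> ?E (\<kappa> m \<omega>) p" using n \<kappa>_le[OF \<omega>M, of m] by blast
      then have 1: "\<bar>ito_sum c X W (real (\<kappa> m \<omega>) * (T / 2 ^ m)) (\<kappa> m \<omega> * w) \<omega> - (X (\<tau>m m \<omega>) \<omega> - d)\<bar> \<le> \<epsilon>"
        using \<omega>M unfolding w_def \<tau>m_def by auto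
      have 2: "\<bar>X (\<tau>m m \<omega>) \<omega> - X (\<tau> \<omega>) \<omega>\<bar> \<le> \<epsilon>" "\<bar>transform \<delta> \<xi> (2 ^ p) \<omega>\<bar> \<le> \<epsilon>" "\<omega> \<notin> bad R"
        using n \<omega>M by auto
      show False using 1 2(1,2) split[OF \<omega>M 2(3)] \<omega> by auto
    qed
    then have "prob {\<omega>\<in>space M. \<bar>?Z p \<omega> - (X (\<tau> \<omega>) \<omega> - d)\<bar> > 3 * \<epsilon>} \<le> prob ((\<Union>i\<in>{..2 ^ m}. ?E i p) \<union> ?G \<union> ?H \<union> bad R)"
      by (rule finite_measure_mono[OF _ sets.Un[OF sets.Un[OF sets.Un[OF EUm Gm] Hm] bad_sets]])
    also have "\<dots> \<le> prob ((\<Union>i\<in>{..2 ^ m}. ?E i p) \<union> ?G \<union> ?H) + prob (bad R)"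
      by (rule measure_Un_le[OF sets.Un[OF sets.Un[OF EUm Gm] Hm] bad_sets])
    also have "prob ((\<Union>i\<in>{..2 ^ m}. ?E i p) \<union> ?G \<union> ?H) \<le> prob ((\<Union>i\<in>{..2 ^ m}. ?E i p) \<union> ?G) + prob ?H"
      by (rule measure_Un_le[OF sets.Un[OF EUm Gm] Hm])
    also have "prob ((\<Union>i\<in>{..2 ^ m}. ?E i p) \<union> ?G) \<le> prob (\<Union>i\<in>{..2 ^ m}. ?E i p) + prob ?G"
      by (rule measure_Un_le[OF EUm Gm])
    also have "prob (\<Union>i\<in>{..2 ^ m}. ?E i p) \<le> (\<Sum>i\<le>2 ^ m. prob (?E i p))"
      by (rule measure_UNION_le[OF _ Em]) simp
    finally show ?thesis using P[of p] p m1 cheb R unfolding \<eta>_def by simp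
  qed
  then show "\<exists>no. \<forall>p\<ge>no. norm (prob {\<omega>\<in>space M. \<bar>?Z p \<omega> - (X (\<tau> \<omega>) \<omega> - d)\<bar> > 3 * \<epsilon>} - 0) < r"
    by (intro exI[of _ "max P m"]) auto
qed

end

text \<open>Bounded second moments give uniform integrability. The explicit form is the inequality
  \<open>pt\<close>, obtained by completing a square: it trades a small multiple of the square
  against a large multiple of the probability of a deviation.\<close>

lemma (in prob_space) tendsto_L1_of_prob:
  fixes Y :: "nat \<Rightarrow> 'a \<Rightarrow> real"
  assumes Y: "\<And>p. Y p \<in> borel_measurable M" "\<And>p. integrable M (Y p)" "\<And>p. integrable M (\<lambda>\<omega>. (Y p \<omega>)\<^sup>2)"
    and Q: "\<And>p. expectation (\<lambda>\<omega>. (Y p \<omega>)\<^sup>2) \<le> Q"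
    and lim: "\<And>\<epsilon>. 0 < \<epsilon> \<Longrightarrow> (\<lambda>p. prob {\<omega>\<in>space M. \<epsilon> < \<bar>Y p \<omega>\<bar>}) \<longlonglongrightarrow> 0"
  shows "(\<lambda>p. expectation (\<lambda>\<omega>. \<bar>Y p \<omega>\<bar>)) \<longlonglongrightarrow> 0"
proof (rule LIMSEQ_I)
  fix r :: real assume r: "0 < r"
  have Q0: "0 \<le> Q" using order_trans[OF _ Q[of 0], of 0] by simp
  \<comment> \<open>The choices make \<open>\<epsilon>\<close> and \<open>\<eta> * Q\<close> at most
    \<open>r / 4\<close>, while probabilities below \<open>\<eta> * r\<close> turn the weight
    \<open>1 / (4 * \<eta>)\<close> into another \<open>r / 4\<close>; the total stays below
    \<open>r\<close>.\<close>
  define \<epsilon> where "\<epsilon> = r / 4"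
  define \<eta> where "\<eta> = r / (4 * (Q + 1))"
  have \<epsilon>: "0 < \<epsilon>" and \<eta>: "0 < \<eta>" using r Q0 by (auto simp: \<epsilon>_def \<eta>_def)
  have "0 < \<eta> * r" using \<eta> r by simp
  from order_tendstoD(2)[OF lim[OF \<epsilon>] this] obtain N
    where N: "\<And>p. N \<le> p \<Longrightarrow> prob {\<omega>\<in>space M. \<epsilon> < \<bar>Y p \<omega>\<bar>} < \<eta> * r"
    unfolding eventually_sequentially by blast
  have "expectation (\<lambda>\<omega>. \<bar>Y p \<omega>\<bar>) < r" if p: "N \<le> p" for p
  proof -
    let ?A = "{\<omega>\<in>space M. \<epsilon> < \<bar>Y p \<omega>\<bar>}"
    have A: "?A \<in> sets M" using Y(1)[of p] by measurable
    have pt: "\<bar>y\<bar> \<le> \<epsilon> + \<eta> * y\<^sup>2 + (if \<epsilon> < \<bar>y\<bar> then 1 / (4 * \<eta>) else 0)" for y :: real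
    proof (cases "\<epsilon> < \<bar>y\<bar>")
      case True
      have "0 \<le> \<eta> * (\<bar>y\<bar> - 1 / (2 * \<eta>))\<^sup>2" using \<eta> by simp
      also have "\<dots> = \<eta> * y\<^sup>2 - \<bar>y\<bar> + 1 / (4 * \<eta>)"
        using \<eta> by (simp add: power2_diff field_simps power2_eq_square)
      finally show ?thesis using True \<epsilon> by simp
    next
      case False then show ?thesis using \<eta> by (simp add: add_increasing2)
    qed
    have iA0: "integrable M (indicator ?A :: 'a \<Rightarrow> real)"
      using A by (intro integrable_real_indicator) (auto simp: emeasure_eq_measure)
    have iA: "integrable M (\<lambda>\<omega>. 1 / (4 * \<eta>) * indicator ?A \<omega>)"
      using iA0 by (rule integrable_mult_right)
    have "expectation (\<lambda>\<omega>. \<bar>Y p \<omega>\<bar>) \<le> expectation (\<lambda>\<omega>. \<epsilon> + \<eta> * (Y p \<omega>)\<^sup>2 + 1 / (4 * \<eta>) * indicator ?A \<omega>)"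
    proof (rule integral_mono)
      show "integrable M (\<lambda>\<omega>. \<epsilon> + \<eta> * (Y p \<omega>)\<^sup>2 + 1 / (4 * \<eta>) * indicator ?A \<omega>)"
        using Y(3)[of p] by (intro Bochner_Integration.integrable_add iA) auto
      show "\<bar>Y p \<omega>\<bar> \<le> \<epsilon> + \<eta> * (Y p \<omega>)\<^sup>2 + 1 / (4 * \<eta>) * indicator ?A \<omega>" if "\<omega> \<in> space M" for \<omega>
        using pt[of "Y p \<omega>"] that by (cases "\<epsilon> < \<bar>Y p \<omega>\<bar>") simp_all
    qed (use Y in auto)
    also have "\<dots> = \<epsilon> + \<eta> * expectation (\<lambda>\<omega>. (Y p \<omega>)\<^sup>2) + 1 / (4 * \<eta>) * prob ?A"
      using Y(3)[of p] iA0 A by (simp add: prob_space)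
    also have "\<dots> < \<epsilon> + \<eta> * Q + r / 4 + r / 4"
    proof -
      have "1 / (4 * \<eta>) * prob ?A < 1 / (4 * \<eta>) * (\<eta> * r)"
        using N[OF p] \<eta> by (intro mult_strict_left_mono) auto
      also have "\<dots> = r / 4" using \<eta> by simp
      finally have "1 / (4 * \<eta>) * prob ?A < r / 4" .
      moreover have "\<eta> * expectation (\<lambda>\<omega>. (Y p \<omega>)\<^sup>2) \<le> \<eta> * Q"
        using \<eta> by (intro mult_left_mono Q) simp
      ultimately show ?thesis using r by linarith
    qed
    also have "\<eta> * Q \<le> r / 4"
    proof -
      have "\<eta> * Q \<le> \<eta> * (Q + 1)" using \<eta> by simp
      also have "\<dots> = r / 4" using Q0 unfolding \<eta>_def by (simp add: divide_simps)
      finally show ?thesis .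
    qed
    finally show ?thesis by (simp add: \<epsilon>_def)
  qed
  moreover have "0 \<le> expectation (\<lambda>\<omega>. \<bar>Y p \<omega>\<bar>)" for p by simp
  ultimately show "\<exists>N. \<forall>p\<ge>N. norm (expectation (\<lambda>\<omega>. \<bar>Y p \<omega>\<bar>) - 0) < r"
    by (intro exI[of _ N]) auto
qed

section \<open>Convergence of the scheme in L1\<close>

context ito_solution
begin

text \<open>Unlike in a numerical Euler scheme, the coefficient is evaluated along the solution
  itself, not along the scheme. The result is therefore a plain martingale transform, and no errors
  feed back.\<close>

definition euler :: "('a \<Rightarrow> real) \<Rightarrow> real \<Rightarrow> nat \<Rightarrow> nat \<Rightarrow> 'a \<Rightarrow> real" where
  "euler \<tau> T p = transform (T / 2 ^ p) (stopped_coeff \<tau> (T / 2 ^ p))"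

definition euler_gap :: "('a \<Rightarrow> real) \<Rightarrow> real \<Rightarrow> nat \<Rightarrow> 'a \<Rightarrow> real" where
  "euler_gap \<tau> T p \<omega> = euler \<tau> T p (2 ^ p) \<omega> - (X (\<tau> \<omega>) \<omega> - d)"

definition bounded_until :: "('a \<Rightarrow> real) \<Rightarrow> real \<Rightarrow> bool" where
  "bounded_until \<tau> L \<longleftrightarrow> (\<forall>\<omega>\<in>space M. \<forall>t\<ge>0. t \<le> \<tau> \<omega> \<longrightarrow> \<bar>X t \<omega>\<bar> \<le> L \<and> \<bar>c (X t \<omega>)\<bar> \<le> L)"

lemma bounded_until_min: "bounded_until \<tau> L \<Longrightarrow> bounded_until (\<lambda>\<omega>. min (\<tau> \<omega>) (\<rho> \<omega>)) L"
  by (auto simp: bounded_until_def)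

lemma stopped_coeff_bound:
  assumes "bounded_until \<tau> L" "0 \<le> L" "0 < \<delta>" "\<omega> \<in> space M"
  shows "\<bar>stopped_coeff \<tau> \<delta> j \<omega>\<bar> \<le> L"
proof -
  have "0 \<le> real j * \<delta>" using assms(3) by simp
  then have "real j * \<delta> < \<tau> \<omega> \<Longrightarrow> \<bar>c (X (real j * \<delta>) \<omega>)\<bar> \<le> L"
    using assms(1,4) unfolding bounded_until_def by (blast intro: less_imp_le)
  then show ?thesis using assms(2) by (simp add: stopped_coeff_def)
qed

text \<open>The point is the last bound, which does not depend on the mesh: by the isometry, at most
  \<open>2 ^ p\<close> terms of size \<open>L\<^sup>2\<close> are weighted by
  \<open>T / 2 ^ p\<close>.\<close>

lemma euler_moments:
  assumes \<tau>: "nn_stopping_time M F \<tau>" and T: "0 < T" and L: "bounded_until \<tau> L" "0 \<le> L"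
  shows "euler \<tau> T p k \<in> borel_measurable (F (real k * (T / 2 ^ p)))"
    and "euler \<tau> T p k \<in> borel_measurable M"
    and "integrable M (euler \<tau> T p k)"
    and "integrable M (\<lambda>\<omega>. (euler \<tau> T p k \<omega>)\<^sup>2)"
    and "expectation (\<lambda>\<omega>. (euler \<tau> T p (2 ^ p) \<omega>)\<^sup>2) \<le> L\<^sup>2 * T"
proof -
  have \<delta>: "0 < T / 2 ^ p" using T by simp
  let ?\<xi> = "stopped_coeff \<tau> (T / 2 ^ p)"
  note b = stopped_coeff_bound[OF L \<delta>]
  note tm = transform_moments[where \<xi>="?\<xi>", OF \<delta> stopped_coeff_adapted[OF \<tau> \<delta>] b]
  show m: "euler \<tau> T p k \<in> borel_measurable (F (real k * (T / 2 ^ p)))" "integrable M (euler \<tau> T p k)"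
    "integrable M (\<lambda>\<omega>. (euler \<tau> T p k \<omega>)\<^sup>2)" for k
    unfolding euler_def by (rule tm(1,2,3); assumption)+
  show "euler \<tau> T p k \<in> borel_measurable M" using m(2)[of k] by (rule borel_measurable_integrable)
  have "expectation (\<lambda>\<omega>. (?\<xi> j \<omega>)\<^sup>2) \<le> L\<^sup>2" for j
  proof -
    have "?\<xi> j \<in> borel_measurable M"
      by (rule adapted_measurable[OF _ stopped_coeff_adapted[OF \<tau> \<delta>]]) (use T in simp)
    moreover have "norm ((?\<xi> j \<omega>)\<^sup>2) \<le> L\<^sup>2" if "\<omega> \<in> space M" for \<omega>
      using power_mono[OF b[OF that, of j], of 2] by simp
    ultimately have "integrable M (\<lambda>\<omega>. (?\<xi> j \<omega>)\<^sup>2)"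
      by (intro integrable_const_bound[of _ "L\<^sup>2"] AE_I2) auto
    then have "expectation (\<lambda>\<omega>. (?\<xi> j \<omega>)\<^sup>2) \<le> expectation (\<lambda>_. L\<^sup>2)"
      using \<open>\<And>\<omega>. \<omega> \<in> space M \<Longrightarrow> norm ((?\<xi> j \<omega>)\<^sup>2) \<le> L\<^sup>2\<close> by (intro integral_mono) auto
    then show ?thesis by (simp add: prob_space)
  qed
  then have "(\<Sum>j<2 ^ p. expectation (\<lambda>\<omega>. (?\<xi> j \<omega>)\<^sup>2)) \<le> (\<Sum>j<(2::nat) ^ p. L\<^sup>2)" by (intro sum_mono)
  then have "(\<Sum>j<2 ^ p. expectation (\<lambda>\<omega>. (?\<xi> j \<omega>)\<^sup>2)) * (T / 2 ^ p) \<le> (2 ^ p * L\<^sup>2) * (T / 2 ^ p)"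
    using \<delta> by (intro mult_right_mono) auto
  then show "expectation (\<lambda>\<omega>. (euler \<tau> T p (2 ^ p) \<omega>)\<^sup>2) \<le> L\<^sup>2 * T"
    unfolding euler_def by (subst tm(4)) auto
qed

lemma X_stop_integrable:
  assumes \<tau>: "nn_stopping_time M F \<tau>" and L: "bounded_until \<tau> L"
  shows "integrable M (\<lambda>\<omega>. X (\<tau> \<omega>) \<omega>)" "\<And>\<omega>. \<omega> \<in> space M \<Longrightarrow> \<bar>X (\<tau> \<omega>) \<omega>\<bar> \<le> L"
proof -
  show b: "\<bar>X (\<tau> \<omega>) \<omega>\<bar> \<le> L" if "\<omega> \<in> space M" for \<omega>
    using L stopping_nonneg[OF \<tau> that] that unfolding bounded_until_def by blast
  show "integrable M (\<lambda>\<omega>. X (\<tau> \<omega>) \<omega>)"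
    by (rule integrable_const_bound[of _ L]) (use b X_stop_measurable[OF \<tau>] in auto)
qed

text \<open>Convergence in probability at the random time \<open>\<tau>\<close> is known; the
  mesh-independent second moment upgrades it to L1.\<close>

lemma euler_gap_L1:
  assumes \<tau>: "nn_stopping_time M F \<tau>" and T: "0 < T" "\<And>\<omega>. \<omega> \<in> space M \<Longrightarrow> \<tau> \<omega> \<le> T"
    and L: "bounded_until \<tau> L" "0 \<le> L"
  shows "integrable M (euler_gap \<tau> T p)"
    and "(\<lambda>p. expectation (\<lambda>\<omega>. \<bar>euler_gap \<tau> T p \<omega>\<bar>)) \<longlonglongrightarrow> 0"
proof -
  note e = euler_moments[OF \<tau> T(1) L]
  note x = X_stop_integrable[OF \<tau> L(1)]
  have i: "integrable M (euler_gap \<tau> T p)" for p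
    unfolding euler_gap_def[abs_def] using e(3) x(1) by (intro Bochner_Integration.integrable_diff) auto
  then show "integrable M (euler_gap \<tau> T p)" .
  have m: "euler_gap \<tau> T p \<in> borel_measurable M" for p using i by (rule borel_measurable_integrable)
  let ?B = "\<lambda>p \<omega>. 2 * (euler \<tau> T p (2 ^ p) \<omega>)\<^sup>2 + 2 * (L + \<bar>d\<bar>)\<^sup>2"
  have B: "(euler_gap \<tau> T p \<omega>)\<^sup>2 \<le> ?B p \<omega>" if "\<omega> \<in> space M" for p \<omega>
  proof -
    have "(u - v)\<^sup>2 \<le> 2 * u\<^sup>2 + 2 * v\<^sup>2" for u v :: real
      using zero_le_power2[of "u + v"] by (simp add: power2_eq_square algebra_simps)
    then have "(euler_gap \<tau> T p \<omega>)\<^sup>2 \<le> 2 * (euler \<tau> T p (2 ^ p) \<omega>)\<^sup>2 + 2 * (X (\<tau> \<omega>) \<omega> - d)\<^sup>2"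
      unfolding euler_gap_def .
    moreover have "\<bar>X (\<tau> \<omega>) \<omega> - d\<bar> \<le> \<bar>L + \<bar>d\<bar>\<bar>" using x(2)[OF that] by linarith
    then have "(X (\<tau> \<omega>) \<omega> - d)\<^sup>2 \<le> (L + \<bar>d\<bar>)\<^sup>2" by (simp only: abs_le_square_iff)
    ultimately show ?thesis by linarith
  qed
  have iB: "integrable M (?B p)" for p using e(4) by auto
  have i2: "integrable M (\<lambda>\<omega>. (euler_gap \<tau> T p \<omega>)\<^sup>2)" for p
    by (rule Bochner_Integration.integrable_bound[OF iB]) (use B m in auto)
  show "(\<lambda>p. expectation (\<lambda>\<omega>. \<bar>euler_gap \<tau> T p \<omega>\<bar>)) \<longlonglongrightarrow> 0"
  proof (rule tendsto_L1_of_prob[OF m i i2])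
    fix p
    have "expectation (\<lambda>\<omega>. (euler_gap \<tau> T p \<omega>)\<^sup>2) \<le> expectation (?B p)"
      by (rule integral_mono[OF i2 iB B])
    also have "\<dots> = 2 * expectation (\<lambda>\<omega>. (euler \<tau> T p (2 ^ p) \<omega>)\<^sup>2) + 2 * (L + \<bar>d\<bar>)\<^sup>2"
      using e(4) by (subst Bochner_Integration.integral_add) (auto simp: prob_space)
    also have "\<dots> \<le> 2 * (L\<^sup>2 * T) + 2 * (L + \<bar>d\<bar>)\<^sup>2" using e(5) by simp
    finally show "expectation (\<lambda>\<omega>. (euler_gap \<tau> T p \<omega>)\<^sup>2) \<le> 2 * (L\<^sup>2 * T) + 2 * (L + \<bar>d\<bar>)\<^sup>2" .
  next
    fix \<epsilon> :: real assume "0 < \<epsilon>"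
    then have "0 < \<epsilon> / 3" by simp
    from transform_tendsto_in_prob[OF \<tau> T this]
    show "(\<lambda>p. prob {\<omega>\<in>space M. \<epsilon> < \<bar>euler_gap \<tau> T p \<omega>\<bar>}) \<longlonglongrightarrow> 0"
      unfolding euler_gap_def euler_def by simp
  qed
qed

lemma integrable_bounded_mult:
  assumes "integrable M Y" "\<phi> \<in> borel_measurable M" "\<And>\<omega>. \<omega> \<in> space M \<Longrightarrow> \<bar>\<phi> \<omega>\<bar> \<le> B"
  shows "integrable M (\<lambda>\<omega>. \<phi> \<omega> * Y \<omega> :: real)"
proof (rule Bochner_Integration.integrable_bound[of M "\<lambda>\<omega>. B * Y \<omega>"])
  show "AE \<omega> in M. norm (\<phi> \<omega> * Y \<omega>) \<le> norm (B * Y \<omega>)"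
  proof (rule AE_I2)
    fix \<omega> assume "\<omega> \<in> space M"
    then have "\<bar>\<phi> \<omega>\<bar> \<le> \<bar>B\<bar>" using assms(3) by fastforce
    then show "norm (\<phi> \<omega> * Y \<omega>) \<le> norm (B * Y \<omega>)" by (simp add: abs_mult mult_right_mono)
  qed
qed (use assms in auto)

text \<open>Optional stopping, tested against bounded functions known at \<open>t\<close>. The
  schemes for \<open>\<tau>\<close> and for \<open>min \<tau> t\<close> are exactly orthogonal in
  this sense, and both terminal gaps vanish in L1, so the identity is inherited by the
  solution.\<close>

lemma stopped_martingale:
  assumes \<tau>: "nn_stopping_time M F \<tau>" and T: "0 < T" "\<And>\<omega>. \<omega> \<in> space M \<Longrightarrow> \<tau> \<omega> \<le> T"
    and L: "bounded_until \<tau> L" "0 \<le> L"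
    and t: "0 \<le> t" and \<phi>: "\<phi> \<in> borel_measurable (F t)" "\<And>\<omega>. \<omega> \<in> space M \<Longrightarrow> \<bar>\<phi> \<omega>\<bar> \<le> B"
  shows "expectation (\<lambda>\<omega>. \<phi> \<omega> * (X (\<tau> \<omega>) \<omega> - X (min (\<tau> \<omega>) t) \<omega>)) = 0"
proof -
  let ?\<rho> = "\<lambda>\<omega>. min (\<tau> \<omega>) t"
  have \<rho>: "nn_stopping_time M F ?\<rho>" by (rule stopping_min[OF \<tau> stopping_const[OF t]])
  have L\<rho>: "bounded_until ?\<rho> L" by (rule bounded_until_min[OF L(1)])
  have \<rho>T: "?\<rho> \<omega> \<le> T" if "\<omega> \<in> space M" for \<omega> using T(2)[OF that] by simp
  have \<phi>M: "\<phi> \<in> borel_measurable M" using adapted_measurable[OF t \<phi>(1)] .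
  note g1 = euler_gap_L1[OF \<tau> T L] and g2 = euler_gap_L1[OF \<rho> T(1) \<rho>T L\<rho> L(2)]
  let ?v = "expectation (\<lambda>\<omega>. \<phi> \<omega> * (X (\<tau> \<omega>) \<omega> - X (?\<rho> \<omega>) \<omega>))"
  have "\<bar>?v\<bar> \<le> B * (expectation (\<lambda>\<omega>. \<bar>euler_gap \<tau> T p \<omega>\<bar>) + expectation (\<lambda>\<omega>. \<bar>euler_gap ?\<rho> T p \<omega>\<bar>))" for p
  proof -
    let ?\<delta> = "T / 2 ^ p"
    have \<delta>: "0 < ?\<delta>" using T by simp
    \<comment> \<open>Before time \<open>t\<close> the conditions for running under
      \<open>\<tau>\<close> and under the minimum coincide, so the difference starts only at
      \<open>t\<close>.\<close>
    let ?\<xi> = "\<lambda>j \<omega>. stopped_coeff \<tau> ?\<delta> j \<omega> - stopped_coeff ?\<rho> ?\<delta> j \<omega>"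
    have o: "expectation (\<lambda>\<omega>. \<phi> \<omega> * transform ?\<delta> ?\<xi> (2 ^ p) \<omega>) = 0"
    proof (rule transform_orthogonal[OF \<delta> _ _ t _ \<phi>])
      fix j show "?\<xi> j \<in> borel_measurable (F (real j * ?\<delta>))"
        by (intro borel_measurable_diff stopped_coeff_adapted \<tau> \<rho> \<delta>)
      fix \<omega> assume \<omega>: "\<omega> \<in> space M"
      show "\<bar>?\<xi> j \<omega>\<bar> \<le> 2 * L"
        using stopped_coeff_bound[OF L \<delta> \<omega>, of j] stopped_coeff_bound[OF L\<rho> L(2) \<delta> \<omega>, of j] by linarith
      show "real j * ?\<delta> < t \<Longrightarrow> ?\<xi> j \<omega> = 0" by (simp add: stopped_coeff_def)
    qed
    have tr: "transform ?\<delta> ?\<xi> (2 ^ p) \<omega> = euler \<tau> T p (2 ^ p) \<omega> - euler ?\<rho> T p (2 ^ p) \<omega>" for \<omega>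
      by (simp add: transform_def euler_def sum_subtractf left_diff_distrib)
    have eq: "\<phi> \<omega> * (X (\<tau> \<omega>) \<omega> - X (?\<rho> \<omega>) \<omega>) =
       \<phi> \<omega> * transform ?\<delta> ?\<xi> (2 ^ p) \<omega> - \<phi> \<omega> * (euler_gap \<tau> T p \<omega> - euler_gap ?\<rho> T p \<omega>)" for \<omega>
      unfolding tr euler_gap_def by (simp add: algebra_simps)
    have i1: "integrable M (\<lambda>\<omega>. \<phi> \<omega> * transform ?\<delta> ?\<xi> (2 ^ p) \<omega>)"
      unfolding tr using euler_moments(3)[OF \<tau> T(1) L] euler_moments(3)[OF \<rho> T(1) L\<rho> L(2)]
      by (intro integrable_bounded_mult[OF _ \<phi>M \<phi>(2)]) auto
    have i2: "integrable M (\<lambda>\<omega>. \<phi> \<omega> * (euler_gap \<tau> T p \<omega> - euler_gap ?\<rho> T p \<omega>))"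
      using g1(1)[of p] g2(1)[of p] by (intro integrable_bounded_mult[OF _ \<phi>M \<phi>(2)]) auto
    have "?v = - expectation (\<lambda>\<omega>. \<phi> \<omega> * (euler_gap \<tau> T p \<omega> - euler_gap ?\<rho> T p \<omega>))"
      unfolding eq using o i1 i2 by simp
    then have "\<bar>?v\<bar> \<le> expectation (\<lambda>\<omega>. \<bar>\<phi> \<omega> * (euler_gap \<tau> T p \<omega> - euler_gap ?\<rho> T p \<omega>)\<bar>)"
      using integral_abs_bound[of M "\<lambda>\<omega>. \<phi> \<omega> * (euler_gap \<tau> T p \<omega> - euler_gap ?\<rho> T p \<omega>)"] by simp
    also have "\<dots> \<le> expectation (\<lambda>\<omega>. B * (\<bar>euler_gap \<tau> T p \<omega>\<bar> + \<bar>euler_gap ?\<rho> T p \<omega>\<bar>))"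
    proof (rule integral_mono)
      show "integrable M (\<lambda>\<omega>. \<bar>\<phi> \<omega> * (euler_gap \<tau> T p \<omega> - euler_gap ?\<rho> T p \<omega>)\<bar>)" using i2 by simp
      show "integrable M (\<lambda>\<omega>. B * (\<bar>euler_gap \<tau> T p \<omega>\<bar> + \<bar>euler_gap ?\<rho> T p \<omega>\<bar>))"
        using g1(1)[of p] g2(1)[of p] by auto
      fix \<omega> assume "\<omega> \<in> space M"
      from \<phi>(2)[OF this] show "\<bar>\<phi> \<omega> * (euler_gap \<tau> T p \<omega> - euler_gap ?\<rho> T p \<omega>)\<bar>
          \<le> B * (\<bar>euler_gap \<tau> T p \<omega>\<bar> + \<bar>euler_gap ?\<rho> T p \<omega>\<bar>)"
        unfolding abs_mult by (intro mult_mono) auto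
    qed
    also have "\<dots> = B * (expectation (\<lambda>\<omega>. \<bar>euler_gap \<tau> T p \<omega>\<bar>) + expectation (\<lambda>\<omega>. \<bar>euler_gap ?\<rho> T p \<omega>\<bar>))"
      using g1(1)[of p] g2(1)[of p] by simp
    finally show ?thesis .
  qed
  moreover have "(\<lambda>p. B * (expectation (\<lambda>\<omega>. \<bar>euler_gap \<tau> T p \<omega>\<bar>) + expectation (\<lambda>\<omega>. \<bar>euler_gap ?\<rho> T p \<omega>\<bar>))) \<longlonglongrightarrow> B * (0 + 0)"
    by (intro tendsto_intros g1(2) g2(2))
  ultimately have "\<bar>?v\<bar> \<le> B * (0 + 0)"
    by (intro tendsto_lowerbound[where F = sequentially] always_eventually) auto
  then show ?thesis by simp
qed

text \<open>Both the scheme and the stopped process are martingales, so the error at an intermediate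
  time is dominated by the terminal one; this replaces a maximal inequality.\<close>

lemma euler_error:
  assumes \<tau>: "nn_stopping_time M F \<tau>" and T: "0 < T" "\<And>\<omega>. \<omega> \<in> space M \<Longrightarrow> \<tau> \<omega> \<le> T"
    and L: "bounded_until \<tau> L" "0 \<le> L" and k: "k \<le> 2 ^ p"
  defines "\<delta> \<equiv> T / 2 ^ p"
  shows "integrable M (\<lambda>\<omega>. if real k * \<delta> < \<tau> \<omega> then \<bar>euler \<tau> T p k \<omega> - (X (real k * \<delta>) \<omega> - d)\<bar> else 0)" (is ?A)
    and "expectation (\<lambda>\<omega>. if real k * \<delta> < \<tau> \<omega> then \<bar>euler \<tau> T p k \<omega> - (X (real k * \<delta>) \<omega> - d)\<bar> else 0)
      \<le> expectation (\<lambda>\<omega>. \<bar>euler_gap \<tau> T p \<omega>\<bar>)" (is ?B)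
proof -
  have \<delta>: "0 < \<delta>" using T by (simp add: \<delta>_def)
  let ?t = "real k * \<delta>"
  have t: "0 \<le> ?t" using \<delta> by simp
  let ?\<rho> = "\<lambda>\<omega>. min (\<tau> \<omega>) ?t"
  have \<rho>: "nn_stopping_time M F ?\<rho>" by (rule stopping_min[OF \<tau> stopping_const[OF t]])
  have L\<rho>: "bounded_until ?\<rho> L" by (rule bounded_until_min[OF L(1)])
  note e = euler_moments[OF \<tau> T(1) L, of p] and x = X_stop_integrable[OF \<tau> L(1)] and x\<rho> = X_stop_integrable[OF \<rho> L\<rho>]
  \<comment> \<open>Testing against the sign of the error turns its L1 norm into an expectation to
    which the two martingale properties apply.\<close>
  define \<phi> where "\<phi> \<omega> = (if ?t < \<tau> \<omega> then sgn (euler \<tau> T p k \<omega> - (X ?t \<omega> - d)) else 0)" for \<omega>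
  have em: "euler \<tau> T p k \<in> borel_measurable (F ?t)" using e(1)[of k] by (simp add: \<delta>_def)
  have \<phi>: "\<phi> \<in> borel_measurable (F ?t)"
  proof -
    have "(\<lambda>\<omega>. sgn (euler \<tau> T p k \<omega> - (X ?t \<omega> - d))) \<in> borel_measurable (F ?t)"
      using em X_adapted[OF t] by simp
    moreover have "{\<omega>\<in>space (F ?t). ?t < \<tau> \<omega>} \<in> sets (F ?t)"
      using stopping_less[OF \<tau> t] space_filtration[OF t] by (simp only:)
    ultimately show ?thesis unfolding \<phi>_def[abs_def] by (intro measurable_If borel_measurable_const)
  qed
  have \<phi>M: "\<phi> \<in> borel_measurable M" using adapted_measurable[OF t \<phi>] .
  have \<phi>1: "\<bar>\<phi> \<omega>\<bar> \<le> 1" for \<omega> by (simp add: \<phi>_def sgn_real_def)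
  have lhs: "(if ?t < \<tau> \<omega> then \<bar>euler \<tau> T p k \<omega> - (X ?t \<omega> - d)\<bar> else 0) = \<phi> \<omega> * (euler \<tau> T p k \<omega> - (X (?\<rho> \<omega>) \<omega> - d))" for \<omega>
    by (simp add: \<phi>_def linordered_idom_class.abs_sgn mult.commute)
  have ik: "integrable M (\<lambda>\<omega>. \<phi> \<omega> * (euler \<tau> T p k \<omega> - (X (?\<rho> \<omega>) \<omega> - d)))"
    using e(3) x\<rho>(1) by (intro integrable_bounded_mult[OF _ \<phi>M \<phi>1]) auto
  then show ?A unfolding lhs .
  \<comment> \<open>Only the increments from step \<open>k\<close> on: their transform is the
    terminal value of the scheme minus its value at step \<open>k\<close>.\<close>
  let ?\<xi> = "\<lambda>j \<omega>. if j < k then 0 else stopped_coeff \<tau> \<delta> j \<omega>"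
  have o: "expectation (\<lambda>\<omega>. \<phi> \<omega> * transform \<delta> ?\<xi> (2 ^ p) \<omega>) = 0"
  proof (rule transform_orthogonal[OF \<delta> _ _ t _ \<phi> \<phi>1])
    fix j show "?\<xi> j \<in> borel_measurable (F (real j * \<delta>))"
      using stopped_coeff_adapted[OF \<tau> \<delta>, of j] by (cases "j < k") simp_all
    fix \<omega> assume \<omega>: "\<omega> \<in> space M"
    show "\<bar>?\<xi> j \<omega>\<bar> \<le> L" using stopped_coeff_bound[OF L \<delta> \<omega>, of j] L(2) by simp
    show "real j * \<delta> < ?t \<Longrightarrow> ?\<xi> j \<omega> = 0" using \<delta> by simp
  qed
  have tr: "transform \<delta> ?\<xi> (2 ^ p) \<omega> = euler \<tau> T p (2 ^ p) \<omega> - euler \<tau> T p k \<omega>" for \<omega>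
  proof -
    let ?g = "\<lambda>j. stopped_coeff \<tau> \<delta> j \<omega> * (W (real (Suc j) * \<delta>) \<omega> - W (real j * \<delta>) \<omega>)"
    have "(\<Sum>j<2 ^ p. ?\<xi> j \<omega> * (W (real (Suc j) * \<delta>) \<omega> - W (real j * \<delta>) \<omega>)) = (\<Sum>j\<in>{k..<2 ^ p}. ?g j)"
      by (rule sum.mono_neutral_cong_right) auto
    moreover have "(\<Sum>j<k. ?g j) + (\<Sum>j\<in>{k..<2 ^ p}. ?g j) = (\<Sum>j<2 ^ p. ?g j)"
      using sum.atLeastLessThan_concat[of 0 k "2 ^ p" ?g] k by (simp add: lessThan_atLeast0)
    ultimately show ?thesis unfolding transform_def euler_def \<delta>_def[symmetric] by linarith
  qed
  have i1: "integrable M (\<lambda>\<omega>. \<phi> \<omega> * transform \<delta> ?\<xi> (2 ^ p) \<omega>)"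
    unfolding tr using e(3) by (intro integrable_bounded_mult[OF _ \<phi>M \<phi>1]) auto
  have i2: "integrable M (\<lambda>\<omega>. \<phi> \<omega> * (X (\<tau> \<omega>) \<omega> - X (?\<rho> \<omega>) \<omega>))"
    using x(1) x\<rho>(1) by (intro integrable_bounded_mult[OF _ \<phi>M \<phi>1]) auto
  note ig = euler_gap_L1(1)[OF \<tau> T L, of p]
  have i3: "integrable M (\<lambda>\<omega>. \<phi> \<omega> * euler_gap \<tau> T p \<omega>)"
    by (rule integrable_bounded_mult[OF ig \<phi>M \<phi>1])
  have eq: "\<phi> \<omega> * (euler \<tau> T p k \<omega> - (X (?\<rho> \<omega>) \<omega> - d)) =
      \<phi> \<omega> * euler_gap \<tau> T p \<omega> - \<phi> \<omega> * transform \<delta> ?\<xi> (2 ^ p) \<omega> + \<phi> \<omega> * (X (\<tau> \<omega>) \<omega> - X (?\<rho> \<omega>) \<omega>)" for \<omega>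
    unfolding tr euler_gap_def by (simp add: algebra_simps)
  have "expectation (\<lambda>\<omega>. \<phi> \<omega> * (euler \<tau> T p k \<omega> - (X (?\<rho> \<omega>) \<omega> - d))) = expectation (\<lambda>\<omega>. \<phi> \<omega> * euler_gap \<tau> T p \<omega>)"
    unfolding eq using o i1 i2 i3 stopped_martingale[OF \<tau> T L t \<phi> \<phi>1] by simp
  also have "\<dots> \<le> expectation (\<lambda>\<omega>. \<bar>euler_gap \<tau> T p \<omega>\<bar>)"
  proof (rule integral_mono[OF i3])
    show "integrable M (\<lambda>\<omega>. \<bar>euler_gap \<tau> T p \<omega>\<bar>)" using ig by simp
    fix \<omega>
    have "\<phi> \<omega> * euler_gap \<tau> T p \<omega> \<le> \<bar>\<phi> \<omega>\<bar> * \<bar>euler_gap \<tau> T p \<omega>\<bar>" by (simp add: abs_mult[symmetric])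
    also have "\<dots> \<le> 1 * \<bar>euler_gap \<tau> T p \<omega>\<bar>" using \<phi>1 by (intro mult_right_mono) auto
    finally show "\<phi> \<omega> * euler_gap \<tau> T p \<omega> \<le> \<bar>euler_gap \<tau> T p \<omega>\<bar>" by simp
  qed
  finally show ?B unfolding lhs .
qed

end

section \<open>Supersolutions and discounted supermartingales\<close>

context ito_solution
begin

text \<open>Ito's formula in expectation, as an inequality for supersolutions: telescope the discounted
  value along the Euler scheme and use a second order Taylor expansion in each step.\<close>

lemma discounted_supermartingale_smooth:
  fixes f f1 f2 :: "real \<Rightarrow> real"
  assumes \<tau>: "nn_stopping_time M F \<tau>" and T: "0 < T" "\<And>\<omega>. \<omega> \<in> space M \<Longrightarrow> \<tau> \<omega> \<le> T"
    and r: "0 \<le> r" and L: "0 \<le> L"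
    and S: "\<And>\<omega> t. \<omega> \<in> space M \<Longrightarrow> 0 \<le> t \<Longrightarrow> t \<le> \<tau> \<omega> \<Longrightarrow> X t \<omega> \<in> S"
    and bS: "\<And>x. x \<in> S \<Longrightarrow> \<bar>x\<bar> \<le> L \<and> \<bar>c x\<bar> \<le> L \<and> \<bar>f x\<bar> \<le> L"
    and super: "\<And>x. x \<in> S \<Longrightarrow> (c x)\<^sup>2 / 2 * f2 x \<le> r * f x"
    and meas: "f \<in> borel_measurable borel" "f1 \<in> borel_measurable borel" "f2 \<in> borel_measurable borel"
    and f_lip: "\<And>x y. \<bar>f x - f y\<bar> \<le> L * \<bar>x - y\<bar>"
    and f1_bd: "\<And>x. \<bar>f1 x\<bar> \<le> L" and f2_bd: "\<And>x. \<bar>f2 x\<bar> \<le> L"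
    and f2_lip: "\<And>x y. \<bar>f2 x - f2 y\<bar> \<le> L * \<bar>x - y\<bar>"
    and taylor: "\<And>z h. f (z + h) - f z \<le> f1 z * h + f2 z * h\<^sup>2 / 2 + L * \<bar>h\<bar> ^ 3"
  shows "expectation (\<lambda>\<omega>. exp (- r * \<tau> \<omega>) * f (X (\<tau> \<omega>) \<omega>)) \<le> f d"
proof -
  have bL: "bounded_until \<tau> L" unfolding bounded_until_def using S bS by blast
  define gap where "gap p = expectation (\<lambda>\<omega>. \<bar>euler_gap \<tau> T p \<omega>\<bar>)" for p
  note gL1 = euler_gap_L1[OF \<tau> T bL L]
  have f_int: "integrable M (\<lambda>\<omega>. f (g \<omega>))" if "integrable M g" for g
  proof (rule Bochner_Integration.integrable_bound[of M "\<lambda>\<omega>. \<bar>f 0\<bar> + L * \<bar>g \<omega>\<bar>"])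
    show "integrable M (\<lambda>\<omega>. \<bar>f 0\<bar> + L * \<bar>g \<omega>\<bar>)" using that by simp
    show "(\<lambda>\<omega>. f (g \<omega>)) \<in> borel_measurable M"
      using borel_measurable_integrable[OF that] meas(1) by simp
    show "AE \<omega> in M. norm (f (g \<omega>)) \<le> norm (\<bar>f 0\<bar> + L * \<bar>g \<omega>\<bar>)"
    proof (rule AE_I2)
      fix \<omega>
      have "\<bar>f (g \<omega>)\<bar> \<le> \<bar>f 0\<bar> + L * \<bar>g \<omega>\<bar>" using f_lip[of "g \<omega>" 0] by simp
      then show "norm (f (g \<omega>)) \<le> norm (\<bar>f 0\<bar> + L * \<bar>g \<omega>\<bar>)" by simp
    qed
  qed
  let ?goal = "expectation (\<lambda>\<omega>. exp (- r * \<tau> \<omega>) * f (X (\<tau> \<omega>) \<omega>))"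
  have main: "?goal \<le> f d + L * gap p + r * (T / 2 ^ p) * L
      + T * ((L ^ 3 / 2 + r * L) * gap p + L * r\<^sup>2 * (T / 2 ^ p) + 2 * L ^ 4 * sqrt (T / 2 ^ p))" for p
  proof -
    define \<delta> where "\<delta> = T / 2 ^ p"
    have \<delta>: "0 < \<delta>" using T by (simp add: \<delta>_def)
    have n\<delta>: "2 ^ p * \<delta> = T" by (simp add: \<delta>_def)
    define q where "q = exp (- r * \<delta>)"
    \<comment> \<open>The last estimate says that the discount lost in one step and its drift
      counterpart \<open>q * \<delta> * r\<close> agree to second order; it comes from
      \<open>1 + t \<le> exp t\<close> at \<open>t = - r * \<delta>\<close> and at
      \<open>t = r * \<delta>\<close>.\<close>
    have q: "0 < q" "q \<le> 1" "1 - q \<le> r * \<delta>" "\<bar>q * \<delta> * r - (1 - q)\<bar> \<le> r\<^sup>2 * \<delta>\<^sup>2"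
    proof -
      show "0 < q" by (simp add: q_def)
      show q1: "q \<le> 1" using r \<delta> by (simp add: q_def)
      show q2: "1 - q \<le> r * \<delta>" using exp_ge_add_one_self[of "- r * \<delta>"] by (simp add: q_def)
      have a: "q * (1 + r * \<delta>) \<le> 1"
      proof -
        have "q * (1 + r * \<delta>) \<le> q * exp (r * \<delta>)"
          using exp_ge_add_one_self[of "r * \<delta>"] by (intro mult_left_mono) (auto simp: q_def)
        then show ?thesis by (simp add: q_def exp_minus)
      qed
      have "(1 - r * \<delta>) * (1 + r * \<delta>) \<le> q * (1 + r * \<delta>)"
        using q2 r \<delta> by (intro mult_right_mono) auto
      then have b: "1 - r\<^sup>2 * \<delta>\<^sup>2 \<le> q * (1 + r * \<delta>)" by (simp add: algebra_simps power2_eq_square)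
      show "\<bar>q * \<delta> * r - (1 - q)\<bar> \<le> r\<^sup>2 * \<delta>\<^sup>2" using a b by (simp add: algebra_simps abs_le_iff)
    qed
    define \<xi> where "\<xi> = stopped_coeff \<tau> \<delta>"
    define z where "z k \<omega> = d + euler \<tau> T p k \<omega>" for k \<omega>
    define h where "h k \<omega> = W (real (Suc k) * \<delta>) \<omega> - W (real k * \<delta>) \<omega>" for k \<omega>
    define A where "A k \<omega> = (if real k * \<delta> < \<tau> \<omega> then exp (- r * (real k * \<delta>)) else 0)" for k \<omega>
    define \<kappa> where "\<kappa> \<omega> = nat \<lceil>\<tau> \<omega> / \<delta>\<rceil>" for \<omega>
    \<comment> \<open>The discount clock stops after \<open>\<kappa>\<close> steps, together with
      the increments of the scheme, so \<open>V\<close> is constant once \<open>\<tau>\<close> has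
      passed.\<close>
    define V where "V k \<omega> = exp (- r * (\<delta> * real (min k (\<kappa> \<omega>)))) * f (z k \<omega>)" for k \<omega>
    have tk: "0 \<le> real k * \<delta>" "real k * \<delta> < real (Suc k) * \<delta>" "real (Suc k) * \<delta> - real k * \<delta> = \<delta>" for k
      using \<delta> by (auto simp: algebra_simps)
    have z_Suc: "z (Suc k) \<omega> = z k \<omega> + \<xi> k \<omega> * h k \<omega>" for k \<omega>
      by (simp add: z_def euler_def transform_Suc \<xi>_def h_def \<delta>_def)
    have \<kappa>_iff: "j < \<kappa> \<omega> \<longleftrightarrow> real j * \<delta> < \<tau> \<omega>" for j \<omega>
      unfolding \<kappa>_def less_nat_ceiling_iff by (rule pos_less_divide_eq[OF \<delta>])
    note em = euler_moments[OF \<tau> T(1) bL L, of p]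
    have z_ad: "z k \<in> borel_measurable (F (real k * \<delta>))" for k
      unfolding z_def using em(1)[of k] by (simp add: \<delta>_def)
    have z_int: "integrable M (z k)" for k unfolding z_def using em(3)[of k] by simp
    have zM: "z k \<in> borel_measurable M" for k using z_int by (rule borel_measurable_integrable)
    have \<xi>_ad: "\<xi> k \<in> borel_measurable (F (real k * \<delta>))" for k
      unfolding \<xi>_def by (rule stopped_coeff_adapted[OF \<tau> \<delta>])
    have \<xi>_bd: "\<bar>\<xi> k \<omega>\<bar> \<le> L" if "\<omega> \<in> space M" for k \<omega>
      unfolding \<xi>_def by (rule stopped_coeff_bound[OF bL L \<delta> that])
    have A_ad: "A k \<in> borel_measurable (F (real k * \<delta>))" for k
    proof -
      have "{\<omega>\<in>space (F (real k * \<delta>)). real k * \<delta> < \<tau> \<omega>} \<in> sets (F (real k * \<delta>))"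
        using stopping_less[OF \<tau> tk(1)] space_filtration[OF tk(1)] by (simp only:)
      then show ?thesis unfolding A_def[abs_def] by (intro measurable_If borel_measurable_const)
    qed
    have A_bd: "0 \<le> A k \<omega>" "A k \<omega> \<le> 1" for k \<omega> using r tk(1)[of k] by (auto simp: A_def)
    have \<kappa>_meas: "\<kappa> \<in> measurable M (count_space UNIV)"
      unfolding \<kappa>_def[abs_def] using stopping_measurable[OF \<tau>] by measurable
    have Dm: "(\<lambda>\<omega>. exp (- r * (\<delta> * real (min k (\<kappa> \<omega>))))) \<in> borel_measurable M" for k
      by (rule measurable_compose[OF \<kappa>_meas]) simp
    have V_int: "integrable M (V k)" for k
      unfolding V_def
      by (rule integrable_bounded_mult[OF f_int[OF z_int] Dm, where B = 1]) (use r \<delta> in simp)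
    \<comment> \<open>The loss per step is \<open>\<delta>\<close> times a quantity that vanishes
      with the mesh, so \<open>2 ^ p\<close> steps lose only \<open>T\<close> times that
      quantity.\<close>
    have step: "expectation (V (Suc k)) - expectation (V k) \<le> \<delta> * ((L ^ 3 / 2 + r * L) * gap p + L * r\<^sup>2 * \<delta> + 2 * L ^ 4 * sqrt \<delta>)"
      if k: "k < 2 ^ p" for k
    proof -
      define e where "e \<omega> = (if real k * \<delta> < \<tau> \<omega> then \<bar>euler \<tau> T p k \<omega> - (X (real k * \<delta>) \<omega> - d)\<bar> else 0)" for \<omega>
      have e_int: "integrable M e" "expectation e \<le> gap p"
        using euler_error[OF \<tau> T bL L, of k p] k unfolding e_def[abs_def] gap_def \<delta>_def by simp_all
      define Y1 where "Y1 \<omega> = q * A k \<omega> * f1 (z k \<omega>) * \<xi> k \<omega>" for \<omega>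
      define Y2 where "Y2 \<omega> = q * A k \<omega> * f2 (z k \<omega>) * (\<xi> k \<omega>)\<^sup>2 / 2" for \<omega>
      define Y3 where "Y3 \<omega> = (1 - q) * A k \<omega> * f (z k \<omega>)" for \<omega>
      have qA: "\<bar>q * A k \<omega>\<bar> \<le> 1" for \<omega>
        using q A_bd[of k \<omega>] by (simp add: abs_mult mult_le_one)
      \<comment> \<open>\<open>Y1\<close> multiplies a mean-zero increment, \<open>Y2\<close> a
        squared increment of mean \<open>\<delta>\<close>, and \<open>Y3\<close> is the value lost
        by discounting; the cubic term is the Taylor remainder.\<close>
      have pt: "V (Suc k) \<omega> - V k \<omega> \<le> Y1 \<omega> * h k \<omega> + Y2 \<omega> * (h k \<omega>)\<^sup>2 + L ^ 4 * \<bar>h k \<omega>\<bar> ^ 3 - Y3 \<omega>"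
        if \<omega>: "\<omega> \<in> space M" for \<omega>
      proof (cases "real k * \<delta> < \<tau> \<omega>")
        case True
        then have "k < \<kappa> \<omega>" by (simp add: \<kappa>_iff)
        then have m: "min k (\<kappa> \<omega>) = k" "min (Suc k) (\<kappa> \<omega>) = Suc k" by auto
        have A: "A k \<omega> = exp (- r * (\<delta> * real k))" using True by (simp add: A_def mult.commute)
        have qA': "exp (- r * (\<delta> * real (Suc k))) = q * A k \<omega>"
          unfolding A q_def by (simp add: exp_add[symmetric] algebra_simps)
        have "V (Suc k) \<omega> - V k \<omega> = q * A k \<omega> * (f (z k \<omega> + \<xi> k \<omega> * h k \<omega>) - f (z k \<omega>)) - Y3 \<omega>"
          unfolding V_def m qA' A[symmetric] z_Suc Y3_def by (simp add: algebra_simps)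
        also have "\<dots> \<le> q * A k \<omega> * (f1 (z k \<omega>) * (\<xi> k \<omega> * h k \<omega>) + f2 (z k \<omega>) * (\<xi> k \<omega> * h k \<omega>)\<^sup>2 / 2 + L * \<bar>\<xi> k \<omega> * h k \<omega>\<bar> ^ 3) - Y3 \<omega>"
          using taylor q(1) A_bd(1)[of k \<omega>] by (intro diff_right_mono mult_left_mono) auto
        also have "\<dots> = Y1 \<omega> * h k \<omega> + Y2 \<omega> * (h k \<omega>)\<^sup>2 + q * A k \<omega> * (L * \<bar>\<xi> k \<omega> * h k \<omega>\<bar> ^ 3) - Y3 \<omega>"
          unfolding Y1_def Y2_def by (simp add: algebra_simps power_mult_distrib)
        also have "q * A k \<omega> * (L * \<bar>\<xi> k \<omega> * h k \<omega>\<bar> ^ 3) \<le> L ^ 4 * \<bar>h k \<omega>\<bar> ^ 3"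
        proof -
          have "\<bar>\<xi> k \<omega>\<bar> ^ 3 \<le> L ^ 3" by (rule power_mono[OF \<xi>_bd[OF \<omega>]]) simp
          then have "L * \<bar>\<xi> k \<omega> * h k \<omega>\<bar> ^ 3 \<le> L * (L ^ 3 * \<bar>h k \<omega>\<bar> ^ 3)"
            unfolding abs_mult power_mult_distrib using L by (intro mult_left_mono mult_right_mono) auto
          also have "\<dots> = L ^ 4 * \<bar>h k \<omega>\<bar> ^ 3" by (simp add: power_numeral_reduce)
          finally have "L * \<bar>\<xi> k \<omega> * h k \<omega>\<bar> ^ 3 \<le> L ^ 4 * \<bar>h k \<omega>\<bar> ^ 3" .
          moreover have "q * A k \<omega> * (L * \<bar>\<xi> k \<omega> * h k \<omega>\<bar> ^ 3) \<le> 1 * (L * \<bar>\<xi> k \<omega> * h k \<omega>\<bar> ^ 3)"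
            using qA[of \<omega>] L by (intro mult_right_mono) auto
          ultimately show ?thesis by simp
        qed
        finally show ?thesis by simp
      next
        case False
        then have "\<not> k < \<kappa> \<omega>" by (simp add: \<kappa>_iff)
        then have m: "min k (\<kappa> \<omega>) = \<kappa> \<omega>" "min (Suc k) (\<kappa> \<omega>) = \<kappa> \<omega>" by auto
        have "\<xi> k \<omega> = 0" using False by (simp add: \<xi>_def stopped_coeff_def)
        then have "V (Suc k) \<omega> - V k \<omega> = 0" unfolding V_def m z_Suc by simp
        moreover have "A k \<omega> = 0" using False by (simp add: A_def)
        ultimately show ?thesis using L by (simp add: Y1_def Y2_def Y3_def)
      qed
      have AM: "A k \<in> borel_measurable M" "\<xi> k \<in> borel_measurable M"
        using adapted_measurable[OF tk(1) A_ad] adapted_measurable[OF tk(1) \<xi>_ad] by auto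
      have fz: "(\<lambda>\<omega>. f1 (z k \<omega>)) \<in> borel_measurable (F (real k * \<delta>))" "(\<lambda>\<omega>. f2 (z k \<omega>)) \<in> borel_measurable (F (real k * \<delta>))"
        using measurable_compose[OF z_ad meas(2)] measurable_compose[OF z_ad meas(3)] by auto
      have Y1_ad: "Y1 \<in> borel_measurable (F (real k * \<delta>))"
        unfolding Y1_def[abs_def] by (intro borel_measurable_times borel_measurable_const A_ad fz \<xi>_ad)
      have Y2_ad: "Y2 \<in> borel_measurable (F (real k * \<delta>))"
        unfolding Y2_def[abs_def] by (intro borel_measurable_divide borel_measurable_times borel_measurable_const borel_measurable_power A_ad fz \<xi>_ad)
      have Y1_bd: "\<bar>Y1 \<omega>\<bar> \<le> 1 * L * L" if "\<omega> \<in> space M" for \<omega>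
        unfolding Y1_def abs_mult[of "_ * _" "\<xi> k \<omega>"] abs_mult[of "_ * _" "f1 _"]
        using qA[of \<omega>] f1_bd[of "z k \<omega>"] \<xi>_bd[OF that, of k] L by (intro mult_mono) auto
      have Y2_bd: "\<bar>Y2 \<omega>\<bar> \<le> 1 * L * L\<^sup>2" if "\<omega> \<in> space M" for \<omega>
      proof -
        have "\<bar>q * A k \<omega> * f2 (z k \<omega>) * (\<xi> k \<omega>)\<^sup>2\<bar> \<le> 1 * L * L\<^sup>2"
          unfolding abs_mult[of "_ * _" "(\<xi> k \<omega>)\<^sup>2"] abs_mult[of "_ * _" "f2 _"]
          using qA[of \<omega>] f2_bd[of "z k \<omega>"] power_mono[OF \<xi>_bd[OF that, of k], of 2] L
          by (intro mult_mono) auto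
        then show ?thesis unfolding Y2_def by linarith
      qed
      have Y1_int: "integrable M Y1"
        by (rule integrable_const_bound[of _ "1 * L * L"]) (use Y1_bd adapted_measurable[OF tk(1) Y1_ad] in auto)
      have Y2_int: "integrable M Y2"
        by (rule integrable_const_bound[of _ "1 * L * L\<^sup>2"]) (use Y2_bd adapted_measurable[OF tk(1) Y2_ad] in auto)
      have Y3_int: "integrable M Y3"
      proof -
        have "integrable M (\<lambda>\<omega>. ((1 - q) * A k \<omega>) * f (z k \<omega>))"
          by (rule integrable_bounded_mult[OF f_int[OF z_int], where B = 1])
            (use AM q A_bd[of k] in \<open>auto simp: abs_mult mult_le_one\<close>)
        then show ?thesis unfolding Y3_def .
      qed
      note m1 = increment_mult[OF tk(1,2) Y1_ad Y1_int, folded h_def]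
      note m2 = increment_mult[OF tk(1,2) Y2_ad Y2_int, folded h_def]
      note m3 = increment_moments(5,6)[OF tk(1,2)[of k], folded h_def]
      let ?R = "\<lambda>\<omega>. Y1 \<omega> * h k \<omega> + Y2 \<omega> * (h k \<omega>)\<^sup>2 + L ^ 4 * \<bar>h k \<omega>\<bar> ^ 3 - Y3 \<omega>"
      have R_int: "integrable M ?R"
        using m1(1) m2(3) m3(1) Y3_int by (intro Bochner_Integration.integrable_diff Bochner_Integration.integrable_add integrable_mult_right) auto
      have "expectation (V (Suc k)) - expectation (V k) = expectation (\<lambda>\<omega>. V (Suc k) \<omega> - V k \<omega>)"
        using V_int by simp
      also have "\<dots> \<le> expectation ?R"
        by (rule integral_mono[OF _ R_int pt]) (use V_int in auto)
      also have "\<dots> = expectation Y2 * \<delta> + L ^ 4 * expectation (\<lambda>\<omega>. \<bar>h k \<omega>\<bar> ^ 3) - expectation Y3"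
        using m1(1,2) m2(3,4) m3(1) Y3_int tk(3)[of k] by (simp add: Bochner_Integration.integrable_add)
      also have "\<dots> \<le> expectation Y2 * \<delta> + L ^ 4 * (2 * (\<delta> * sqrt \<delta>)) - expectation Y3"
        using m3(2) tk(3)[of k] by (intro diff_right_mono add_left_mono mult_left_mono) auto
      also have "\<dots> = expectation (\<lambda>\<omega>. Y2 \<omega> * \<delta> - Y3 \<omega>) + L ^ 4 * (2 * (\<delta> * sqrt \<delta>))"
        using Y2_int Y3_int by simp
      \<comment> \<open>The differential inequality holds at the position of the solution, whereas
        the Taylor expansion is taken at the scheme. Lipschitz bounds on \<open>f\<close> and
        \<open>f2\<close> carry it over, at a cost proportional to their distance
        \<open>e\<close>.\<close>
      also have "expectation (\<lambda>\<omega>. Y2 \<omega> * \<delta> - Y3 \<omega>) \<le> expectation (\<lambda>\<omega>. \<delta> * (L ^ 3 / 2 + r * L) * e \<omega> + L * r\<^sup>2 * \<delta>\<^sup>2)"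
      proof (rule integral_mono)
        show "integrable M (\<lambda>\<omega>. Y2 \<omega> * \<delta> - Y3 \<omega>)" using Y2_int Y3_int by simp
        show "integrable M (\<lambda>\<omega>. \<delta> * (L ^ 3 / 2 + r * L) * e \<omega> + L * r\<^sup>2 * \<delta>\<^sup>2)"
          using e_int(1) by (intro Bochner_Integration.integrable_add integrable_mult_right) auto
        fix \<omega> assume \<omega>: "\<omega> \<in> space M"
        show "Y2 \<omega> * \<delta> - Y3 \<omega> \<le> \<delta> * (L ^ 3 / 2 + r * L) * e \<omega> + L * r\<^sup>2 * \<delta>\<^sup>2"
        proof (cases "real k * \<delta> < \<tau> \<omega>")
          case False
          then have "A k \<omega> = 0" "e \<omega> = 0" by (auto simp: A_def e_def)
          then show ?thesis using L by (simp add: Y2_def Y3_def)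
        next
          case True
          define x where "x = X (real k * \<delta>) \<omega>"
          define y where "y = z k \<omega>"
          have xS: "x \<in> S" unfolding x_def by (rule S[OF \<omega> tk(1)]) (use True in simp)
          have \<xi>: "\<xi> k \<omega> = c x" using True by (simp add: \<xi>_def stopped_coeff_def x_def)
          have e: "e \<omega> = \<bar>y - x\<bar>" using True by (simp add: e_def y_def x_def z_def algebra_simps)
          have cx: "(c x)\<^sup>2 \<le> L\<^sup>2" using bS[OF xS] L by (simp add: abs_le_square_iff[symmetric])
          have a: "q * \<delta> * ((c x)\<^sup>2 / 2 * f2 y) \<le> q * \<delta> * (r * f x) + \<delta> * (L ^ 3 / 2) * \<bar>y - x\<bar>"
          proof -
            have "(c x)\<^sup>2 / 2 * f2 y \<le> (c x)\<^sup>2 / 2 * (f2 x + L * \<bar>y - x\<bar>)"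
              using f2_lip[of y x] by (intro mult_left_mono) auto
            also have "\<dots> = (c x)\<^sup>2 / 2 * f2 x + (c x)\<^sup>2 / 2 * (L * \<bar>y - x\<bar>)" by (simp add: algebra_simps)
            also have "\<dots> \<le> r * f x + L\<^sup>2 / 2 * (L * \<bar>y - x\<bar>)"
              using super[OF xS] cx L by (intro add_mono mult_right_mono) auto
            finally have "(c x)\<^sup>2 / 2 * f2 y \<le> r * f x + L ^ 3 / 2 * \<bar>y - x\<bar>"
              by (simp add: power2_eq_square power3_eq_cube)
            then have "q * \<delta> * ((c x)\<^sup>2 / 2 * f2 y) \<le> q * \<delta> * (r * f x + L ^ 3 / 2 * \<bar>y - x\<bar>)"
              using q \<delta> by (intro mult_left_mono) auto
            also have "\<dots> = q * \<delta> * (r * f x) + q * (\<delta> * (L ^ 3 / 2) * \<bar>y - x\<bar>)" by (simp add: algebra_simps)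
            also have "q * (\<delta> * (L ^ 3 / 2) * \<bar>y - x\<bar>) \<le> \<delta> * (L ^ 3 / 2) * \<bar>y - x\<bar>"
              using q \<delta> L by (intro mult_left_le_one_le) auto
            finally show ?thesis by simp
          qed
          have b: "- ((1 - q) * f y) \<le> - ((1 - q) * f x) + \<delta> * (r * L) * \<bar>y - x\<bar>"
          proof -
            have "(1 - q) * (f x - f y) \<le> (1 - q) * (L * \<bar>y - x\<bar>)"
              using f_lip[of x y] q by (intro mult_left_mono) (auto simp: abs_minus_commute)
            also have "\<dots> \<le> (r * \<delta>) * (L * \<bar>y - x\<bar>)" using q L by (intro mult_right_mono) auto
            finally show ?thesis by (simp add: algebra_simps)
          qed
          have c: "(q * \<delta> * r - (1 - q)) * f x \<le> L * r\<^sup>2 * \<delta>\<^sup>2"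
          proof -
            have "(q * \<delta> * r - (1 - q)) * f x \<le> \<bar>q * \<delta> * r - (1 - q)\<bar> * \<bar>f x\<bar>" by (simp add: abs_mult[symmetric])
            also have "\<dots> \<le> (r\<^sup>2 * \<delta>\<^sup>2) * L" using q bS[OF xS] by (intro mult_mono) auto
            finally show ?thesis by (simp add: algebra_simps)
          qed
          have "q * \<delta> * ((c x)\<^sup>2 / 2 * f2 y) - (1 - q) * f y \<le> \<delta> * (L ^ 3 / 2 + r * L) * \<bar>y - x\<bar> + L * r\<^sup>2 * \<delta>\<^sup>2"
            using a b c by (simp add: algebra_simps)
          then have "A k \<omega> * (q * \<delta> * ((c x)\<^sup>2 / 2 * f2 y) - (1 - q) * f y)
             \<le> A k \<omega> * (\<delta> * (L ^ 3 / 2 + r * L) * \<bar>y - x\<bar> + L * r\<^sup>2 * \<delta>\<^sup>2)"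
            by (rule mult_left_mono[OF _ A_bd(1)])
          also have "\<dots> \<le> \<delta> * (L ^ 3 / 2 + r * L) * \<bar>y - x\<bar> + L * r\<^sup>2 * \<delta>\<^sup>2"
            using A_bd[of k \<omega>] \<delta> L r by (intro mult_left_le_one_le) auto
          finally show ?thesis unfolding Y2_def Y3_def \<xi> e y_def by (simp add: algebra_simps)
        qed
      qed
      also have "\<dots> = \<delta> * (L ^ 3 / 2 + r * L) * expectation e + L * r\<^sup>2 * \<delta>\<^sup>2"
        using e_int(1) by (simp add: prob_space)
      also have "\<dots> \<le> \<delta> * (L ^ 3 / 2 + r * L) * gap p + L * r\<^sup>2 * \<delta>\<^sup>2"
        using e_int(2) \<delta> L r by (intro add_right_mono mult_left_mono) auto
      finally show ?thesis by (simp add: algebra_simps power2_eq_square)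
    qed
    have tele: "expectation (V k) \<le> f d + real k * (\<delta> * ((L ^ 3 / 2 + r * L) * gap p + L * r\<^sup>2 * \<delta> + 2 * L ^ 4 * sqrt \<delta>))"
      if "k \<le> 2 ^ p" for k
      using that
    proof (induction k)
      case 0
      have "V 0 \<omega> = f d" for \<omega> by (simp add: V_def z_def euler_def)
      then show ?case by (simp add: prob_space)
    next
      case (Suc k)
      have D: "real (Suc k) * D = real k * D + D" for D by (simp add: algebra_simps)
      have "k < 2 ^ p" "k \<le> 2 ^ p" using Suc.prems by auto
      from step[OF this(1)] Suc.IH[OF this(2)] show ?case unfolding D by linarith
    qed
    \<comment> \<open>Exchanges the rounded time for \<open>\<tau>\<close> and the final scheme
      value for the stopped solution; this costs the discount of one step and the terminal
      gap.\<close>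
    have fin: "?goal - expectation (V (2 ^ p)) \<le> L * gap p + r * \<delta> * L"
    proof -
      have fX: "integrable M (\<lambda>\<omega>. f (X (\<tau> \<omega>) \<omega>))" by (rule f_int[OF X_stop_integrable(1)[OF \<tau> bL]])
      have iX: "integrable M (\<lambda>\<omega>. exp (- r * \<tau> \<omega>) * f (X (\<tau> \<omega>) \<omega>))"
        by (rule integrable_bounded_mult[OF fX, where B = 1])
          (use stopping_measurable[OF \<tau>] stopping_nonneg[OF \<tau>] r in auto)
      have "?goal - expectation (V (2 ^ p)) = expectation (\<lambda>\<omega>. exp (- r * \<tau> \<omega>) * f (X (\<tau> \<omega>) \<omega>) - V (2 ^ p) \<omega>)"
        using iX V_int by simp
      also have "\<dots> \<le> expectation (\<lambda>\<omega>. L * \<bar>euler_gap \<tau> T p \<omega>\<bar> + r * \<delta> * L)"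
      proof (rule integral_mono)
        show "integrable M (\<lambda>\<omega>. exp (- r * \<tau> \<omega>) * f (X (\<tau> \<omega>) \<omega>) - V (2 ^ p) \<omega>)" using iX V_int by simp
        show "integrable M (\<lambda>\<omega>. L * \<bar>euler_gap \<tau> T p \<omega>\<bar> + r * \<delta> * L)"
          using gL1(1)[of p] by (intro Bochner_Integration.integrable_add integrable_mult_right) auto
        fix \<omega> assume \<omega>: "\<omega> \<in> space M"
        define x where "x = X (\<tau> \<omega>) \<omega>"
        define y where "y = z (2 ^ p) \<omega>"
        have xS: "x \<in> S" unfolding x_def by (rule S[OF \<omega> stopping_nonneg[OF \<tau> \<omega>]]) simp
        have g: "euler_gap \<tau> T p \<omega> = y - x" by (simp add: euler_gap_def y_def x_def z_def)
        have "\<not> 2 ^ p < \<kappa> \<omega>" using \<kappa>_iff[of "2 ^ p" \<omega>] n\<delta> T(2)[OF \<omega>] by simp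
        then have m: "min (2 ^ p) (\<kappa> \<omega>) = \<kappa> \<omega>" by simp
        define u where "u = \<delta> * real (\<kappa> \<omega>)"
        have u1: "\<tau> \<omega> \<le> u" using \<kappa>_iff[of "\<kappa> \<omega>" \<omega>] by (simp add: u_def mult.commute)
        have u2: "u \<le> \<tau> \<omega> + \<delta>"
        proof (cases "\<kappa> \<omega>")
          case 0 then show ?thesis using stopping_nonneg[OF \<tau> \<omega>] \<delta> by (simp add: u_def)
        next
          case (Suc j) then show ?thesis using \<kappa>_iff[of j \<omega>] by (simp add: u_def algebra_simps)
        qed
        have E: "0 \<le> exp (- r * \<tau> \<omega>) - exp (- r * u)" "exp (- r * \<tau> \<omega>) - exp (- r * u) \<le> r * \<delta>"
        proof -
          show "0 \<le> exp (- r * \<tau> \<omega>) - exp (- r * u)" using u1 r by (simp add: mult_left_mono)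
          have "1 - r * (u - \<tau> \<omega>) \<le> exp (- r * (u - \<tau> \<omega>))"
            using exp_ge_add_one_self[of "- r * (u - \<tau> \<omega>)"] by simp
          then have "exp (- r * \<tau> \<omega>) * (1 - exp (- r * (u - \<tau> \<omega>))) \<le> 1 * (r * (u - \<tau> \<omega>))"
            using u1 r stopping_nonneg[OF \<tau> \<omega>] by (intro mult_mono) auto
          moreover have "exp (- r * \<tau> \<omega>) * exp (- r * (u - \<tau> \<omega>)) = exp (- r * u)"
            by (simp add: exp_add[symmetric] algebra_simps)
          moreover have "r * (u - \<tau> \<omega>) \<le> r * \<delta>" using u2 r by (intro mult_left_mono) auto
          ultimately show "exp (- r * \<tau> \<omega>) - exp (- r * u) \<le> r * \<delta>" by (simp add: right_diff_distrib)
        qed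
        have Eu: "0 \<le> exp (- r * u)" "exp (- r * u) \<le> 1" using u1 r stopping_nonneg[OF \<tau> \<omega>] by auto
        have "exp (- r * \<tau> \<omega>) * f x - exp (- r * u) * f y = (exp (- r * \<tau> \<omega>) - exp (- r * u)) * f x + exp (- r * u) * (f x - f y)"
          by (simp add: algebra_simps)
        also have "\<dots> \<le> r * \<delta> * L + 1 * (L * \<bar>y - x\<bar>)"
        proof (rule add_mono)
          have "(exp (- r * \<tau> \<omega>) - exp (- r * u)) * f x \<le> (exp (- r * \<tau> \<omega>) - exp (- r * u)) * L"
            using bS[OF xS] E by (intro mult_left_mono) auto
          also have "\<dots> \<le> r * \<delta> * L" using E L by (intro mult_right_mono) auto
          finally show "(exp (- r * \<tau> \<omega>) - exp (- r * u)) * f x \<le> r * \<delta> * L" .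
          have "exp (- r * u) * (f x - f y) \<le> exp (- r * u) * (L * \<bar>y - x\<bar>)"
            using f_lip[of x y] Eu by (intro mult_left_mono) (auto simp: abs_minus_commute)
          also have "\<dots> \<le> 1 * (L * \<bar>y - x\<bar>)" using Eu L by (intro mult_right_mono) auto
          finally show "exp (- r * u) * (f x - f y) \<le> 1 * (L * \<bar>y - x\<bar>)" .
        qed
        finally show "exp (- r * \<tau> \<omega>) * f (X (\<tau> \<omega>) \<omega>) - V (2 ^ p) \<omega> \<le> L * \<bar>euler_gap \<tau> T p \<omega>\<bar> + r * \<delta> * L"
          unfolding V_def m g u_def[symmetric] x_def[symmetric] y_def[symmetric] by simp
      qed
      also have "\<dots> = L * gap p + r * \<delta> * L"
        using gL1(1)[of p] by (simp add: prob_space gap_def)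
      finally show ?thesis .
    qed
    have "real (2 ^ p) * (\<delta> * ((L ^ 3 / 2 + r * L) * gap p + L * r\<^sup>2 * \<delta> + 2 * L ^ 4 * sqrt \<delta>))
       = T * ((L ^ 3 / 2 + r * L) * gap p + L * r\<^sup>2 * \<delta> + 2 * L ^ 4 * sqrt \<delta>)"
      using n\<delta> by (simp add: mult.assoc[symmetric])
    then show ?thesis using tele[of "2 ^ p"] fin unfolding \<delta>_def[symmetric] by linarith
  qed
  have T2: "(\<lambda>p. T / 2 ^ p) \<longlonglongrightarrow> 0"
    using tendsto_mult[OF tendsto_const LIMSEQ_power_zero[of "1/2::real"], of T] by (simp add: power_one_over)
  have g0: "gap \<longlonglongrightarrow> 0" unfolding gap_def using gL1(2) .
  have "(\<lambda>p. f d + L * gap p + r * (T / 2 ^ p) * L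
      + T * ((L ^ 3 / 2 + r * L) * gap p + L * r\<^sup>2 * (T / 2 ^ p) + 2 * L ^ 4 * sqrt (T / 2 ^ p)))
     \<longlonglongrightarrow> f d + L * 0 + r * 0 * L + T * ((L ^ 3 / 2 + r * L) * 0 + L * r\<^sup>2 * 0 + 2 * L ^ 4 * sqrt 0)"
    by (intro tendsto_intros g0 T2)
  then have "?goal \<le> f d + L * 0 + r * 0 * L + T * ((L ^ 3 / 2 + r * L) * 0 + L * r\<^sup>2 * 0 + 2 * L ^ 4 * sqrt 0)"
    by (rule tendsto_lowerbound) (use main in auto)
  then show ?thesis by simp
qed

end

section \<open>Extension of functions from a compact interval\<close>

definition tame_C2 :: "real \<Rightarrow> (real \<Rightarrow> real) \<Rightarrow> (real \<Rightarrow> real) \<Rightarrow> (real \<Rightarrow> real) \<Rightarrow> bool" where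
  "tame_C2 L g g1 g2 \<longleftrightarrow> 0 \<le> L \<and> continuous_on UNIV g \<and> continuous_on UNIV g1 \<and> continuous_on UNIV g2 \<and>
    (\<forall>x y. \<bar>g x - g y\<bar> \<le> L * \<bar>x - y\<bar>) \<and> (\<forall>x. \<bar>g1 x\<bar> \<le> L) \<and> (\<forall>x. \<bar>g2 x\<bar> \<le> L) \<and>
    (\<forall>x y. \<bar>g2 x - g2 y\<bar> \<le> L * \<bar>x - y\<bar>) \<and>
    (\<forall>z h. g (z + h) - g z \<le> g1 z * h + g2 z * h\<^sup>2 / 2 + L * \<bar>h\<bar> ^ 3)"

text \<open>The solution remains in \<open>{a..b}\<close> but the scheme may leave it, so global
  bounds are needed. The second derivative is frozen at the nearest end point and cut off within
  distance 1; integrating twice from \<open>a\<close> recovers \<open>f1\<close> and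
  \<open>f\<close> on the interval. Beyond the cutoff the first derivative is constant, hence
  bounded overall.\<close>

lemma extend_smooth:
  fixes f f1 f2 f3 :: "real \<Rightarrow> real"
  assumes ab: "a \<le> b"
    and D: "\<And>x. x \<in> {a..b} \<Longrightarrow> (f has_real_derivative f1 x) (at x)"
      "\<And>x. x \<in> {a..b} \<Longrightarrow> (f1 has_real_derivative f2 x) (at x)"
      "\<And>x. x \<in> {a..b} \<Longrightarrow> (f2 has_real_derivative f3 x) (at x)"
    and f3: "continuous_on {a..b} f3"
  shows "\<exists>L g g1 g2. (\<forall>x\<in>{a..b}. g x = f x) \<and> (\<forall>x\<in>{a..b}. g2 x = f2 x) \<and> tame_C2 L g g1 g2"
proof -
  have cont2: "continuous_on {a..b} f2"
    by (intro continuous_at_imp_continuous_on ballI DERIV_isCont[OF D(3)])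
  obtain B where B: "\<And>x. x \<in> {a..b} \<Longrightarrow> \<bar>f2 x\<bar> \<le> B"
    using compact_imp_bounded[OF compact_continuous_image[OF cont2 compact_Icc]]
    unfolding bounded_iff real_norm_def by blast
  obtain K where K: "\<And>x. x \<in> {a..b} \<Longrightarrow> \<bar>f3 x\<bar> \<le> K"
    using compact_imp_bounded[OF compact_continuous_image[OF f3 compact_Icc]]
    unfolding bounded_iff real_norm_def by blast
  have lip2: "\<bar>f2 x - f2 y\<bar> \<le> K * \<bar>x - y\<bar>" if "x \<in> {a..b}" "y \<in> {a..b}" for x y
    using field_differentiable_bound[of "{a..b}" f2 f3 K x y] D(3) K that
    by (auto intro: has_field_derivative_at_within)
  have B0: "0 \<le> B" using B[of a] ab by simp
  have K0: "0 \<le> K" using K[of a] ab by simp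
  define cl where "cl x = max a (min b x)" for x :: real
  define \<eta> where "\<eta> x = max 0 (1 - \<bar>x - cl x\<bar>)" for x :: real
  define g2 where "g2 x = f2 (cl x) * \<eta> x" for x
  have cl: "cl x \<in> {a..b}" for x using ab by (auto simp: cl_def)
  have cl_id: "cl x = x" if "x \<in> {a..b}" for x using that by (auto simp: cl_def)
  have cl_lip: "\<bar>cl x - cl y\<bar> \<le> \<bar>x - y\<bar>" for x y unfolding cl_def by linarith
  have \<eta>_bd: "0 \<le> \<eta> x" "\<eta> x \<le> 1" for x by (auto simp: \<eta>_def)
  have \<eta>_lip: "\<bar>\<eta> x - \<eta> y\<bar> \<le> \<bar>x - y\<bar>" for x y
    using ab unfolding \<eta>_def cl_def by linarith
  have g2_eq: "g2 x = f2 x" if "x \<in> {a..b}" for x using cl_id[OF that] by (simp add: g2_def \<eta>_def)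
  have g2_bd: "\<bar>g2 x\<bar> \<le> B" for x
  proof -
    have "\<bar>g2 x\<bar> \<le> B * 1" unfolding g2_def abs_mult using B[OF cl] \<eta>_bd B0 by (intro mult_mono) auto
    then show ?thesis by simp
  qed
  have g2_lip: "\<bar>g2 x - g2 y\<bar> \<le> (K + B) * \<bar>x - y\<bar>" for x y
  proof -
    have "g2 x - g2 y = (f2 (cl x) - f2 (cl y)) * \<eta> x + f2 (cl y) * (\<eta> x - \<eta> y)"
      by (simp add: g2_def algebra_simps)
    then have "\<bar>g2 x - g2 y\<bar> \<le> \<bar>f2 (cl x) - f2 (cl y)\<bar> * \<bar>\<eta> x\<bar> + \<bar>f2 (cl y)\<bar> * \<bar>\<eta> x - \<eta> y\<bar>"
      by (simp add: abs_mult[symmetric])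
    also have "\<dots> \<le> (K * \<bar>x - y\<bar>) * 1 + B * \<bar>x - y\<bar>"
    proof (intro add_mono mult_mono)
      have "\<bar>f2 (cl x) - f2 (cl y)\<bar> \<le> K * \<bar>cl x - cl y\<bar>" by (rule lip2[OF cl cl])
      also have "\<dots> \<le> K * \<bar>x - y\<bar>" by (rule mult_left_mono[OF cl_lip K0])
      finally show "\<bar>f2 (cl x) - f2 (cl y)\<bar> \<le> K * \<bar>x - y\<bar>" .
    qed (use \<eta>_bd \<eta>_lip B[OF cl] B0 K0 in auto)
    finally show ?thesis by (simp add: algebra_simps)
  qed
  have lip_cont: "continuous_on UNIV u" if "\<And>x y. \<bar>u x - u y\<bar> \<le> C * \<bar>x - y\<bar>" "0 \<le> C" for u :: "real \<Rightarrow> real" and C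
  proof -
    have "C-lipschitz_on UNIV u" using that by (intro lipschitz_onI) (auto simp: dist_real_def)
    then show ?thesis by (rule lipschitz_on_continuous_on)
  qed
  have g2_cont: "continuous_on UNIV g2" using lip_cont[OF g2_lip] K0 B0 by simp
  have antideriv: "\<exists>G. (\<forall>x. (G has_real_derivative u x) (at x)) \<and> G a = v"
    if "continuous_on UNIV u" for u :: "real \<Rightarrow> real" and v
  proof -
    have "isCont u x" for x using that continuous_on_eq_continuous_at[of UNIV u] by simp
    then obtain G where "\<And>x. (G has_vector_derivative u x) (at x)"
      using einterval_antiderivative[of "-\<infinity>" "\<infinity>" u] by auto
    then have "((\<lambda>x. G x + (v - G a)) has_real_derivative u x) (at x)" for x
      by (auto intro!: derivative_eq_intros simp: has_real_derivative_iff_has_vector_derivative[symmetric])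
    then show ?thesis by (intro exI[of _ "\<lambda>x. G x + (v - G a)"]) simp
  qed
  obtain g1 where g1: "\<And>x. (g1 has_real_derivative g2 x) (at x)" "g1 a = f1 a" using antideriv[OF g2_cont] by blast
  have g1_cont: "continuous_on UNIV g1"
    by (intro continuous_at_imp_continuous_on ballI DERIV_isCont[OF g1(1)])
  obtain g where g: "\<And>x. (g has_real_derivative g1 x) (at x)" "g a = f a" using antideriv[OF g1_cont] by blast
  have g_cont: "continuous_on UNIV g"
    by (intro continuous_at_imp_continuous_on ballI DERIV_isCont[OF g(1)])
  have eqI: "u x = w x" if "\<And>x. x \<in> {a..b} \<Longrightarrow> (u has_real_derivative k x) (at x)"
    "\<And>x. x \<in> {a..b} \<Longrightarrow> (w has_real_derivative k x) (at x)" "u a = w a" "x \<in> {a..b}" for u w k :: "real \<Rightarrow> real" and x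
  proof -
    have "((\<lambda>x. u x - w x) has_real_derivative 0) (at x within {a..b})" if "x \<in> {a..b}" for x
      using DERIV_diff[OF \<open>\<And>x. x \<in> {a..b} \<Longrightarrow> (u has_real_derivative k x) (at x)\<close>[OF that]
        \<open>\<And>x. x \<in> {a..b} \<Longrightarrow> (w has_real_derivative k x) (at x)\<close>[OF that]]
      by (auto intro: has_field_derivative_at_within)
    from has_field_derivative_zero_constant[OF _ this] obtain C where "\<And>x. x \<in> {a..b} \<Longrightarrow> u x - w x = C" by auto
    from this[of a] this[OF that(4)] that(3) ab show ?thesis by simp
  qed
  have g1_eq: "g1 x = f1 x" if "x \<in> {a..b}" for x
  proof (rule eqI[of g1 g2 f1, OF g1(1) _ g1(2) that])
    fix y assume "y \<in> {a..b}"
    then show "(f1 has_real_derivative g2 y) (at y)" using D(2) g2_eq by simp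
  qed
  have g_eq: "g x = f x" if "x \<in> {a..b}" for x
  proof (rule eqI[of g g1 f, OF g(1) _ g(2) that])
    fix y assume "y \<in> {a..b}"
    then show "(f has_real_derivative g1 y) (at y)" using D(1) g1_eq by simp
  qed
  have g2_0: "g2 x = 0" if "x \<le> a - 1 \<or> b + 1 \<le> x" for x
  proof -
    have "1 \<le> \<bar>x - cl x\<bar>" using that ab unfolding cl_def by linarith
    then show ?thesis by (simp add: g2_def \<eta>_def)
  qed
  have const: "\<exists>C. \<forall>x\<in>S. g1 x = C" if "convex S" "\<And>x. x \<in> S \<Longrightarrow> g2 x = 0" for S
    using that(2) g1(1) by (intro has_field_derivative_zero_constant[OF that(1)]) (metis has_field_derivative_at_within)
  obtain C1 where C1: "\<And>x. x \<le> a - 1 \<Longrightarrow> g1 x = C1" using const[of "{..a - 1}"] g2_0 by auto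
  obtain C2 where C2: "\<And>x. b + 1 \<le> x \<Longrightarrow> g1 x = C2" using const[of "{b + 1..}"] g2_0 by auto
  obtain C3 where C3: "\<And>x. x \<in> {a - 1..b + 1} \<Longrightarrow> \<bar>g1 x\<bar> \<le> C3"
    using compact_imp_bounded[OF compact_continuous_image[OF continuous_on_subset[OF g1_cont subset_UNIV] compact_Icc]]
    unfolding bounded_iff real_norm_def by blast
  have g1_bd: "\<bar>g1 x\<bar> \<le> \<bar>C1\<bar> + \<bar>C2\<bar> + \<bar>C3\<bar>" for x
    using C1[of x] C2[of x] C3[of x] by (cases "x \<le> a - 1"; cases "b + 1 \<le> x") auto
  define L where "L = \<bar>C1\<bar> + \<bar>C2\<bar> + \<bar>C3\<bar> + K + B"
  have L: "0 \<le> L" "\<bar>C1\<bar> + \<bar>C2\<bar> + \<bar>C3\<bar> \<le> L" "K + B \<le> L" "B \<le> L" using K0 B0 by (auto simp: L_def)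
  have "tame_C2 L g g1 g2"
    unfolding tame_C2_def
  proof (intro conjI allI)
    show "0 \<le> L" by (rule L)
    show "continuous_on UNIV g" "continuous_on UNIV g1" "continuous_on UNIV g2" by fact+
    show "\<bar>g1 x\<bar> \<le> L" "\<bar>g2 x\<bar> \<le> L" for x using g1_bd[of x] g2_bd[of x] L by linarith+
    show "\<bar>g x - g y\<bar> \<le> L * \<bar>x - y\<bar>" for x y
      using field_differentiable_bound[OF convex_UNIV g(1), of L x y] order_trans[OF g1_bd L(2)] by simp
    show l2: "\<bar>g2 x - g2 y\<bar> \<le> L * \<bar>x - y\<bar>" for x y
      by (rule order_trans[OF g2_lip mult_right_mono[OF L(3)]]) simp
    show "g (z + h) - g z \<le> g1 z * h + g2 z * h\<^sup>2 / 2 + L * \<bar>h\<bar> ^ 3" for z h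
    proof (cases "h = 0")
      case False
      let ?diff = "\<lambda>m::nat. if m = 0 then g else if m = 1 then g1 else g2"
      \<comment> \<open>Lagrange remainder of second order. Lipschitz continuity of
        \<open>g2\<close> moves it from the intermediate point to \<open>z\<close>, leaving an error
        of third order.\<close>
      have "\<exists>t. (if z + h < z then z + h < t \<and> t < z else z < t \<and> t < z + h) \<and>
        g (z + h) = (\<Sum>m<2. (?diff m z / fact m) * (z + h - z) ^ m) + (?diff 2 t / fact 2) * (z + h - z)\<^sup>2"
        by (rule Taylor[where a="min z (z + h)" and b = "max z (z + h)"])
          (use False g(1) g1(1) in \<open>auto simp: less_2_cases_iff\<close>)
      then obtain t where t0: "if z + h < z then z + h < t \<and> t < z else z < t \<and> t < z + h"
        and t1: "g (z + h) = (\<Sum>m<2. (?diff m z / fact m) * (z + h - z) ^ m) + (?diff 2 t / fact 2) * (z + h - z)\<^sup>2"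
        by blast
      have t: "\<bar>t - z\<bar> \<le> \<bar>h\<bar>" "g (z + h) = g z + g1 z * h + g2 t / 2 * h\<^sup>2"
        using t0 t1 by (auto simp: numeral_2_eq_2 split: if_splits)
      have "g2 t \<le> g2 z + L * \<bar>h\<bar>"
        using l2[of t z] mult_left_mono[OF t(1) L(1)] by linarith
      then have "g2 t * h\<^sup>2 \<le> (g2 z + L * \<bar>h\<bar>) * h\<^sup>2" by (rule mult_right_mono) simp
      also have "\<dots> = g2 z * h\<^sup>2 + L * \<bar>h\<bar> ^ 3"
        by (simp add: power3_eq_cube power2_eq_square algebra_simps abs_mult_self_eq)
      finally have "g2 t / 2 * h\<^sup>2 \<le> g2 z * h\<^sup>2 / 2 + L * \<bar>h\<bar> ^ 3 / 2" by simp
      moreover have "L * \<bar>h\<bar> ^ 3 / 2 \<le> L * \<bar>h\<bar> ^ 3" using L(1) by simp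
      ultimately show ?thesis using t(2) by linarith
    qed simp
  qed
  then show ?thesis using g_eq g2_eq by blast
qed

context ito_solution
begin

text \<open>Since the path does not leave \<open>{a..b}\<close> before \<open>\<tau>\<close>, and
  the extension keeps \<open>f\<close> and \<open>f2\<close> there, nothing is required of
  \<open>f\<close> away from the interval. This admits functions that are singular at the ends of
  the unit interval.\<close>

lemma discounted_supermartingale:
  fixes f f1 f2 f3 :: "real \<Rightarrow> real"
  assumes \<tau>: "nn_stopping_time M F \<tau>" and T: "\<And>\<omega>. \<omega> \<in> space M \<Longrightarrow> \<tau> \<omega> \<le> T"
    and r: "0 \<le> r"
    and S: "\<And>\<omega> t. \<omega> \<in> space M \<Longrightarrow> 0 \<le> t \<Longrightarrow> t \<le> \<tau> \<omega> \<Longrightarrow> X t \<omega> \<in> {a..b}"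
    and D: "\<And>x. x \<in> {a..b} \<Longrightarrow> (f has_real_derivative f1 x) (at x)"
      "\<And>x. x \<in> {a..b} \<Longrightarrow> (f1 has_real_derivative f2 x) (at x)"
      "\<And>x. x \<in> {a..b} \<Longrightarrow> (f2 has_real_derivative f3 x) (at x)"
    and f3: "continuous_on {a..b} f3"
    and super: "\<And>x. x \<in> {a..b} \<Longrightarrow> (c x)\<^sup>2 / 2 * f2 x \<le> r * f x"
  shows "expectation (\<lambda>\<omega>. exp (- r * \<tau> \<omega>) * f (X (\<tau> \<omega>) \<omega>)) \<le> f d"
proof -
  obtain \<omega>0 where \<omega>0: "\<omega>0 \<in> space M" using not_empty by blast
  have d: "d \<in> {a..b}" using S[OF \<omega>0, of 0] X_0[OF \<omega>0] stopping_nonneg[OF \<tau> \<omega>0] by simp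
  then have ab: "a \<le> b" by simp
  obtain g g1 g2 L where g: "\<And>x. x \<in> {a..b} \<Longrightarrow> g x = f x" and g2: "\<And>x. x \<in> {a..b} \<Longrightarrow> g2 x = f2 x"
    and ext: "tame_C2 L g g1 g2"
    using extend_smooth[OF ab D f3] by blast
  note ext' = ext[unfolded tame_C2_def]
  have L: "0 \<le> L" and cont: "continuous_on UNIV g" "continuous_on UNIV g1" "continuous_on UNIV g2"
    using ext' by (simp_all only:)
  have g_lip: "\<bar>g x - g y\<bar> \<le> L * \<bar>x - y\<bar>" and g2_lip: "\<bar>g2 x - g2 y\<bar> \<le> L * \<bar>x - y\<bar>" for x y
    using ext' by (simp_all only:)
  have g1_bd: "\<bar>g1 x\<bar> \<le> L" and g2_bd: "\<bar>g2 x\<bar> \<le> L" for x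
    using ext' by (simp_all only:)
  have tay: "g (z + h) - g z \<le> g1 z * h + g2 z * h\<^sup>2 / 2 + L * \<bar>h\<bar> ^ 3" for z h
    using ext' by (simp only:)
  have "\<exists>K. \<forall>x\<in>{a..b}. \<bar>u x\<bar> \<le> K" if "continuous_on UNIV u" for u :: "real \<Rightarrow> real"
    using compact_imp_bounded[OF compact_continuous_image[OF continuous_on_subset[OF that subset_UNIV] compact_Icc]]
    unfolding bounded_iff real_norm_def by blast
  from this[OF c_cont] this[OF cont(1)] obtain K1 K2
    where K1: "\<And>x. x \<in> {a..b} \<Longrightarrow> \<bar>c x\<bar> \<le> K1" and K2: "\<And>x. x \<in> {a..b} \<Longrightarrow> \<bar>g x\<bar> \<le> K2" by blast
  define L' where "L' = L + \<bar>K1\<bar> + \<bar>K2\<bar> + \<bar>a\<bar> + \<bar>b\<bar>"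
  have L': "L \<le> L'" "0 \<le> L'" using L by (auto simp: L'_def)
  have LL: "L * u \<le> L' * u" if "0 \<le> u" for u using L'(1) that by (rule mult_right_mono)
  have "expectation (\<lambda>\<omega>. exp (- r * \<tau> \<omega>) * g (X (\<tau> \<omega>) \<omega>)) \<le> g d"
  proof (rule discounted_supermartingale_smooth[where T = "max T 1" and L = L' and S = "{a..b}" and ?f1.0 = g1 and ?f2.0 = g2])
    show "\<tau> \<omega> \<le> max T 1" if "\<omega> \<in> space M" for \<omega> using T[OF that] by simp
    show "\<bar>x\<bar> \<le> L' \<and> \<bar>c x\<bar> \<le> L' \<and> \<bar>g x\<bar> \<le> L'" if "x \<in> {a..b}" for x
      using K1[OF that] K2[OF that] that L unfolding L'_def by auto
    show "(c x)\<^sup>2 / 2 * g2 x \<le> r * g x" if "x \<in> {a..b}" for x using super[OF that] g[OF that] g2[OF that] by simp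
    show "g \<in> borel_measurable borel" "g1 \<in> borel_measurable borel" "g2 \<in> borel_measurable borel"
      using cont by (auto intro: borel_measurable_continuous_onI)
    show "\<bar>g x - g y\<bar> \<le> L' * \<bar>x - y\<bar>" "\<bar>g2 x - g2 y\<bar> \<le> L' * \<bar>x - y\<bar>" for x y
      using g_lip[of x y] g2_lip[of x y] LL[of "\<bar>x - y\<bar>"] by auto
    show "\<bar>g1 x\<bar> \<le> L'" "\<bar>g2 x\<bar> \<le> L'" for x using g1_bd[of x] g2_bd[of x] L' by auto
    show "g (z + h) - g z \<le> g1 z * h + g2 z * h\<^sup>2 / 2 + L' * \<bar>h\<bar> ^ 3" for z h
      using tay[of z h] LL[of "\<bar>h\<bar> ^ 3"] by simp
  qed (use \<tau> r L' S in auto)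
  moreover have "expectation (\<lambda>\<omega>. exp (- r * \<tau> \<omega>) * g (X (\<tau> \<omega>) \<omega>)) = expectation (\<lambda>\<omega>. exp (- r * \<tau> \<omega>) * f (X (\<tau> \<omega>) \<omega>))"
    by (rule Bochner_Integration.integral_cong[OF refl]) (use g S stopping_nonneg[OF \<tau>] in auto)
  ultimately show ?thesis using g[OF d] by simp
qed

text \<open>The inequality for \<open>f\<close> and for \<open>- f\<close>.\<close>

lemma discounted_martingale:
  fixes f f1 f2 f3 :: "real \<Rightarrow> real"
  assumes \<tau>: "nn_stopping_time M F \<tau>" and T: "\<And>\<omega>. \<omega> \<in> space M \<Longrightarrow> \<tau> \<omega> \<le> T"
    and r: "0 \<le> r"
    and S: "\<And>\<omega> t. \<omega> \<in> space M \<Longrightarrow> 0 \<le> t \<Longrightarrow> t \<le> \<tau> \<omega> \<Longrightarrow> X t \<omega> \<in> {a..b}"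
    and D: "\<And>x. x \<in> {a..b} \<Longrightarrow> (f has_real_derivative f1 x) (at x)"
      "\<And>x. x \<in> {a..b} \<Longrightarrow> (f1 has_real_derivative f2 x) (at x)"
      "\<And>x. x \<in> {a..b} \<Longrightarrow> (f2 has_real_derivative f3 x) (at x)"
    and f3: "continuous_on {a..b} f3"
    and eq: "\<And>x. x \<in> {a..b} \<Longrightarrow> (c x)\<^sup>2 / 2 * f2 x = r * f x"
  shows "expectation (\<lambda>\<omega>. exp (- r * \<tau> \<omega>) * f (X (\<tau> \<omega>) \<omega>)) = f d"
proof (rule antisym)
  show "expectation (\<lambda>\<omega>. exp (- r * \<tau> \<omega>) * f (X (\<tau> \<omega>) \<omega>)) \<le> f d"
    using discounted_supermartingale[OF \<tau> T r S D f3] eq by simp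
  have "expectation (\<lambda>\<omega>. exp (- r * \<tau> \<omega>) * - f (X (\<tau> \<omega>) \<omega>)) \<le> - f d"
  proof (rule discounted_supermartingale[OF \<tau> T r S, where ?f1.0 = "\<lambda>x. - f1 x" and ?f2.0 = "\<lambda>x. - f2 x" and ?f3.0 = "\<lambda>x. - f3 x"])
    show "continuous_on {a..b} (\<lambda>x. - f3 x)" using f3 by (intro continuous_intros)
    show "(c x)\<^sup>2 / 2 * - f2 x \<le> r * - f x" if "x \<in> {a..b}" for x using eq[OF that] by simp
  qed (use D in \<open>auto intro!: DERIV_minus\<close>)
  then show "f d \<le> expectation (\<lambda>\<omega>. exp (- r * \<tau> \<omega>) * f (X (\<tau> \<omega>) \<omega>))" by simp
qed

section \<open>Exit times from open intervals\<close>

definition exit_time :: "real \<Rightarrow> real \<Rightarrow> real \<Rightarrow> 'a \<Rightarrow> real" where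
  "exit_time a b N \<omega> = Inf {s \<in> {0..N}. s = N \<or> X s \<omega> \<notin> {a<..<b}}"

text \<open>The cap \<open>N\<close> always belongs to the set whose infimum is taken, so the time
  is bounded. Path continuity makes that set closed, hence the infimum is attained, and an exit
  before the cap happens exactly at an end point.\<close>

lemma exit_time:
  assumes \<omega>: "\<omega> \<in> space M" and N: "0 \<le> N" and d: "a < d" "d < b"
  shows "0 \<le> exit_time a b N \<omega>" "exit_time a b N \<omega> \<le> N"
    and "\<And>s. 0 \<le> s \<Longrightarrow> s < exit_time a b N \<omega> \<Longrightarrow> X s \<omega> \<in> {a<..<b}"
    and "\<And>s. 0 \<le> s \<Longrightarrow> s \<le> exit_time a b N \<omega> \<Longrightarrow> X s \<omega> \<in> {a..b}"
    and "exit_time a b N \<omega> < N \<Longrightarrow> X (exit_time a b N \<omega>) \<omega> = a \<or> X (exit_time a b N \<omega>) \<omega> = b"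
proof -
  let ?E = "{s \<in> {0..N}. s = N \<or> X s \<omega> \<notin> {a<..<b}}" and ?\<rho> = "exit_time a b N \<omega>"
  have cont: "continuous_on {0..N} (\<lambda>s. X s \<omega>)" by (rule continuous_on_subset[OF X_cont[OF \<omega>]]) auto
  have E: "?E = ({0..N} \<inter> (\<lambda>s. X s \<omega>) -` (- {a<..<b})) \<union> {N}" using N by auto
  have "closed ({0..N} \<inter> (\<lambda>s. X s \<omega>) -` (- {a<..<b}))"
    by (rule continuous_on_closed_vimage[THEN iffD1, rule_format, OF _ cont, simplified Int_commute]) auto
  then have "closed ?E" unfolding E by auto
  moreover have "N \<in> ?E" using N by simp
  moreover have bdd: "bdd_below ?E" by (rule bdd_belowI[of _ 0]) auto
  ultimately have in_E: "?\<rho> \<in> ?E" unfolding exit_time_def by (intro closed_contains_Inf) auto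
  then show \<rho>: "0 \<le> ?\<rho>" "?\<rho> \<le> N" by auto
  show lt: "X s \<omega> \<in> {a<..<b}" if "0 \<le> s" "s < ?\<rho>" for s
  proof (rule ccontr)
    assume "X s \<omega> \<notin> {a<..<b}"
    then have "s \<in> ?E" using that \<rho> by auto
    from cInf_lower[OF this bdd] that show False unfolding exit_time_def by simp
  qed
  show le: "X s \<omega> \<in> {a..b}" if "0 \<le> s" "s \<le> ?\<rho>" for s
  proof (cases "s < ?\<rho>")
    case True then show ?thesis using lt[OF that(1)] by auto
  next
    case False
    then have s: "s = ?\<rho>" using that by simp
    show ?thesis
    proof (cases "?\<rho> = 0")
      case True then show ?thesis using X_0[OF \<omega>] d s by simp
    next
      case False
      then have "closure {0..<?\<rho>} = {0..?\<rho>}" using \<rho> by simp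
      then have c: "continuous_on (closure {0..<?\<rho>}) (\<lambda>s. X s \<omega>)" "s \<in> closure {0..<?\<rho>}"
        using cont \<rho> s by (auto intro: continuous_on_subset)
      have "X s \<omega> \<le> b" by (rule continuous_le_on_closure[OF c]) (use lt in \<open>auto intro: less_imp_le\<close>)
      moreover have "a \<le> X s \<omega>" by (rule continuous_ge_on_closure[OF c]) (use lt in \<open>auto intro: less_imp_le\<close>)
      ultimately show ?thesis by simp
    qed
  qed
  show "X ?\<rho> \<omega> = a \<or> X ?\<rho> \<omega> = b" if "?\<rho> < N"
    using in_E that le[OF \<rho>(1)] by auto
qed

text \<open>The filtration is not assumed right-continuous, so the event must be expressed by times
  up to \<open>t\<close> alone. By compactness, a path stays in the open interval on
  \<open>{0..t}\<close> iff it stays in some slightly smaller closed interval, and for a closed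
  interval a countable dense set of times decides.\<close>

lemma exit_time_stopping:
  assumes N: "0 \<le> N" and d: "a < d" "d < b"
  shows "nn_stopping_time M F (exit_time a b N)"
  unfolding nn_stopping_time_def
proof (intro conjI allI impI ballI)
  fix \<omega> assume "\<omega> \<in> space M" then show "0 \<le> exit_time a b N \<omega>" using exit_time(1) N d by blast
next
  fix t :: real assume t: "0 \<le> t"
  show "{\<omega>\<in>space M. exit_time a b N \<omega> \<le> t} \<in> sets (F t)"
  proof (cases "N \<le> t")
    case True
    have "{\<omega>\<in>space M. exit_time a b N \<omega> \<le> t} = space (F t)"
      unfolding space_filtration[OF t] using order_trans[OF exit_time(2)[OF _ N d] True] by blast
    then show ?thesis by (simp only: sets.top)
  next
    case False
    \<comment> \<open>Including 0 keeps the set nonempty and dense in \<open>{0..t}\<close> when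
      \<open>t = 0\<close>.\<close>
    define D where "D = insert 0 ({0<..<t} \<inter> \<rat>)"
    have D: "countable D" unfolding D_def by (intro countable_insert countable_Int2 countable_rat)
    have Dt: "D \<subseteq> {0..t}" using t by (auto simp: D_def)
    have clD: "closure D = {0..t}"
    proof (cases "t = 0")
      case False
      then have "closure ({0<..<t} \<inter> \<rat>) = {0..t}"
        using t closure_open_Int_superset[of "{0<..<t}" \<rat>] by (simp add: Rats_closure_real)
      moreover have "insert 0 {0..t} = {0..t}" using t by (simp add: insert_absorb)
      ultimately show ?thesis unfolding D_def closure_insert by (simp only:)
    qed (simp add: D_def)
    define I where "I = (\<Union>k::nat. \<Inter>q\<in>D. {\<omega>\<in>space M. X q \<omega> \<in> {a + 1 / real (Suc k)..b - 1 / real (Suc k)}})"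
    have ev: "{\<omega>\<in>space M. X q \<omega> \<in> {a + 1 / real (Suc k)..b - 1 / real (Suc k)}} \<in> sets (F t)" if "q \<in> D" for q k
    proof -
      have q: "0 \<le> q" "q \<le> t" using that Dt by auto
      have "X q -` {a + 1 / real (Suc k)..b - 1 / real (Suc k)} \<inter> space (F t) \<in> sets (F t)"
        by (rule measurable_sets[OF adapted_mono[OF q X_adapted[OF q(1)]]]) simp
      moreover have "X q -` {a + 1 / real (Suc k)..b - 1 / real (Suc k)} \<inter> space (F t)
        = {\<omega>\<in>space M. X q \<omega> \<in> {a + 1 / real (Suc k)..b - 1 / real (Suc k)}}"
        using space_filtration[OF t] by blast
      ultimately show ?thesis by (simp only:)
    qed
    have ne: "D \<noteq> {}" by (simp add: D_def)
    have I: "I \<in> sets (F t)" unfolding I_def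
      by (intro sets.countable_UN image_subsetI sets.countable_INT'[OF D ne] ev)
    have I_iff: "\<omega> \<in> I \<longleftrightarrow> (\<forall>s\<in>{0..t}. X s \<omega> \<in> {a<..<b})" if \<omega>: "\<omega> \<in> space M" for \<omega>
    proof
      assume "\<omega> \<in> I"
      then obtain k where k: "\<And>q. q \<in> D \<Longrightarrow> X q \<omega> \<in> {a + 1 / real (Suc k)..b - 1 / real (Suc k)}" unfolding I_def by blast
      have c: "continuous_on (closure D) (\<lambda>s. X s \<omega>)"
        unfolding clD by (rule continuous_on_subset[OF X_cont[OF \<omega>]]) auto
      show "\<forall>s\<in>{0..t}. X s \<omega> \<in> {a<..<b}"
      proof
        fix s assume "s \<in> {0..t}"
        then have s: "s \<in> closure D" by (simp add: clD)
        have "X s \<omega> \<le> b - 1 / real (Suc k)" by (rule continuous_le_on_closure[OF c s]) (use k in auto)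
        moreover have "a + 1 / real (Suc k) \<le> X s \<omega>" by (rule continuous_ge_on_closure[OF c s]) (use k in auto)
        moreover have "0 < 1 / real (Suc k)" by simp
        ultimately show "X s \<omega> \<in> {a<..<b}" unfolding greaterThanLessThan_iff by linarith
      qed
    next
      assume R: "\<forall>s\<in>{0..t}. X s \<omega> \<in> {a<..<b}"
      have c: "continuous_on {0..t} (\<lambda>s. X s \<omega>)" by (rule continuous_on_subset[OF X_cont[OF \<omega>]]) auto
      have ne: "{0..t} \<noteq> {}" using t by auto
      obtain s1 where s1: "s1 \<in> {0..t}" "\<And>s. s \<in> {0..t} \<Longrightarrow> X s1 \<omega> \<le> X s \<omega>"
        using continuous_attains_inf[OF compact_Icc ne c] by blast
      obtain s2 where s2: "s2 \<in> {0..t}" "\<And>s. s \<in> {0..t} \<Longrightarrow> X s \<omega> \<le> X s2 \<omega>"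
        using continuous_attains_sup[OF compact_Icc ne c] by blast
      have "0 < min (X s1 \<omega> - a) (b - X s2 \<omega>)" using R s1(1) s2(1) by auto
      then obtain k where k: "1 / real (Suc k) < min (X s1 \<omega> - a) (b - X s2 \<omega>)"
        using nat_approx_posE by blast
      have "X q \<omega> \<in> {a + 1 / real (Suc k)..b - 1 / real (Suc k)}" if "q \<in> D" for q
        using s1(2)[of q] s2(2)[of q] k that Dt unfolding atLeastAtMost_iff by (auto simp del: of_nat_Suc)
      then show "\<omega> \<in> I" unfolding I_def using \<omega> by blast
    qed
    have "{\<omega>\<in>space M. exit_time a b N \<omega> \<le> t} = space (F t) - I"
    proof (rule set_eqI)
      fix \<omega>
      show "\<omega> \<in> {\<omega>\<in>space M. exit_time a b N \<omega> \<le> t} \<longleftrightarrow> \<omega> \<in> space (F t) - I"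
      proof (cases "\<omega> \<in> space M")
        case \<omega>: True
        note e = exit_time[OF \<omega> N d]
        have "exit_time a b N \<omega> \<le> t \<longleftrightarrow> \<not> (\<forall>s\<in>{0..t}. X s \<omega> \<in> {a<..<b})"
        proof
          assume le: "exit_time a b N \<omega> \<le> t"
          then have "X (exit_time a b N \<omega>) \<omega> = a \<or> X (exit_time a b N \<omega>) \<omega> = b" using e(5) False by simp
          then have "X (exit_time a b N \<omega>) \<omega> \<notin> {a<..<b}" by auto
          then show "\<not> (\<forall>s\<in>{0..t}. X s \<omega> \<in> {a<..<b})" using e(1) le by auto
        next
          assume "\<not> (\<forall>s\<in>{0..t}. X s \<omega> \<in> {a<..<b})"
          then obtain s where s: "0 \<le> s" "s \<le> t" "X s \<omega> \<notin> {a<..<b}" by auto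
          then have "\<not> s < exit_time a b N \<omega>" using e(3) by blast
          then show "exit_time a b N \<omega> \<le> t" using s by simp
        qed
        then show ?thesis using I_iff[OF \<omega>] \<omega> space_filtration[OF t] by simp
      qed (use space_filtration[OF t] in auto)
    qed
    then show ?thesis using sets.compl_sets[OF I] by (simp only:)
  qed
qed

end

section \<open>The belief process\<close>

text \<open>For \<open>b (b - 1) \<sigma>\<^sup>2 / 2 = r\<close> with \<open>b > 1\<close>, the functions \<open>u b x\<close> and \<open>u b (1 - x)\<close> span the
  solutions of \<open>\<sigma>\<^sup>2 x\<^sup>2 (1 - x)\<^sup>2 / 2 * f'' = r f\<close> on \<open>(0, 1)\<close>.\<close>

definition u :: "real \<Rightarrow> real \<Rightarrow> real" where
  "u b x = x powr b * (1 - x) powr (1 - b)"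

text \<open>The factor is the logarithmic derivative \<open>b / x - (1 - b) / (1 - x)\<close> over a
  common denominator.\<close>

definition u' :: "real \<Rightarrow> real \<Rightarrow> real" where
  "u' b x = u b x * ((b - x) / (x * (1 - x)))"

definition u'' :: "real \<Rightarrow> real \<Rightarrow> real" where
  "u'' b x = b * (b - 1) * (u b x / (x * (1 - x))\<^sup>2)"

definition u''' :: "real \<Rightarrow> real \<Rightarrow> real" where
  "u''' b x = b * (b - 1) * (u' b x / (x * (1 - x))\<^sup>2 - u b x * (2 * (1 - 2 * x)) / (x * (1 - x)) ^ 3)"

lemma u_pos: "0 < x \<Longrightarrow> x < 1 \<Longrightarrow> 0 < u b x"
  by (simp add: u_def)

lemma u_deriv:
  assumes "0 < x" "x < 1"
  shows "(u b has_real_derivative u' b x) (at x)"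
proof -
  have x': "0 < 1 - x" using assms by simp
  have lin: "((\<lambda>x::real. 1 - x) has_real_derivative - 1) (at x)" by (auto intro!: derivative_eq_intros)
  have "(u b has_real_derivative
      (b * x powr (b - 1) * (1 - x) powr (1 - b) + x powr b * - ((1 - b) * (1 - x) powr (1 - b - 1)))) (at x)"
    unfolding u_def[abs_def] using assms
    using DERIV_mult[OF has_real_derivative_powr[OF assms(1), of b] DERIV_chain2[OF has_real_derivative_powr[OF x', of "1 - b"] lin]]
    by (simp add: algebra_simps)
  moreover have "b * x powr (b - 1) * (1 - x) powr (1 - b) + x powr b * - ((1 - b) * (1 - x) powr (1 - b - 1)) = u' b x"
  proof -
    have p: "x powr (b - 1) = x powr b / x" "(1 - x) powr (1 - b - 1) = (1 - x) powr (1 - b) / (1 - x)"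
      using assms x' powr_diff[of "1 - x" "1 - b" 1] by (simp_all add: powr_diff)
    have "b * (A / x) * C + A * - ((1 - b) * (C / (1 - x))) = A * C * ((b - x) / (x * (1 - x)))" for A C
      using assms by (simp add: divide_simps) (simp add: algebra_simps)
    then show ?thesis unfolding u'_def u_def p .
  qed
  ultimately show ?thesis by simp
qed

text \<open>Everything depending on \<open>x\<close> in the numerator cancels and leaves the
  constant \<open>b * (b - 1)\<close>; this cancellation is why \<open>u b\<close> solves the
  generator equation.\<close>

lemma u'_deriv:
  assumes "0 < x" "x < 1"
  shows "(u' b has_real_derivative u'' b x) (at x)"
proof -
  have nz: "x * (1 - x) \<noteq> 0" using assms by simp
  have "(u' b has_real_derivative
      (u' b x * ((b - x) / (x * (1 - x))) + u b x * ((- (x * (1 - x)) - (b - x) * (1 - 2 * x)) / (x * (1 - x))\<^sup>2))) (at x)"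
    unfolding u'_def[abs_def]
    by (rule derivative_eq_intros u_deriv assms refl | use nz in \<open>simp add: u'_def power2_eq_square algebra_simps\<close>)+
  moreover have "u' b x * ((b - x) / (x * (1 - x))) + u b x * ((- (x * (1 - x)) - (b - x) * (1 - 2 * x)) / (x * (1 - x))\<^sup>2)
     = u b x * (((b - x)\<^sup>2 + (- (x * (1 - x)) - (b - x) * (1 - 2 * x))) / (x * (1 - x))\<^sup>2)"
    by (simp add: u'_def power2_eq_square algebra_simps add_divide_distrib diff_divide_distrib)
  moreover have "(b - x)\<^sup>2 + (- (x * (1 - x)) - (b - x) * (1 - 2 * x)) = b * (b - 1)"
    by (simp add: power2_eq_square algebra_simps)
  ultimately show ?thesis by (simp add: u''_def mult.commute)
qed

lemma u''_deriv:
  assumes "0 < x" "x < 1"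
  shows "(u'' b has_real_derivative u''' b x) (at x)"
proof -
  have nz: "x * (1 - x) \<noteq> 0" using assms by simp
  have "((\<lambda>x. (x * (1 - x))\<^sup>2) has_real_derivative 2 * (x * (1 - x)) * (1 - 2 * x)) (at x)"
    by (auto intro!: derivative_eq_intros simp: algebra_simps power2_eq_square)
  from DERIV_divide[OF u_deriv[OF assms, of b] this] nz
  have "((\<lambda>x. u b x / (x * (1 - x))\<^sup>2) has_real_derivative
      (u' b x * (x * (1 - x))\<^sup>2 - u b x * (2 * (x * (1 - x)) * (1 - 2 * x))) / ((x * (1 - x))\<^sup>2 * (x * (1 - x))\<^sup>2)) (at x)"
    by simp
  moreover have "(u' b x * (x * (1 - x))\<^sup>2 - u b x * (2 * (x * (1 - x)) * (1 - 2 * x))) / ((x * (1 - x))\<^sup>2 * (x * (1 - x))\<^sup>2)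
     = u' b x / (x * (1 - x))\<^sup>2 - u b x * (2 * (1 - 2 * x)) / (x * (1 - x)) ^ 3"
  proof -
    define w where "w = x * (1 - x)"
    have "w \<noteq> 0" using nz by (simp add: w_def)
    then show ?thesis unfolding w_def[symmetric]
      by (simp add: diff_divide_distrib power2_eq_square power3_eq_cube)
  qed
  ultimately have "((\<lambda>x. u b x / (x * (1 - x))\<^sup>2) has_real_derivative
      u' b x / (x * (1 - x))\<^sup>2 - u b x * (2 * (1 - 2 * x)) / (x * (1 - x)) ^ 3) (at x)" by (simp only:)
  then show ?thesis unfolding u''_def[abs_def] u'''_def by (rule DERIV_cmult)
qed

lemma u'''_cont:
  assumes "0 < lo" "hi < 1"
  shows "continuous_on {lo..hi} (u''' b)"
proof -
  have c: "continuous_on {lo..hi} (u b)" "continuous_on {lo..hi} (u' b)"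
    using assms by (auto intro!: continuous_at_imp_continuous_on DERIV_isCont[OF u_deriv] DERIV_isCont[OF u'_deriv])
  show ?thesis unfolding u'''_def[abs_def]
    by (intro continuous_intros c) (use assms in auto)
qed

lemma u_measurable [measurable]: "u b \<in> borel_measurable borel"
  unfolding u_def[abs_def] by measurable

text \<open>In the coordinate \<open>u b x / u b (1 - x)\<close> and after division by \<open>u b (1 - x)\<close>, these are the
  affine functions; this is the sense in which the value function is a concave envelope.\<close>

definition harm :: "real \<Rightarrow> real \<Rightarrow> real \<Rightarrow> real \<Rightarrow> real" where
  "harm b \<alpha> \<gamma> x = \<alpha> * u b (1 - x) + \<gamma> * u b x"

definition harm' :: "real \<Rightarrow> real \<Rightarrow> real \<Rightarrow> real \<Rightarrow> real" where
  "harm' b \<alpha> \<gamma> x = - \<alpha> * u' b (1 - x) + \<gamma> * u' b x"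

definition harm'' :: "real \<Rightarrow> real \<Rightarrow> real \<Rightarrow> real \<Rightarrow> real" where
  "harm'' b \<alpha> \<gamma> x = \<alpha> * u'' b (1 - x) + \<gamma> * u'' b x"

definition harm''' :: "real \<Rightarrow> real \<Rightarrow> real \<Rightarrow> real \<Rightarrow> real" where
  "harm''' b \<alpha> \<gamma> x = - \<alpha> * u''' b (1 - x) + \<gamma> * u''' b x"

lemma harm_derivs:
  assumes "0 < x" "x < 1"
  shows "(harm b \<alpha> \<gamma> has_real_derivative harm' b \<alpha> \<gamma> x) (at x)"
    and "(harm' b \<alpha> \<gamma> has_real_derivative harm'' b \<alpha> \<gamma> x) (at x)"
    and "(harm'' b \<alpha> \<gamma> has_real_derivative harm''' b \<alpha> \<gamma> x) (at x)"
proof -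
  have x: "0 < 1 - x" "1 - x < 1" using assms by auto
  have refl: "((\<lambda>x. h (1 - x)) has_real_derivative - h') (at x)"
    if "(h has_real_derivative h') (at (1 - x))" for h :: "real \<Rightarrow> real" and h'
  proof -
    have lin: "((\<lambda>x::real. 1 - x) has_real_derivative - 1) (at x)" by (auto intro!: derivative_eq_intros)
    show ?thesis using DERIV_chain2[where f = h and g = "\<lambda>x. 1 - x" and x = x, OF that lin] by simp
  qed
  show "(harm b \<alpha> \<gamma> has_real_derivative harm' b \<alpha> \<gamma> x) (at x)"
    unfolding harm_def[abs_def] harm'_def
    using DERIV_add[OF DERIV_cmult[OF refl[OF u_deriv[OF x]]] DERIV_cmult[OF u_deriv[OF assms]]] by simp
  show "(harm' b \<alpha> \<gamma> has_real_derivative harm'' b \<alpha> \<gamma> x) (at x)"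
    unfolding harm'_def[abs_def] harm''_def
    using DERIV_add[OF DERIV_cmult[OF refl[OF u'_deriv[OF x]], of "- \<alpha>"] DERIV_cmult[OF u'_deriv[OF assms]]] by simp
  show "(harm'' b \<alpha> \<gamma> has_real_derivative harm''' b \<alpha> \<gamma> x) (at x)"
    unfolding harm''_def[abs_def] harm'''_def
    using DERIV_add[OF DERIV_cmult[OF refl[OF u''_deriv[OF x]]] DERIV_cmult[OF u''_deriv[OF assms]]] by simp
qed

lemma harm'''_cont:
  assumes "0 < lo" "hi < 1"
  shows "continuous_on {lo..hi} (harm''' b \<alpha> \<gamma>)"
proof -
  have "continuous_on {lo..hi} (\<lambda>x. u''' b (1 - x))"
    by (rule continuous_on_compose2[OF u'''_cont[of "1 - hi" "1 - lo"]])
      (use assms in \<open>auto intro!: continuous_intros\<close>)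
  then show ?thesis unfolding harm'''_def[abs_def]
    by (intro continuous_intros u'''_cont assms)
qed

lemma harm_ode:
  assumes "0 < x" "x < 1" and r: "b * (b - 1) * \<sigma>\<^sup>2 / 2 = r"
  shows "(\<sigma> * x * (1 - x))\<^sup>2 / 2 * harm'' b \<alpha> \<gamma> x = r * harm b \<alpha> \<gamma> x"
proof -
  have nz: "x * (1 - x) \<noteq> 0" using assms by simp
  have "harm'' b \<alpha> \<gamma> x = b * (b - 1) * (harm b \<alpha> \<gamma> x / (x * (1 - x))\<^sup>2)"
    by (simp add: harm''_def harm_def u''_def add_divide_distrib algebra_simps)
  moreover have "(\<sigma> * x * (1 - x))\<^sup>2 = \<sigma>\<^sup>2 * (x * (1 - x))\<^sup>2" by (simp add: power_mult_distrib)
  ultimately show ?thesis using nz unfolding r[symmetric] by simp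
qed

lemma harm_measurable [measurable]: "harm b \<alpha> \<gamma> \<in> borel_measurable borel"
  unfolding harm_def[abs_def] by measurable

lemma harm_cont: "0 < lo \<Longrightarrow> hi < 1 \<Longrightarrow> continuous_on {lo..hi} (harm b \<alpha> \<gamma>)"
  by (intro continuous_at_imp_continuous_on ballI DERIV_isCont[OF harm_derivs(1)]) auto

text \<open>\<open>b\<close> is the larger root of the indicial equation of the generator; the other
  root \<open>1 - b\<close> yields \<open>u (1 - b) x\<close>, which is the reflected solution
  \<open>u b (1 - x)\<close>.\<close>

locale belief = bm +
  fixes X :: "real \<Rightarrow> real \<Rightarrow> 'a \<Rightarrow> real" and \<sigma> r b :: real
  assumes r_pos: "0 < r"
    and b: "1 < b" "b * (b - 1) * \<sigma>\<^sup>2 / 2 = r"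
    and sol: "\<And>d. d \<in> {0..1} \<Longrightarrow> solves_belief_sde M F W \<sigma> d (X d)"
begin

lemma ito: "d \<in> {0..1} \<Longrightarrow> ito_solution M F W (\<lambda>x. \<sigma> * x * (1 - x)) d (X d)"
  using sol[of d] unfolding solves_belief_sde_def
  by unfold_locales (auto intro!: continuous_intros)

section \<open>Discounted payoffs and the ends of the unit interval\<close>

definition payoff :: "real \<Rightarrow> (real \<Rightarrow> real) \<Rightarrow> ('a \<Rightarrow> real) \<Rightarrow> real" where
  "payoff d g \<tau> = expectation (\<lambda>\<omega>. exp (- r * \<tau> \<omega>) * g (X d (\<tau> \<omega>) \<omega>))"

lemma discount_bounds:
  assumes "nn_stopping_time M F \<tau>" "\<omega> \<in> space M"
  shows "0 < exp (- r * \<tau> \<omega>)" "exp (- r * \<tau> \<omega>) \<le> 1"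
  using stopping_nonneg[OF assms] r_pos by auto

lemma payoff_measurable:
  assumes "d \<in> {0..1}" "nn_stopping_time M F \<tau>" "g \<in> borel_measurable borel"
  shows "(\<lambda>\<omega>. exp (- r * \<tau> \<omega>) * g (X d (\<tau> \<omega>) \<omega>)) \<in> borel_measurable M"
proof -
  interpret ito_solution M F W "\<lambda>x. \<sigma> * x * (1 - x)" d "X d" by (rule ito[OF assms(1)])
  show ?thesis
    using stopping_measurable[OF assms(2)] measurable_compose[OF X_stop_measurable[OF assms(2)] assms(3)] by simp
qed

lemma payoff_integrable:
  assumes "d \<in> {0..1}" "nn_stopping_time M F \<tau>" "g \<in> borel_measurable borel"
    and K: "AE \<omega> in M. \<bar>g (X d (\<tau> \<omega>) \<omega>)\<bar> \<le> K"
  shows "integrable M (\<lambda>\<omega>. exp (- r * \<tau> \<omega>) * g (X d (\<tau> \<omega>) \<omega>))"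
proof (rule integrable_const_bound[OF _ payoff_measurable[OF assms(1-3)]])
  show "AE \<omega> in M. norm (exp (- r * \<tau> \<omega>) * g (X d (\<tau> \<omega>) \<omega>)) \<le> K"
    using K
  proof (rule AE_mp, intro AE_I2 impI)
    fix \<omega> assume "\<omega> \<in> space M" and k: "\<bar>g (X d (\<tau> \<omega>) \<omega>)\<bar> \<le> K"
    have "exp (- r * \<tau> \<omega>) * \<bar>g (X d (\<tau> \<omega>) \<omega>)\<bar> \<le> \<bar>g (X d (\<tau> \<omega>) \<omega>)\<bar>"
      using discount_bounds[OF assms(2) \<open>\<omega> \<in> space M\<close>] by (intro mult_left_le_one_le) auto
    then show "norm (exp (- r * \<tau> \<omega>) * g (X d (\<tau> \<omega>) \<omega>)) \<le> K" using k by (simp add: abs_mult)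
  qed
qed

lemma harm_martingale:
  assumes d: "d \<in> {0..1}" and lohi: "0 < lo" "hi < 1"
    and \<tau>: "nn_stopping_time M F \<tau>" "\<And>\<omega>. \<omega> \<in> space M \<Longrightarrow> \<tau> \<omega> \<le> T"
    and S: "\<And>\<omega> t. \<omega> \<in> space M \<Longrightarrow> 0 \<le> t \<Longrightarrow> t \<le> \<tau> \<omega> \<Longrightarrow> X d t \<omega> \<in> {lo..hi}"
  shows "payoff d (harm b \<alpha> \<gamma>) \<tau> = harm b \<alpha> \<gamma> d"
    and "integrable M (\<lambda>\<omega>. exp (- r * \<tau> \<omega>) * harm b \<alpha> \<gamma> (X d (\<tau> \<omega>) \<omega>))"
proof -
  interpret ito_solution M F W "\<lambda>x. \<sigma> * x * (1 - x)" d "X d" by (rule ito[OF d])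
  show "payoff d (harm b \<alpha> \<gamma>) \<tau> = harm b \<alpha> \<gamma> d"
    unfolding payoff_def
    by (rule discounted_martingale[OF \<tau> _ S, where ?f1.0 = "harm' b \<alpha> \<gamma>" and ?f2.0 = "harm'' b \<alpha> \<gamma>" and ?f3.0 = "harm''' b \<alpha> \<gamma>"])
      (use lohi r_pos harm_derivs harm'''_cont harm_ode[OF _ _ b(2)] in auto)
  obtain K where K: "\<And>x. x \<in> {lo..hi} \<Longrightarrow> \<bar>harm b \<alpha> \<gamma> x\<bar> \<le> K"
    using compact_imp_bounded[OF compact_continuous_image[OF harm_cont[OF lohi] compact_Icc]]
    unfolding bounded_iff real_norm_def by blast
  show "integrable M (\<lambda>\<omega>. exp (- r * \<tau> \<omega>) * harm b \<alpha> \<gamma> (X d (\<tau> \<omega>) \<omega>))"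
    by (rule payoff_integrable[OF d \<tau>(1) harm_measurable, where K = K])
      (use K S stopping_nonneg[OF \<tau>(1)] in auto)
qed

text \<open>The harmonic function \<open>u b x + u b (1 - x)\<close> blows up at both ends, so the ends are not reached.\<close>

lemma stays_interior:
  assumes d: "0 < d" "d < 1"
  shows "AE \<omega> in M. \<forall>t\<ge>0. 0 < X d t \<omega> \<and> X d t \<omega> < 1"
proof -
  have d01: "d \<in> {0..1}" using d by simp
  interpret ito_solution M F W "\<lambda>x. \<sigma> * x * (1 - x)" d "X d" by (rule ito[OF d01])
  define e where "e n = 1 / real (n + 2)" for n :: nat
  have e: "0 < e n" "e n \<le> 1 / 2" for n by (auto simp: e_def field_simps)
  have e0: "e \<longlonglongrightarrow> 0" unfolding e_def
    using LIMSEQ_ignore_initial_segment[OF lim_1_over_n, of 2] by simp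
  have "0 < min d (1 - d)" using d by simp
  from order_tendstoD(2)[OF e0 this] obtain n0 where n0: "\<And>n. n0 \<le> n \<Longrightarrow> e n < min d (1 - d)"
    unfolding eventually_sequentially by blast
  let ?v = "harm b 1 1"
  have AE_N: "AE \<omega> in M. \<forall>t. 0 \<le> t \<longrightarrow> t < real N \<longrightarrow> 0 < X d t \<omega> \<and> X d t \<omega> < 1" for N :: nat
  proof -
    let ?\<rho> = "\<lambda>n. exit_time (e n) (1 - e n) (real N)"
    define E where "E n = {\<omega>\<in>space M. ?\<rho> n \<omega> < real N}" for n
    have dn: "e n < d" "d < 1 - e n" if "n0 \<le> n" for n using n0[OF that] by auto
    have st: "nn_stopping_time M F (?\<rho> n)" if "n0 \<le> n" for n
      by (rule exit_time_stopping[OF _ dn[OF that]]) simp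
    have Em: "E n \<in> sets M" if "n0 \<le> n" for n
      unfolding E_def using stopping_measurable[OF st[OF that]] by measurable
    have PE: "prob (E n) \<le> ?v d * exp (r * real N) * 2 powr b * e n powr (b - 1)" if n: "n0 \<le> n" for n
    proof -
      note x = exit_time[OF _ _ dn[OF n], of _ "real N"]
      \<comment> \<open>A lower bound for the discounted harmonic function at an exit before
        \<open>N\<close>. Whichever end is hit, it contains the term \<open>u b (1 - e n)\<close>,
        where \<open>1 - e n\<close> is at least \<open>1 / 2\<close>. Dividing by \<open>K\<close>
        leaves \<open>e n powr (b - 1)\<close>, which tends to 0 because
        \<open>1 < b\<close>.\<close>
      define K where "K = exp (- r * real N) * ((1 / 2) powr b * e n powr (1 - b))"
      have K: "0 < K" using e[of n] by (simp add: K_def)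
      have e1: "1 - e n < 1" using e[of n] by simp
      have T: "?\<rho> n \<omega> \<le> real N" if "\<omega> \<in> space M" for \<omega> using x(2)[OF that] by simp
      have S: "X d t \<omega> \<in> {e n..1 - e n}" if "\<omega> \<in> space M" "0 \<le> t" "t \<le> ?\<rho> n \<omega>" for \<omega> t
        using x(4)[OF that(1) _ that(2,3)] by simp
      note hm = harm_martingale[OF d01 e(1)[of n] e1 st[OF n] T S, where \<alpha> = 1 and \<gamma> = 1]
      have "K * prob (E n) = expectation (\<lambda>\<omega>. K * indicator (E n) \<omega>)"
        using Em[OF n] by simp
      also have "\<dots> \<le> expectation (\<lambda>\<omega>. exp (- r * ?\<rho> n \<omega>) * ?v (X d (?\<rho> n \<omega>) \<omega>))"
      proof (rule integral_mono)
        show "integrable M (\<lambda>\<omega>. K * indicator (E n) \<omega>)"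
          using Em[OF n] by (intro integrable_mult_right integrable_real_indicator) (auto simp: emeasure_eq_measure)
        show "integrable M (\<lambda>\<omega>. exp (- r * ?\<rho> n \<omega>) * ?v (X d (?\<rho> n \<omega>) \<omega>))"
          by (rule hm(2))
        fix \<omega> assume \<omega>: "\<omega> \<in> space M"
        have X: "X d (?\<rho> n \<omega>) \<omega> \<in> {e n..1 - e n}" using x(4)[OF \<omega>, of "?\<rho> n \<omega>"] x(1)[OF \<omega>] by simp
        then have X': "0 < X d (?\<rho> n \<omega>) \<omega>" "X d (?\<rho> n \<omega>) \<omega> < 1" using e[of n] by auto
        have vpos: "0 \<le> ?v (X d (?\<rho> n \<omega>) \<omega>)"
          using u_pos[of "X d (?\<rho> n \<omega>) \<omega>" b] u_pos[of "1 - X d (?\<rho> n \<omega>) \<omega>" b] X' by (simp add: harm_def)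
        show "K * indicator (E n) \<omega> \<le> exp (- r * ?\<rho> n \<omega>) * ?v (X d (?\<rho> n \<omega>) \<omega>)"
        proof (cases "\<omega> \<in> E n")
          case True
          then have "X d (?\<rho> n \<omega>) \<omega> = e n \<or> X d (?\<rho> n \<omega>) \<omega> = 1 - e n"
            using x(5)[OF \<omega>] unfolding E_def by simp
          then have v: "?v (X d (?\<rho> n \<omega>) \<omega>) = u b (e n) + u b (1 - e n)" by (auto simp: harm_def)
          have "(1 / 2) powr b * e n powr (1 - b) \<le> (1 - e n) powr b * e n powr (1 - b)"
            using e[of n] b by (intro mult_right_mono powr_mono2) auto
          also have "\<dots> = u b (1 - e n)" by (simp add: u_def)
          also have "\<dots> \<le> ?v (X d (?\<rho> n \<omega>) \<omega>)" unfolding v using u_pos[of "e n" b] e[of n] by simp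
          finally have 1: "(1 / 2) powr b * e n powr (1 - b) \<le> ?v (X d (?\<rho> n \<omega>) \<omega>)" .
          have 2: "exp (- r * real N) \<le> exp (- r * ?\<rho> n \<omega>)"
            using x(2)[OF \<omega>] r_pos by (simp add: mult_left_mono)
          have "K \<le> exp (- r * ?\<rho> n \<omega>) * ?v (X d (?\<rho> n \<omega>) \<omega>)"
            unfolding K_def by (rule mult_mono[OF 2 1]) auto
          then show ?thesis using True by simp
        qed (use vpos in simp)
      qed
      also have "\<dots> = ?v d" unfolding payoff_def[symmetric] by (rule hm(1))
      finally have "prob (E n) \<le> ?v d / K" using K by (simp add: field_simps)
      also have "1 / K = exp (r * real N) * (2 powr b * e n powr (b - 1))"
      proof -
        have "(1 / 2) powr b * 2 powr b = (1::real)" by (simp add: powr_mult[symmetric])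
        moreover have "e n powr (1 - b) * e n powr (b - 1) = 1" using e[of n] by (simp add: powr_add[symmetric])
        moreover have "exp (- r * real N) * exp (r * real N) = 1" by (simp add: exp_add[symmetric])
        moreover have k: "K * (exp (r * real N) * (2 powr b * e n powr (b - 1))) =
          (exp (- r * real N) * exp (r * real N)) * (((1 / 2) powr b * 2 powr b) * (e n powr (1 - b) * e n powr (b - 1)))"
          unfolding K_def by (simp only: ac_simps)
        ultimately have "K * (exp (r * real N) * (2 powr b * e n powr (b - 1))) = 1"
          using k by simp
        then show ?thesis using K by (simp add: field_simps)
      qed
      then have "?v d / K = ?v d * exp (r * real N) * 2 powr b * e n powr (b - 1)"
        by (metis divide_real_def mult.assoc mult.left_neutral)
      finally show ?thesis .
    qed
    have "(\<lambda>n. e n powr (b - 1)) \<longlonglongrightarrow> 0 powr (b - 1)"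
      by (rule tendsto_powr'[OF e0 tendsto_const]) (use b e in \<open>auto intro!: always_eventually less_imp_le\<close>)
    then have "(\<lambda>n. ?v d * exp (r * real N) * 2 powr b * e n powr (b - 1)) \<longlonglongrightarrow> ?v d * exp (r * real N) * 2 powr b * 0"
      using b by (intro tendsto_intros) simp
    then have lim: "(\<lambda>n. ?v d * exp (r * real N) * 2 powr b * e n powr (b - 1)) \<longlonglongrightarrow> 0" by simp
    let ?Z = "\<Inter>n\<in>{n0..}. E n"
    have Zm: "?Z \<in> sets M" using Em by (intro sets.countable_INT') auto
    have "prob ?Z \<le> ?v d * exp (r * real N) * 2 powr b * e n powr (b - 1)" if "n0 \<le> n" for n
    proof -
      have "prob ?Z \<le> prob (E n)" using that by (intro finite_measure_mono Em) auto
      then show ?thesis using PE[OF that] by linarith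
    qed
    then have "prob ?Z \<le> 0"
      by (intro tendsto_lowerbound[OF lim]) (auto simp: eventually_sequentially)
    then have "prob ?Z = 0" using measure_nonneg[of M ?Z] by linarith
    then have "?Z \<in> null_sets M" using Zm by (simp add: null_sets_def emeasure_eq_measure)
    \<comment> \<open>A path found outside (0, 1) before \<open>N\<close> must have left every
      interval \<open>{e n<..<1 - e n}\<close> with \<open>n0 \<le> n\<close> before
      \<open>N\<close>.\<close>
    moreover have "{\<omega>\<in>space M. \<not> (\<forall>t. 0 \<le> t \<longrightarrow> t < real N \<longrightarrow> 0 < X d t \<omega> \<and> X d t \<omega> < 1)} \<subseteq> ?Z"
    proof (intro subsetI INT_I)
      fix \<omega> n assume a: "\<omega> \<in> {\<omega>\<in>space M. \<not> (\<forall>t. 0 \<le> t \<longrightarrow> t < real N \<longrightarrow> 0 < X d t \<omega> \<and> X d t \<omega> < 1)}" and n: "n \<in> {n0..}"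
      then obtain t where t: "0 \<le> t" "t < real N" "\<not> (0 < X d t \<omega> \<and> X d t \<omega> < 1)" and \<omega>: "\<omega> \<in> space M" by blast
      have n': "n0 \<le> n" using n by simp
      have "\<not> t \<le> ?\<rho> n \<omega>"
      proof
        assume "t \<le> ?\<rho> n \<omega>"
        then have "X d t \<omega> \<in> {e n..1 - e n}" using exit_time(4)[OF \<omega> _ dn[OF n'], of "real N" t] t by simp
        then show False using t(3) e[of n] by auto
      qed
      then show "\<omega> \<in> E n" using t \<omega> by (simp add: E_def)
    qed
    ultimately show ?thesis  by (rule AE_I')
  qed
  have "AE \<omega> in M. \<forall>N::nat. \<forall>t. 0 \<le> t \<longrightarrow> t < real N \<longrightarrow> 0 < X d t \<omega> \<and> X d t \<omega> < 1"
    unfolding AE_all_countable using AE_N by blast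
  then show ?thesis
  proof (rule AE_mp, intro AE_I2 impI allI)
    fix \<omega> and t :: real
    assume a: "\<forall>N::nat. \<forall>t. 0 \<le> t \<longrightarrow> t < real N \<longrightarrow> 0 < X d t \<omega> \<and> X d t \<omega> < 1" and t: "0 \<le> t"
    obtain N :: nat where "t < real N" using reals_Archimedean2 by blast
    then show "0 < X d t \<omega> \<and> X d t \<omega> < 1" using a t by blast
  qed
qed

text \<open>A uniqueness argument: near \<open>e\<close> the squared diffusion coefficient is at
  most a multiple of \<open>(x - e)\<^sup>2\<close>, so with an artificial discount rate this
  function is a supersolution. It vanishes at the start, hence its stopped discounted expectation is
  zero.\<close>

lemma stays_at_boundary:
  assumes e: "e = 0 \<or> e = 1" and \<tau>: "nn_stopping_time M F \<tau>"
  shows "AE \<omega> in M. X e (\<tau> \<omega>) \<omega> = e"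
proof -
  have e01: "e \<in> {0..1}" using e by auto
  interpret ito_solution M F W "\<lambda>x. \<sigma> * x * (1 - x)" e "X e" by (rule ito[OF e01])
  let ?\<rho> = "\<lambda>N::nat. exit_time (e - 1 / 2) (e + 1 / 2) (real N)"
  have de: "e - 1 / 2 < e" "e < e + 1 / 2" by auto
  have st: "nn_stopping_time M F (?\<rho> N)" for N by (rule exit_time_stopping[OF _ de]) simp
  note x = exit_time[OF _ of_nat_0_le_iff de]
  have min0: "AE \<omega> in M. X e (min (\<rho>' \<omega>) (?\<rho> N \<omega>)) \<omega> = e" if \<rho>': "nn_stopping_time M F \<rho>'" for \<rho>' N
  proof -
    let ?m = "\<lambda>\<omega>. min (\<rho>' \<omega>) (?\<rho> N \<omega>)"
    \<comment> \<open>Within distance \<open>1 / 2\<close> of \<open>e\<close>, the factor of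
      \<open>x * (1 - x)\<close> that does not vanish at \<open>e\<close> has modulus at most
      \<open>3 / 2\<close>, whence \<open>9 / 4\<close>. This rate is unrelated to
      \<open>r\<close>.\<close>
    let ?K = "\<sigma>\<^sup>2 * (9 / 4)"
    have m: "nn_stopping_time M F ?m" by (rule stopping_min[OF \<rho>' st])
    have mS: "X e t \<omega> \<in> {e - 1 / 2..e + 1 / 2}" if "\<omega> \<in> space M" "0 \<le> t" "t \<le> ?m \<omega>" for \<omega> t
      using x(4)[OF that(1,2), of N] that(3) by simp
    let ?Y = "\<lambda>\<omega>. exp (- ?K * ?m \<omega>) * (X e (?m \<omega>) \<omega> - e)\<^sup>2"
    have "expectation ?Y \<le> (e - e)\<^sup>2"
    proof (rule discounted_supermartingale[OF m _ _ mS, where T = "real N" and f = "\<lambda>x. (x - e)\<^sup>2"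
        and ?f1.0 = "\<lambda>x. 2 * (x - e)" and ?f2.0 = "\<lambda>_. 2" and ?f3.0 = "\<lambda>_. 0"])
      show "?m \<omega> \<le> real N" if "\<omega> \<in> space M" for \<omega> using x(2)[OF that, of N] by simp
      show "((\<lambda>x. (x - e)\<^sup>2) has_real_derivative 2 * (x - e)) (at x)" for x
        by (auto intro!: derivative_eq_intros)
      show "((\<lambda>x. 2 * (x - e)) has_real_derivative 2) (at x)" for x
        by (auto intro!: derivative_eq_intros)
      fix y assume y: "y \<in> {e - 1 / 2..e + 1 / 2}"
      have sq: "z\<^sup>2 \<le> 9 / 4" if "\<bar>z\<bar> \<le> 3 / 2" for z :: real
        using power_mono[OF that, of 2] by (simp add: power2_eq_square)
      have "y\<^sup>2 * (1 - y)\<^sup>2 \<le> 9 / 4 * (y - e)\<^sup>2"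
      proof (cases "e = 0")
        case True
        then have "(1 - y)\<^sup>2 \<le> 9 / 4" using y by (intro sq) auto
        then show ?thesis using True mult_left_mono[of "(1 - y)\<^sup>2" "9 / 4" "y\<^sup>2"] by (simp add: mult.commute)
      next
        case False
        then have e1: "e = 1" using e by simp
        then have "y\<^sup>2 \<le> 9 / 4" using y by (intro sq) auto
        then show ?thesis using e1 mult_right_mono[of "y\<^sup>2" "9 / 4" "(1 - y)\<^sup>2"] by (simp add: power2_commute)
      qed
      then have "\<sigma>\<^sup>2 * (y\<^sup>2 * (1 - y)\<^sup>2) \<le> \<sigma>\<^sup>2 * (9 / 4 * (y - e)\<^sup>2)" by (intro mult_left_mono) auto
      moreover have "(\<sigma> * y * (1 - y))\<^sup>2 = \<sigma>\<^sup>2 * (y\<^sup>2 * (1 - y)\<^sup>2)" by (simp only: power_mult_distrib mult.assoc)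
      ultimately show "(\<sigma> * y * (1 - y))\<^sup>2 / 2 * 2 \<le> ?K * (y - e)\<^sup>2" by (simp add: mult.assoc)
    qed auto
    then have le: "expectation ?Y \<le> 0" by simp
    have Ym: "?Y \<in> borel_measurable M"
      using stopping_measurable[OF m] X_stop_measurable[OF m] by measurable
    have iY: "integrable M ?Y"
    proof (rule integrable_const_bound[OF AE_I2 Ym])
      fix \<omega> assume \<omega>: "\<omega> \<in> space M"
      have "\<bar>X e (?m \<omega>) \<omega> - e\<bar> \<le> 1 / 2" using mS[OF \<omega> stopping_nonneg[OF m \<omega>] order.refl] unfolding atLeastAtMost_iff by linarith
      then have "(X e (?m \<omega>) \<omega> - e)\<^sup>2 \<le> 1" using power_mono[of "\<bar>X e (?m \<omega>) \<omega> - e\<bar>" "1/2" 2] by (simp add: power2_eq_square)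
      moreover have "exp (- ?K * ?m \<omega>) \<le> 1" using stopping_nonneg[OF m \<omega>] by simp
      ultimately have "?Y \<omega> \<le> 1 * 1" by (intro mult_mono) auto
      then show "norm (?Y \<omega>) \<le> 1" by simp
    qed
    have "expectation ?Y = 0" using le integral_nonneg_AE[of ?Y M] by (intro antisym) auto
    then have "AE \<omega> in M. ?Y \<omega> = 0" using integral_nonneg_eq_0_iff_AE[OF iY] by simp
    then show ?thesis by (rule AE_mp) (intro AE_I2, simp)
  qed
  \<comment> \<open>An exit before the cap would place the path at distance \<open>1 / 2\<close>
    from \<open>e\<close>, so almost surely no exit occurs and the localization can be
    removed.\<close>
  have \<rho>N: "AE \<omega> in M. ?\<rho> N \<omega> = real N" for N
  proof -
    have "AE \<omega> in M. X e (min (real N) (?\<rho> N \<omega>)) \<omega> = e" by (rule min0[OF stopping_const]) simp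
    then show ?thesis
    proof (rule AE_mp, intro AE_I2 impI)
      fix \<omega> assume \<omega>: "\<omega> \<in> space M" and "X e (min (real N) (?\<rho> N \<omega>)) \<omega> = e"
      then have "X e (?\<rho> N \<omega>) \<omega> = e" using x(2)[OF \<omega>, of N] by (simp add: min_def split: if_splits)
      then show "?\<rho> N \<omega> = real N" using x(2)[OF \<omega>, of N] x(5)[OF \<omega>, of N] by fastforce
    qed
  qed
  have "AE \<omega> in M. \<forall>N. ?\<rho> N \<omega> = real N \<and> X e (min (\<tau> \<omega>) (?\<rho> N \<omega>)) \<omega> = e"
    unfolding AE_all_countable using \<rho>N min0[OF \<tau>] by (auto intro: AE_conjI)
  then show ?thesis
  proof (rule AE_mp, intro AE_I2 impI)
    fix \<omega> assume a: "\<forall>N. ?\<rho> N \<omega> = real N \<and> X e (min (\<tau> \<omega>) (?\<rho> N \<omega>)) \<omega> = e"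
    obtain N :: nat where "\<tau> \<omega> < real N" using reals_Archimedean2 by blast
    then show "X e (\<tau> \<omega>) \<omega> = e" using a[rule_format, of N] by (simp add: min_def split: if_splits)
  qed
qed

text \<open>The equation by itself does not confine the process, whereas payoffs are controlled on
  the unit interval only.\<close>

lemma stays_in_unit:
  assumes d: "d \<in> {0..1}" and \<tau>: "nn_stopping_time M F \<tau>"
  shows "AE \<omega> in M. X d (\<tau> \<omega>) \<omega> \<in> {0..1}"
proof (cases "d = 0 \<or> d = 1")
  case True
  from stays_at_boundary[OF True \<tau>] show ?thesis by (rule AE_mp) (use d in \<open>auto intro!: AE_I2\<close>)
next
  case False
  then have "0 < d" "d < 1" using d by auto
  from stays_interior[OF this] show ?thesis
  proof (rule AE_mp, intro AE_I2 impI)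
    fix \<omega> assume \<omega>: "\<omega> \<in> space M" and "\<forall>t\<ge>0. 0 < X d t \<omega> \<and> X d t \<omega> < 1"
    then have "0 < X d (\<tau> \<omega>) \<omega> \<and> X d (\<tau> \<omega>) \<omega> < 1" using stopping_nonneg[OF \<tau> \<omega>] by blast
    then show "X d (\<tau> \<omega>) \<omega> \<in> {0..1}" by simp
  qed
qed

section \<open>Bounds on stopping values\<close>

lemma bounded_on_unit:
  assumes "continuous_on UNIV g"
  obtains K :: real where "0 \<le> K" "\<And>x. x \<in> {0..1::real} \<Longrightarrow> \<bar>g x :: real\<bar> \<le> K"
proof -
  obtain K where K: "\<And>x. x \<in> {0..1} \<Longrightarrow> \<bar>g x\<bar> \<le> K"
    using compact_imp_bounded[OF compact_continuous_image[OF continuous_on_subset[OF assms subset_UNIV] compact_Icc]]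
    unfolding bounded_iff real_norm_def by blast
  moreover have "\<bar>g 0\<bar> \<le> K" by (rule K) simp
  then have "0 \<le> K" by linarith
  ultimately show ?thesis by (intro that[of K])
qed

text \<open>The value is a supremum of reals, which exceeds its members only once they are known to
  be bounded.\<close>

lemma payoff_bdd_above:
  assumes d: "d \<in> {0..1}" and g: "continuous_on UNIV g"
  shows "bdd_above (payoff d g ` {\<tau>. nn_stopping_time M F \<tau>})"
proof -
  obtain K where K: "0 \<le> K" "\<And>x. x \<in> {0..1} \<Longrightarrow> \<bar>g x\<bar> \<le> K" using bounded_on_unit[OF g] by blast
  have gm: "g \<in> borel_measurable borel" using g by (rule borel_measurable_continuous_onI)
  have "payoff d g \<tau> \<le> K" if \<tau>: "nn_stopping_time M F \<tau>" for \<tau>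
  proof -
    have AK: "AE \<omega> in M. \<bar>g (X d (\<tau> \<omega>) \<omega>)\<bar> \<le> K"
      using stays_in_unit[OF d \<tau>] by (rule AE_mp) (use K in \<open>auto intro!: AE_I2\<close>)
    have "payoff d g \<tau> \<le> expectation (\<lambda>_. K)"
      unfolding payoff_def
    proof (rule integral_mono_AE[OF payoff_integrable[OF d \<tau> gm AK]])
      show "AE \<omega> in M. exp (- r * \<tau> \<omega>) * g (X d (\<tau> \<omega>) \<omega>) \<le> K"
        using AK
      proof (rule AE_mp, intro AE_I2 impI)
        fix \<omega> assume "\<omega> \<in> space M" "\<bar>g (X d (\<tau> \<omega>) \<omega>)\<bar> \<le> K"
        then have "exp (- r * \<tau> \<omega>) * g (X d (\<tau> \<omega>) \<omega>) \<le> 1 * K"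
          using discount_bounds[OF \<tau>, of \<omega>] K by (intro order_trans[OF mult_left_mono[of _ K] mult_right_mono]) auto
        then show "exp (- r * \<tau> \<omega>) * g (X d (\<tau> \<omega>) \<omega>) \<le> K" by simp
      qed
    qed simp
    then show ?thesis by (simp add: prob_space)
  qed
  then show ?thesis by (auto intro!: bdd_aboveI2)
qed

lemma stop_value_payoff: "stop_value M F X r g d = (SUP \<tau>\<in>{\<tau>. nn_stopping_time M F \<tau>}. payoff d g \<tau>)"
  by (simp add: stop_value_def payoff_def)

lemma stop_value_ge_payoff:
  assumes "d \<in> {0..1}" "continuous_on UNIV g" "nn_stopping_time M F \<tau>"
  shows "payoff d g \<tau> \<le> stop_value M F X r g d"
  unfolding stop_value_payoff using payoff_bdd_above[OF assms(1,2)] assms(3) by (intro cSUP_upper) auto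

lemma stop_value_leI:
  assumes "\<And>\<tau>. nn_stopping_time M F \<tau> \<Longrightarrow> payoff d g \<tau> \<le> v"
  shows "stop_value M F X r g d \<le> v"
  unfolding stop_value_payoff using assms stopping_const[of 0] by (intro cSUP_least) auto

lemma stop_value_ge:
  assumes d: "d \<in> {0..1}" and g: "continuous_on UNIV g"
  shows "g d \<le> stop_value M F X r g d"
proof -
  interpret ito_solution M F W "\<lambda>x. \<sigma> * x * (1 - x)" d "X d" by (rule ito[OF d])
  have "payoff d g (\<lambda>_. 0) = expectation (\<lambda>_. g d)"
    unfolding payoff_def by (rule Bochner_Integration.integral_cong) (auto simp: X_0)
  then have "payoff d g (\<lambda>_. 0) = g d" by (simp add: prob_space)
  then show ?thesis using stop_value_ge_payoff[OF d g stopping_const[of 0]] by simp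
qed

text \<open>The belief is frozen at an end, so waiting only discounts a nonnegative reward.\<close>

lemma stop_value_boundary:
  assumes e: "e = 0 \<or> e = 1" and g: "continuous_on UNIV g" "0 \<le> g e"
  shows "stop_value M F X r g e = g e"
proof (rule antisym)
  have e01: "e \<in> {0..1}" using e by auto
  have gm: "g \<in> borel_measurable borel" using g(1) by (rule borel_measurable_continuous_onI)
  show "g e \<le> stop_value M F X r g e" by (rule stop_value_ge[OF e01 g(1)])
  show "stop_value M F X r g e \<le> g e"
  proof (rule stop_value_leI)
    fix \<tau> assume \<tau>: "nn_stopping_time M F \<tau>"
    have AK: "AE \<omega> in M. \<bar>g (X e (\<tau> \<omega>) \<omega>)\<bar> \<le> g e"
      using stays_at_boundary[OF e \<tau>] by (rule AE_mp) (use g in \<open>auto intro!: AE_I2\<close>)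
    have "payoff e g \<tau> \<le> expectation (\<lambda>_. g e)"
      unfolding payoff_def
    proof (rule integral_mono_AE[OF payoff_integrable[OF e01 \<tau> gm AK]])
      show "AE \<omega> in M. exp (- r * \<tau> \<omega>) * g (X e (\<tau> \<omega>) \<omega>) \<le> g e"
        using stays_at_boundary[OF e \<tau>]
      proof (rule AE_mp, intro AE_I2 impI)
        fix \<omega> assume "\<omega> \<in> space M" "X e (\<tau> \<omega>) \<omega> = e"
        then show "exp (- r * \<tau> \<omega>) * g (X e (\<tau> \<omega>) \<omega>) \<le> g e"
          using discount_bounds[OF \<tau>, of \<omega>] g(2) by (simp add: mult_left_le_one_le)
      qed
    qed simp
    then show "payoff e g \<tau> \<le> g e" by (simp add: prob_space)
  qed
qed

text \<open>Up to the exit from \<open>{e n<..<1 - e n}\<close>, capped at \<open>n\<close>, the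
  majorant is a martingale. The limit is taken in the payoff of \<open>g\<close>, which is bounded
  on the unit interval, and not in the majorant, which may be unbounded there.\<close>

lemma stop_value_le_harm:
  assumes d: "0 < d" "d < 1" and g: "continuous_on UNIV g"
    and le: "\<And>x. 0 < x \<Longrightarrow> x < 1 \<Longrightarrow> g x \<le> harm b \<alpha> \<gamma> x"
  shows "stop_value M F X r g d \<le> harm b \<alpha> \<gamma> d"
proof (rule stop_value_leI)
  fix \<tau> assume \<tau>: "nn_stopping_time M F \<tau>"
  have d01: "d \<in> {0..1}" using d by simp
  interpret ito_solution M F W "\<lambda>x. \<sigma> * x * (1 - x)" d "X d" by (rule ito[OF d01])
  obtain K where K: "0 \<le> K" "\<And>x. x \<in> {0..1} \<Longrightarrow> \<bar>g x\<bar> \<le> K" using bounded_on_unit[OF g] by blast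
  have gm: "g \<in> borel_measurable borel" using g by (rule borel_measurable_continuous_onI)
  define m where "m = min d (1 - d)"
  have m: "0 < m" "m \<le> d" "m \<le> 1 - d" using d by (auto simp: m_def)
  define e where "e n = m / real (n + 2)" for n :: nat
  have e: "0 < e n" "e n < m" for n
    using m divide_strict_left_mono[of 1 "real (n + 2)" m] by (simp_all add: e_def)
  have e0: "e \<longlonglongrightarrow> 0" unfolding e_def
    using tendsto_mult[OF tendsto_const LIMSEQ_ignore_initial_segment[OF lim_1_over_n, of 2], of m] by simp
  have dn: "e n < d" "d < 1 - e n" for n using e[of n] m by auto
  let ?\<rho> = "\<lambda>n. exit_time (e n) (1 - e n) (real n)"
  let ?t = "\<lambda>n \<omega>. min (\<tau> \<omega>) (?\<rho> n \<omega>)"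
  have st: "nn_stopping_time M F (?t n)" for n
    by (rule stopping_min[OF \<tau> exit_time_stopping[OF _ dn]]) simp
  have S: "X d t \<omega> \<in> {e n..1 - e n}" if "\<omega> \<in> space M" "0 \<le> t" "t \<le> ?t n \<omega>" for n \<omega> t
    using exit_time(4)[OF that(1) of_nat_0_le_iff[of n] dn(1)[of n] dn(2)[of n] that(2)] that(3) by simp
  have S': "0 < X d (?t n \<omega>) \<omega>" "X d (?t n \<omega>) \<omega> < 1" if "\<omega> \<in> space M" for n \<omega>
    using S[OF that stopping_nonneg[OF st that] order.refl, of n] e[of n] by auto
  have n_le: "payoff d g (?t n) \<le> harm b \<alpha> \<gamma> d" for n
  proof -
    have hi: "1 - e n < 1" using e[of n] by simp
    have T: "?t n \<omega> \<le> real n" if "\<omega> \<in> space M" for \<omega> using exit_time(2)[OF that of_nat_0_le_iff[of n] dn(1)[of n] dn(2)[of n]] by simp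
    note hm = harm_martingale[OF d01 e(1)[of n] hi st T S, where \<alpha> = \<alpha> and \<gamma> = \<gamma>]
    have AK: "AE \<omega> in M. \<bar>g (X d (?t n \<omega>) \<omega>)\<bar> \<le> K"
      using K S' by (intro AE_I2) (simp add: less_imp_le)
    have "payoff d g (?t n) \<le> payoff d (harm b \<alpha> \<gamma>) (?t n)"
      unfolding payoff_def
      by (rule integral_mono[OF payoff_integrable[OF d01 st gm AK] hm(2)]) (use le S' in auto)
    then show ?thesis using hm(1) by simp
  qed
  have "(\<lambda>n. payoff d g (?t n)) \<longlonglongrightarrow> payoff d g \<tau>"
    unfolding payoff_def
  proof (rule integral_dominated_convergence[where w = "\<lambda>_. K"])
    show "(\<lambda>\<omega>. exp (- r * \<tau> \<omega>) * g (X d (\<tau> \<omega>) \<omega>)) \<in> borel_measurable M"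
      by (rule payoff_measurable[OF d01 \<tau> gm])
    show "(\<lambda>\<omega>. exp (- r * ?t n \<omega>) * g (X d (?t n \<omega>) \<omega>)) \<in> borel_measurable M" for n
      by (rule payoff_measurable[OF d01 st gm])
    show "AE \<omega> in M. norm (exp (- r * ?t n \<omega>) * g (X d (?t n \<omega>) \<omega>)) \<le> K" for n
    proof (rule AE_I2)
      fix \<omega> assume \<omega>: "\<omega> \<in> space M"
      have "exp (- r * ?t n \<omega>) * \<bar>g (X d (?t n \<omega>) \<omega>)\<bar> \<le> 1 * K"
        using discount_bounds[OF st \<omega>, of n] K S'[OF \<omega>, of n] by (intro mult_mono) auto
      then show "norm (exp (- r * ?t n \<omega>) * g (X d (?t n \<omega>) \<omega>)) \<le> K" by (simp add: abs_mult)
    qed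
    show "AE \<omega> in M. (\<lambda>n. exp (- r * ?t n \<omega>) * g (X d (?t n \<omega>) \<omega>)) \<longlonglongrightarrow> exp (- r * \<tau> \<omega>) * g (X d (\<tau> \<omega>) \<omega>)"
      using stays_interior[OF d]
    proof (rule AE_mp, intro AE_I2 impI)
      fix \<omega> assume \<omega>: "\<omega> \<in> space M" and int: "\<forall>t\<ge>0. 0 < X d t \<omega> \<and> X d t \<omega> < 1"
      have ne: "{0..\<tau> \<omega>} \<noteq> {}" using stopping_nonneg[OF \<tau> \<omega>] by simp
      have c: "continuous_on {0..\<tau> \<omega>} (\<lambda>t. X d t \<omega>)" by (rule continuous_on_subset[OF X_cont[OF \<omega>]]) auto
      obtain s1 where s1: "s1 \<in> {0..\<tau> \<omega>}" "\<And>s. s \<in> {0..\<tau> \<omega>} \<Longrightarrow> X d s1 \<omega> \<le> X d s \<omega>"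
        using continuous_attains_inf[OF compact_Icc ne c] by blast
      obtain s2 where s2: "s2 \<in> {0..\<tau> \<omega>}" "\<And>s. s \<in> {0..\<tau> \<omega>} \<Longrightarrow> X d s \<omega> \<le> X d s2 \<omega>"
        using continuous_attains_sup[OF compact_Icc ne c] by blast
      have "0 < min (X d s1 \<omega>) (1 - X d s2 \<omega>)" using int s1(1) s2(1) by auto
      from order_tendstoD(2)[OF e0 this]
      have ev1: "\<forall>\<^sub>F n in sequentially. e n < min (X d s1 \<omega>) (1 - X d s2 \<omega>)" .
      have ev2: "\<forall>\<^sub>F n in sequentially. \<tau> \<omega> < real n"
        using filterlim_at_top_dense[THEN iffD1, OF filterlim_real_sequentially] by blast
      \<comment> \<open>Up to \<open>\<tau>\<close> the path has a minimum and a maximum inside (0,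
        1); once \<open>e n\<close> clears both and \<open>n\<close> exceeds \<open>\<tau>\<close>,
        the localized time equals \<open>\<tau>\<close>.\<close>
      have "\<forall>\<^sub>F n in sequentially. exp (- r * ?t n \<omega>) * g (X d (?t n \<omega>) \<omega>) = exp (- r * \<tau> \<omega>) * g (X d (\<tau> \<omega>) \<omega>)"
        using ev1 ev2
      proof eventually_elim
        case (elim n)
        note x = exit_time[OF \<omega> of_nat_0_le_iff[of n] dn(1)[of n] dn(2)[of n]]
        have "\<tau> \<omega> \<le> ?\<rho> n \<omega>"
        proof (rule ccontr)
          assume "\<not> \<tau> \<omega> \<le> ?\<rho> n \<omega>"
          then have lt: "?\<rho> n \<omega> < \<tau> \<omega>" by simp
          then have "X d (?\<rho> n \<omega>) \<omega> = e n \<or> X d (?\<rho> n \<omega>) \<omega> = 1 - e n" using x(5) elim by simp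
          moreover have "?\<rho> n \<omega> \<in> {0..\<tau> \<omega>}" using x(1) lt by simp
          ultimately show False using s1(2)[of "?\<rho> n \<omega>"] s2(2)[of "?\<rho> n \<omega>"] elim by auto
        qed
        then have "?t n \<omega> = \<tau> \<omega>" by simp
        then show ?case by simp
      qed
      then show "(\<lambda>n. exp (- r * ?t n \<omega>) * g (X d (?t n \<omega>) \<omega>)) \<longlonglongrightarrow> exp (- r * \<tau> \<omega>) * g (X d (\<tau> \<omega>) \<omega>)"
        by (rule tendsto_eventually)
    qed
  qed simp
  then show "payoff d g \<tau> \<le> harm b \<alpha> \<gamma> d"
    by (rule tendsto_upperbound) (use n_le in auto)
qed

text \<open>The strategy is to stop on leaving \<open>{lo<..<hi}\<close>, where reward and
  combination agree. Capping the time at \<open>n\<close> makes it bounded and costs at most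
  \<open>exp (- r * real n) * K\<close>.\<close>

lemma harm_le_stop_value:
  assumes lohi: "0 < lo" "lo < d" "d < hi" "hi < 1" and g: "continuous_on UNIV g"
    and eq: "g lo = harm b \<alpha> \<gamma> lo" "g hi = harm b \<alpha> \<gamma> hi"
  shows "harm b \<alpha> \<gamma> d \<le> stop_value M F X r g d"
proof -
  have d01: "d \<in> {0..1}" using lohi by simp
  interpret ito_solution M F W "\<lambda>x. \<sigma> * x * (1 - x)" d "X d" by (rule ito[OF d01])
  have gm: "g \<in> borel_measurable borel" using g by (rule borel_measurable_continuous_onI)
  have "continuous_on {lo..hi} (\<lambda>x. harm b \<alpha> \<gamma> x - g x)"
    by (intro continuous_on_diff harm_cont lohi continuous_on_subset[OF g subset_UNIV])
  then obtain K where K: "\<And>x. x \<in> {lo..hi} \<Longrightarrow> \<bar>harm b \<alpha> \<gamma> x - g x\<bar> \<le> K"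
    using compact_imp_bounded[OF compact_continuous_image[OF _ compact_Icc], of lo hi "\<lambda>x. harm b \<alpha> \<gamma> x - g x"]
    unfolding bounded_iff real_norm_def by blast
  have K0: "0 \<le> K" using K[of d] lohi by auto
  obtain K' where K': "0 \<le> K'" "\<And>x. x \<in> {0..1} \<Longrightarrow> \<bar>g x\<bar> \<le> K'" using bounded_on_unit[OF g] by blast
  let ?\<rho> = "\<lambda>n::nat. exit_time lo hi (real n)"
  note x = exit_time[OF _ of_nat_0_le_iff lohi(2,3)]
  have st: "nn_stopping_time M F (?\<rho> n)" for n by (rule exit_time_stopping[OF _ lohi(2,3)]) simp
  have bound: "harm b \<alpha> \<gamma> d - exp (- r * real n) * K \<le> stop_value M F X r g d" for n
  proof -
    have T: "?\<rho> n \<omega> \<le> real n" if "\<omega> \<in> space M" for \<omega> using x(2)[OF that] .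
    have S: "X d t \<omega> \<in> {lo..hi}" if "\<omega> \<in> space M" "0 \<le> t" "t \<le> ?\<rho> n \<omega>" for \<omega> t using x(4)[OF that] .
    note hm = harm_martingale[OF d01 lohi(1,4) st T S, where \<alpha> = \<alpha> and \<gamma> = \<gamma>]
    have X: "X d (?\<rho> n \<omega>) \<omega> \<in> {lo..hi}" if "\<omega> \<in> space M" for \<omega>
      using x(4)[OF that x(1)[OF that] order.refl] .
    have AK: "AE \<omega> in M. \<bar>g (X d (?\<rho> n \<omega>) \<omega>)\<bar> \<le> K'"
      using K' X lohi by (intro AE_I2) force
    note ig = payoff_integrable[OF d01 st gm AK]
    have "harm b \<alpha> \<gamma> d - payoff d g (?\<rho> n) = expectation (\<lambda>\<omega>. exp (- r * ?\<rho> n \<omega>) * harm b \<alpha> \<gamma> (X d (?\<rho> n \<omega>) \<omega>) - exp (- r * ?\<rho> n \<omega>) * g (X d (?\<rho> n \<omega>) \<omega>))"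
      using hm ig unfolding payoff_def by simp
    also have "\<dots> \<le> expectation (\<lambda>_. exp (- r * real n) * K)"
    proof (rule integral_mono)
      show "integrable M (\<lambda>\<omega>. exp (- r * ?\<rho> n \<omega>) * harm b \<alpha> \<gamma> (X d (?\<rho> n \<omega>) \<omega>) - exp (- r * ?\<rho> n \<omega>) * g (X d (?\<rho> n \<omega>) \<omega>))"
        using hm(2) ig by simp
      fix \<omega> assume \<omega>: "\<omega> \<in> space M"
      show "exp (- r * ?\<rho> n \<omega>) * harm b \<alpha> \<gamma> (X d (?\<rho> n \<omega>) \<omega>) - exp (- r * ?\<rho> n \<omega>) * g (X d (?\<rho> n \<omega>) \<omega>) \<le> exp (- r * real n) * K"
      proof (cases "?\<rho> n \<omega> < real n")
        case True
        then have "X d (?\<rho> n \<omega>) \<omega> = lo \<or> X d (?\<rho> n \<omega>) \<omega> = hi" by (rule x(5)[OF \<omega>])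
        then have "harm b \<alpha> \<gamma> (X d (?\<rho> n \<omega>) \<omega>) = g (X d (?\<rho> n \<omega>) \<omega>)" using eq by auto
        then show ?thesis using K0 by simp
      next
        case False
        then have "?\<rho> n \<omega> = real n" using x(2)[OF \<omega>, of n] by simp
        then show ?thesis using K[OF X[OF \<omega>]] by (simp add: right_diff_distrib[symmetric])
      qed
    qed simp
    also have "\<dots> = exp (- r * real n) * K" by (simp add: prob_space)
    finally show ?thesis using stop_value_ge_payoff[OF d01 g st, of n] by linarith
  qed
  have "(\<lambda>n. exp (- r) ^ n) \<longlonglongrightarrow> 0" using r_pos by (intro LIMSEQ_power_zero) simp
  then have "(\<lambda>n. exp (- r * real n)) \<longlonglongrightarrow> 0" by (simp add: exp_of_nat_mult[symmetric] mult.commute)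
  then have "(\<lambda>n. harm b \<alpha> \<gamma> d - exp (- r * real n) * K) \<longlonglongrightarrow> harm b \<alpha> \<gamma> d - 0 * K"
    by (intro tendsto_intros)
  then have "harm b \<alpha> \<gamma> d - 0 * K \<le> stop_value M F X r g d"
    by (rule tendsto_upperbound) (use bound in auto)
  then show ?thesis by simp
qed

end

section \<open>Majorants spanned by the harmonic functions\<close>

lemma reflect_harm: "harm b \<alpha> \<gamma> (1 - x) = harm b \<gamma> \<alpha> x"
  by (simp add: harm_def)

lemma u_mono:
  assumes "1 \<le> b" "0 < x" "x \<le> y" "y < 1"
  shows "u b x \<le> u b y"
  unfolding u_def using assms by (intro mult_mono powr_mono2 powr_mono2') auto

text \<open>An affine function that is nonnegative at two points is nonnegative between them, read
  in the original coordinate. The signs of the coefficient differences decide: both cannot be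
  negative, and with opposite signs the difference is monotone, so one of the two ends
  suffices.\<close>

lemma harm_le_between:
  assumes b: "1 \<le> b" and x: "0 < x1" "x1 \<le> x" "x \<le> x2" "x2 < 1"
    and le: "harm b \<alpha> \<gamma> x1 \<le> harm b \<alpha>' \<gamma>' x1" "harm b \<alpha> \<gamma> x2 \<le> harm b \<alpha>' \<gamma>' x2"
  shows "harm b \<alpha> \<gamma> x \<le> harm b \<alpha>' \<gamma>' x"
proof -
  define A where "A = \<alpha>' - \<alpha>"
  define C where "C = \<gamma>' - \<gamma>"
  have le': "0 \<le> A * u b (1 - x1) + C * u b x1" "0 \<le> A * u b (1 - x2) + C * u b x2"
    using le by (auto simp: harm_def A_def C_def algebra_simps)
  have pos: "0 < u b y" "0 < u b (1 - y)" if "0 < y" "y < 1" for y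
    using u_pos[of y b] u_pos[of "1 - y" b] that by auto
  have m: "u b x1 \<le> u b x" "u b x \<le> u b x2" "u b (1 - x) \<le> u b (1 - x1)" "u b (1 - x2) \<le> u b (1 - x)"
    using x by (auto intro!: u_mono[OF b])
  have "0 \<le> A * u b (1 - x) + C * u b x"
  proof (cases "A \<ge> 0")
    case A: True
    show ?thesis
    proof (cases "C \<ge> 0")
      case True then show ?thesis using A pos[of x] x by simp
    next
      case False
      then have "A * u b (1 - x2) \<le> A * u b (1 - x)" "C * u b x2 \<le> C * u b x"
        using A m by (auto intro: mult_left_mono mult_left_mono_neg)
      then show ?thesis using le' by linarith
    qed
  next
    case A: False
    have "C \<ge> 0"
    proof (rule ccontr)
      assume "\<not> C \<ge> 0"
      then have "A * u b (1 - x1) + C * u b x1 < 0"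
        using A pos[of x1] x by (intro add_neg_neg mult_neg_pos) auto
      then show False using le' by simp
    qed
    then have "A * u b (1 - x1) \<le> A * u b (1 - x)" "C * u b x1 \<le> C * u b x"
      using A m by (auto intro: mult_left_mono mult_left_mono_neg)
    then show ?thesis using le' by linarith
  qed
  then show ?thesis by (simp add: harm_def A_def C_def algebra_simps)
qed

text \<open>The Wronskian of the two basic solutions does not vanish: they and the derivatives
  \<open>u'\<close> at \<open>x\<close> and at \<open>1 - x\<close> are all positive.\<close>

lemma harm_determined:
  assumes b: "1 \<le> b" and x: "0 < x" "x < 1"
    and eq: "harm b \<alpha> \<gamma> x = harm b \<alpha>' \<gamma>' x" "harm' b \<alpha> \<gamma> x = harm' b \<alpha>' \<gamma>' x"
  shows "\<alpha> = \<alpha>'" "\<gamma> = \<gamma>'"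
proof -
  define A where "A = \<alpha>' - \<alpha>"
  define C where "C = \<gamma>' - \<gamma>"
  have pos: "0 < u b x" "0 < u b (1 - x)" using u_pos[of x b] u_pos[of "1 - x" b] x by auto
  have pos': "0 < u' b x" "0 < u' b (1 - x)" using pos b x by (auto simp: u'_def)
  have 1: "A * u b (1 - x) + C * u b x = 0" and 2: "- A * u' b (1 - x) + C * u' b x = 0"
    using eq by (auto simp: harm_def harm'_def A_def C_def algebra_simps)
  have "A * (u b (1 - x) * u' b x + u' b (1 - x) * u b x)
     = u' b x * (A * u b (1 - x) + C * u b x) - u b x * (- A * u' b (1 - x) + C * u' b x)"
    by (simp add: algebra_simps)
  also have "\<dots> = 0" unfolding 1 2 by simp
  finally have "A * (u b (1 - x) * u' b x + u' b (1 - x) * u b x) = 0" .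
  moreover have "0 < u b (1 - x) * u' b x + u' b (1 - x) * u b x" using pos pos' by (simp add: add_pos_pos)
  ultimately have A: "A = 0" by simp
  with 1 pos have "C = 0" by simp
  with A show "\<alpha> = \<alpha>'" "\<gamma> = \<gamma>'" by (auto simp: A_def C_def)
qed

text \<open>The tangent at \<open>y\<close> to \<open>1 - x\<close>; in logarithmic odds this is \<open>1 + t \<le> exp t\<close> with weights
  chosen to cancel the linear terms.\<close>

definition tan_hi :: "real \<Rightarrow> real \<Rightarrow> real" where
  "tan_hi b y = b / (2 * b - 1) * (y / (1 - y)) powr (b - 1)"

definition tan_lo :: "real \<Rightarrow> real \<Rightarrow> real" where
  "tan_lo b y = (b - 1) / (2 * b - 1) * (y / (1 - y)) powr (- b)"

lemma tangent_ge:
  assumes b: "1 < b" and x: "0 < x" "x < 1" and y: "0 < y" "y < 1"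
  shows "1 - x \<le> harm b (tan_hi b y) (tan_lo b y) x"
    and "1 - y = harm b (tan_hi b y) (tan_lo b y) y"
proof -
  define \<kappa> where "\<kappa> = b / (2 * b - 1)"
  define \<mu> where "\<mu> = (b - 1) / (2 * b - 1)"
  have wts: "0 < \<kappa>" "0 < \<mu>" "\<kappa> + \<mu> = 1" "\<kappa> * (1 - b) + \<mu> * b = 0"
    using b by (auto simp: \<kappa>_def \<mu>_def divide_simps) (simp_all add: algebra_simps)
  \<comment> \<open>Factoring out \<open>1 - x\<close> leaves powers of the odds
    \<open>x / (1 - x)\<close>, which become exponentials in the logarithmic odds.\<close>
  have u: "u b x = (1 - x) * (x / (1 - x)) powr b" "u b (1 - x) = (1 - x) * (x / (1 - x)) powr (1 - b)"
    if "0 < x" "x < 1" for x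
    using that by (auto simp: u_def powr_divide powr_diff powr_minus field_simps)
  have eq: "harm b (tan_hi b y) (tan_lo b y) x = (1 - x) *
     (\<kappa> * exp ((1 - b) * (ln (x / (1 - x)) - ln (y / (1 - y)))) + \<mu> * exp (b * (ln (x / (1 - x)) - ln (y / (1 - y)))))"
    if x: "0 < x" "x < 1" for x
  proof -
    have e: "(y / (1 - y)) powr (b - 1) * (x / (1 - x)) powr (1 - b) = exp ((1 - b) * (ln (x / (1 - x)) - ln (y / (1 - y))))"
      "(y / (1 - y)) powr (- b) * (x / (1 - x)) powr b = exp (b * (ln (x / (1 - x)) - ln (y / (1 - y))))"
      using x y by (simp_all add: powr_def exp_add[symmetric] algebra_simps)
    have "harm b (tan_hi b y) (tan_lo b y) x = (1 - x) * (\<kappa> * ((y / (1 - y)) powr (b - 1) * (x / (1 - x)) powr (1 - b))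
       + \<mu> * ((y / (1 - y)) powr (- b) * (x / (1 - x)) powr b))"
      unfolding harm_def u[OF x] tan_hi_def tan_lo_def \<kappa>_def[symmetric] \<mu>_def[symmetric] by (simp add: algebra_simps)
    then show ?thesis unfolding e .
  qed
  have ge: "1 \<le> \<kappa> * exp ((1 - b) * t) + \<mu> * exp (b * t)" for t
  proof -
    have "1 = (\<kappa> + \<mu>) + (\<kappa> * (1 - b) + \<mu> * b) * t" using wts by simp
    also have "\<dots> = \<kappa> * (1 + (1 - b) * t) + \<mu> * (1 + b * t)" by (simp add: algebra_simps)
    also have "\<dots> \<le> \<kappa> * exp ((1 - b) * t) + \<mu> * exp (b * t)"
      using wts by (intro add_mono mult_left_mono exp_ge_add_one_self) auto
    finally show ?thesis .
  qed
  show "1 - x \<le> harm b (tan_hi b y) (tan_lo b y) x"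
    unfolding eq[OF x] using mult_left_mono[OF ge, of "1 - x"] x by simp
  show "1 - y = harm b (tan_hi b y) (tan_lo b y) y"
    unfolding eq[OF y] using wts by simp
qed

lemma Rt_reflect: "Rt R1 R0 a (1 - x) = Rt R0 R1 a x"
  by (simp add: Rt_def)

text \<open>Concavity of a linear reward relative to the harmonic functions.\<close>

lemma Rt_tangent:
  assumes b: "1 < b" and y: "0 < y" "y < 1" and nn: "0 \<le> R0 a" "0 \<le> R1 a"
  defines "\<alpha> \<equiv> R1 a * tan_hi b y + R0 a * tan_lo b (1 - y)"
    and "\<gamma> \<equiv> R1 a * tan_lo b y + R0 a * tan_hi b (1 - y)"
  shows "\<And>x. 0 < x \<Longrightarrow> x < 1 \<Longrightarrow> Rt R0 R1 a x \<le> harm b \<alpha> \<gamma> x"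
    and "Rt R0 R1 a y = harm b \<alpha> \<gamma> y"
proof -
  have eq: "harm b \<alpha> \<gamma> x = R1 a * harm b (tan_hi b y) (tan_lo b y) x + R0 a * harm b (tan_hi b (1 - y)) (tan_lo b (1 - y)) (1 - x)" for x
    by (simp add: harm_def \<alpha>_def \<gamma>_def algebra_simps)
  show "Rt R0 R1 a x \<le> harm b \<alpha> \<gamma> x" if x: "0 < x" "x < 1" for x
  proof -
    have "R1 a * (1 - x) + R0 a * (1 - (1 - x)) \<le> harm b \<alpha> \<gamma> x"
      unfolding eq using x y nn by (intro add_mono mult_left_mono tangent_ge b) auto
    then show ?thesis by (simp add: Rt_def algebra_simps)
  qed
  have "harm b \<alpha> \<gamma> y = R1 a * (1 - y) + R0 a * (1 - (1 - y))"
    unfolding eq using tangent_ge(2)[OF b y y] tangent_ge(2)[OF b, of "1 - y" "1 - y"] y by simp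
  then show "Rt R0 R1 a y = harm b \<alpha> \<gamma> y" by (simp add: Rt_def algebra_simps)
qed

section \<open>Minimal majorants and their contact points\<close>

definition majorant :: "(real \<Rightarrow> real) \<Rightarrow> (real \<Rightarrow> real) \<Rightarrow> real \<Rightarrow> real \<Rightarrow> bool" where
  "majorant P N \<alpha> \<gamma> \<longleftrightarrow> (\<forall>x\<in>{0..1}. N x \<le> \<alpha> * P (1 - x) + \<gamma> * P x)"

text \<open>Without contact on \<open>{0..x0}\<close> the gap stays positive slightly beyond
  \<open>x0\<close>. The combination can then be tilted about a point \<open>x3\<close> to the right
  of \<open>x0\<close>, going down on the left and up on the right, which lowers its value at
  \<open>x0\<close> and contradicts minimality.\<close>

lemma left_contact:
  fixes P N :: "real \<Rightarrow> real"
  assumes P: "continuous_on {0..1} P" "strict_mono_on {0..1} P" "P 0 = 0"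
    and N: "continuous_on {0..1} N"
    and x0: "0 < x0" "x0 < 1"
    and maj: "majorant P N \<alpha> \<gamma>"
    and least: "\<And>\<alpha>' \<gamma>'. majorant P N \<alpha>' \<gamma>' \<Longrightarrow> \<alpha> * P (1 - x0) + \<gamma> * P x0 \<le> \<alpha>' * P (1 - x0) + \<gamma>' * P x0"
  shows "\<exists>x\<in>{0..x0}. N x = \<alpha> * P (1 - x) + \<gamma> * P x"
proof (rule ccontr)
  assume no: "\<not> ?thesis"
  define \<phi> where "\<phi> x = \<alpha> * P (1 - x) + \<gamma> * P x - N x" for x
  have P': "continuous_on {0..1} (\<lambda>x. P (1 - x))"
    by (rule continuous_on_compose2[OF P(1)]) (auto intro!: continuous_intros)
  have \<phi>_cont: "continuous_on {0..1} \<phi>" unfolding \<phi>_def[abs_def] by (intro continuous_intros P P' N)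
  have \<phi>_pos: "0 < \<phi> x" if "x \<in> {0..x0}" for x
  proof -
    have "N x \<noteq> \<alpha> * P (1 - x) + \<gamma> * P x" using no that by blast
    moreover have "N x \<le> \<alpha> * P (1 - x) + \<gamma> * P x" using maj that x0 unfolding majorant_def by auto
    ultimately show ?thesis by (simp add: \<phi>_def)
  qed
  have "isCont \<phi> x0" using \<phi>_cont x0 by (intro continuous_on_interior) auto
  then have "\<forall>\<^sub>F x in at x0. 0 < \<phi> x" using order_tendstoD(1)[of \<phi> "\<phi> x0" "at x0" 0] \<phi>_pos[of x0] x0 by (simp add: isCont_def)
  then obtain e where e: "0 < e" "\<And>x. x \<noteq> x0 \<Longrightarrow> dist x x0 < e \<Longrightarrow> 0 < \<phi> x"
    unfolding eventually_at by auto
  \<comment> \<open>Close enough to \<open>x0\<close> for the gap to be positive on all of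
    \<open>{0..x3}\<close>, and strictly inside the unit interval.\<close>
  define x3 where "x3 = min (x0 + e / 2) ((x0 + 1) / 2)"
  have x3: "x0 < x3" "x3 < 1" "x3 \<le> x0 + e / 2" using e x0 by (auto simp: x3_def min_def)
  have \<phi>_pos': "0 < \<phi> x" if "x \<in> {0..x3}" for x
  proof (cases "x \<le> x0")
    case True then show ?thesis using \<phi>_pos that by simp
  next
    case False then show ?thesis using e(2)[of x] e(1) that x3 by (simp add: dist_real_def)
  qed
  have "continuous_on {0..x3} \<phi>" by (rule continuous_on_subset[OF \<phi>_cont]) (use x3 in auto)
  from continuous_attains_inf[OF compact_Icc _ this] obtain m where
    m: "m \<in> {0..x3}" "\<And>x. x \<in> {0..x3} \<Longrightarrow> \<phi> m \<le> \<phi> x" using x3 x0 by auto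
  have \<phi>m: "0 < \<phi> m" using \<phi>_pos' m(1) by blast
  have mono: "P x \<le> P y" if "0 \<le> x" "x \<le> y" "y \<le> 1" for x y
    using strict_mono_on_leD[OF P(2)] that by auto
  have Ppos: "0 < P x" if "0 < x" "x \<le> 1" for x
    using strict_mono_onD[OF P(2), of 0 x] that P(3) by simp
  \<comment> \<open>Tilting lowers the combination by at most \<open>\<eta> * (P 1 * P x3)\<close>,
    here set equal to the least gap on \<open>{0..x3}\<close>.\<close>
  define \<eta> where "\<eta> = \<phi> m / (P 1 * P x3)"
  have \<eta>: "0 < \<eta>" using \<phi>m Ppos x3 x0 by (simp add: \<eta>_def)
  have \<eta>': "\<eta> * (P 1 * P x3) = \<phi> m"
    using Ppos[of 1] Ppos[of x3] x3 x0 by (simp add: \<eta>_def)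
  \<comment> \<open>The change is proportional to
    \<open>P x * P (1 - x3) - P (1 - x) * P x3\<close>, which vanishes at \<open>x3\<close> and is
    negative to its left and positive to its right.\<close>
  let ?\<alpha> = "\<alpha> - \<eta> * P x3" and ?\<gamma> = "\<gamma> + \<eta> * P (1 - x3)"
  have new: "?\<alpha> * P (1 - x) + ?\<gamma> * P x = \<alpha> * P (1 - x) + \<gamma> * P x + \<eta> * (P x * P (1 - x3) - P (1 - x) * P x3)" for x
    by (simp add: algebra_simps)
  have "majorant P N ?\<alpha> ?\<gamma>"
    unfolding majorant_def
  proof
    fix x :: real assume x: "x \<in> {0..1}"
    show "N x \<le> ?\<alpha> * P (1 - x) + ?\<gamma> * P x"
    proof (cases "x \<le> x3")
      case True
      have "P (1 - x) * P x3 \<le> P 1 * P x3"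
        using x x3 x0 by (intro mult_right_mono mono less_imp_le[OF Ppos]) auto
      moreover have "0 \<le> P x * P (1 - x3)"
        using x x3 mono[of 0 x] mono[of 0 "1 - x3"] P(3) x0 by (intro mult_nonneg_nonneg) auto
      ultimately have "- (P 1 * P x3) \<le> P x * P (1 - x3) - P (1 - x) * P x3" by linarith
      then have "\<eta> * - (P 1 * P x3) \<le> \<eta> * (P x * P (1 - x3) - P (1 - x) * P x3)"
        using \<eta> by (intro mult_left_mono) auto
      then have "- \<phi> m \<le> \<eta> * (P x * P (1 - x3) - P (1 - x) * P x3)" using \<eta>' by simp
      moreover have "\<phi> m \<le> \<phi> x" using m(2)[of x] True x by simp
      ultimately show ?thesis unfolding new \<phi>_def by simp
    next
      case False
      have "P (1 - x) * P x3 \<le> P (1 - x3) * P x"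
        using False x x3 x0 mono[of 0 "1 - x3"] mono[of 0 x3] P(3) by (intro mult_mono mono) auto
      then have "0 \<le> \<eta> * (P x * P (1 - x3) - P (1 - x) * P x3)" using \<eta> by (simp add: mult.commute)
      moreover have "N x \<le> \<alpha> * P (1 - x) + \<gamma> * P x" using maj x unfolding majorant_def by auto
      ultimately show ?thesis unfolding new by simp
    qed
  qed
  from least[OF this] have "0 \<le> \<eta> * (P x0 * P (1 - x3) - P (1 - x0) * P x3)" unfolding new by simp
  then have "P (1 - x0) * P x3 \<le> P x0 * P (1 - x3)" using \<eta> by (simp add: zero_le_mult_iff)
  moreover have "P x0 * P (1 - x3) < P x3 * P (1 - x0)"
    using x0 x3 Ppos strict_mono_onD[OF P(2), of x0 x3] strict_mono_onD[OF P(2), of "1 - x3" "1 - x0"]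
    by (intro mult_strict_mono) (auto intro: less_imp_le)
  ultimately show False by (simp add: mult.commute)
qed

text \<open>The value at \<open>x0\<close> is linear in the weights and is minimized over a closed
  set. Evaluation at the ends, where one of the two solutions vanishes, forces nonnegative weights,
  so weights of bounded value form a compact set. The right contact point is the left one of the
  reflected problem.\<close>

lemma least_majorant:
  fixes P N :: "real \<Rightarrow> real"
  assumes P: "continuous_on {0..1} P" "strict_mono_on {0..1} P" "P 0 = 0"
    and N: "continuous_on {0..1} N" "\<And>x. x \<in> {0..1} \<Longrightarrow> 0 \<le> N x"
    and x0: "0 < x0" "x0 < 1"
  obtains \<alpha> \<gamma> x1 x2 where "0 \<le> \<alpha>" "0 \<le> \<gamma>" "majorant P N \<alpha> \<gamma>"
    "0 \<le> x1" "x1 \<le> x0" "x0 \<le> x2" "x2 \<le> 1"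
    "N x1 = \<alpha> * P (1 - x1) + \<gamma> * P x1" "N x2 = \<alpha> * P (1 - x2) + \<gamma> * P x2"
proof -
  have mono: "P x \<le> P y" if "0 \<le> x" "x \<le> y" "y \<le> 1" for x y
    using strict_mono_on_leD[OF P(2)] that by auto
  have Ppos: "0 < P x" if "0 < x" "x \<le> 1" for x
    using strict_mono_onD[OF P(2), of 0 x] that P(3) by simp
  let ?J = "\<lambda>z. fst z * P (1 - x0) + snd z * P x0"
  let ?C = "{z. majorant P N (fst z) (snd z)}"
  have nn: "0 \<le> \<alpha>" "0 \<le> \<gamma>" if "majorant P N \<alpha> \<gamma>" for \<alpha> \<gamma>
  proof -
    have "N 0 \<le> \<alpha> * P (1 - 0) + \<gamma> * P 0" "N 1 \<le> \<alpha> * P (1 - 1) + \<gamma> * P 1"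
      using bspec[OF that[unfolded majorant_def], of 0] bspec[OF that[unfolded majorant_def], of 1] by simp_all
    then have "0 \<le> \<alpha> * P 1" "0 \<le> \<gamma> * P 1"
      using N(2)[of 0] N(2)[of 1] P(3) by auto
    then show "0 \<le> \<alpha>" "0 \<le> \<gamma>" using Ppos[of 1] by (auto simp: zero_le_mult_iff)
  qed
  obtain K where K: "\<And>x. x \<in> {0..1} \<Longrightarrow> \<bar>N x\<bar> \<le> K"
    using compact_imp_bounded[OF compact_continuous_image[OF N(1) compact_Icc]]
    unfolding bounded_iff real_norm_def by blast
  \<comment> \<open>Equal weights suffice for a first majorant: one of \<open>x\<close> and
    \<open>1 - x\<close> is at least \<open>1 / 2\<close>, so \<open>P (1 - x) + P x\<close> is at
    least \<open>P (1 / 2)\<close>.\<close>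
  define k where "k = K / P (1 / 2)"
  have K0: "0 \<le> K" using K[of 0] by simp
  have k: "0 \<le> k" using K0 Ppos[of "1/2"] by (simp add: k_def)
  have "majorant P N k k"
    unfolding majorant_def
  proof
    fix x :: real assume x: "x \<in> {0..1}"
    have "P (1 / 2) \<le> P (1 - x) + P x"
      using mono[of "1/2" x] mono[of "1/2" "1 - x"] mono[of 0 x] mono[of 0 "1 - x"] P(3) x by (cases "x \<le> 1 / 2") auto
    then have "k * P (1 / 2) \<le> k * (P (1 - x) + P x)" using k by (rule mult_left_mono)
    moreover have "k * P (1 / 2) = K" using Ppos[of "1/2"] by (simp add: k_def)
    ultimately show "N x \<le> k * P (1 - x) + k * P x" using K[OF x] by (simp add: algebra_simps)
  qed
  then have kC: "(k, k) \<in> ?C" by simp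
  let ?B = "{0..?J (k, k) / P (1 - x0)} \<times> {0..?J (k, k) / P x0}"
  have closed: "closed ?C"
  proof -
    have "?C = (\<Inter>x\<in>{0..1}. {z. N x \<le> fst z * P (1 - x) + snd z * P x})" by (auto simp: majorant_def)
    also have "closed \<dots>" by (intro closed_INT ballI closed_Collect_le continuous_intros)
    finally show ?thesis .
  qed
  have cB: "compact ?B" by (intro compact_Times compact_Icc)
  have inB: "z \<in> ?B" if "z \<in> ?C" "?J z \<le> ?J (k, k)" for z
  proof -
    have z: "0 \<le> fst z" "0 \<le> snd z" using nn that(1) by auto
    have "fst z * P (1 - x0) \<le> ?J (k, k)" "snd z * P x0 \<le> ?J (k, k)"
      using that(2) z Ppos[of x0] Ppos[of "1 - x0"] x0 by (auto intro: order_trans[rotated] simp: add_increasing add_increasing2)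
    then show ?thesis using z Ppos[of x0] Ppos[of "1 - x0"] x0 by (cases z) (auto simp: pos_le_divide_eq)
  qed
  have "compact (?B \<inter> ?C)" using cB closed by (rule compact_Int_closed)
  moreover have "?B \<inter> ?C \<noteq> {}" using inB[OF kC] kC by blast
  moreover have "continuous_on (?B \<inter> ?C) ?J" by (intro continuous_intros)
  ultimately obtain z where z: "z \<in> ?B \<inter> ?C" "\<And>y. y \<in> ?B \<inter> ?C \<Longrightarrow> ?J z \<le> ?J y"
    using continuous_attains_inf[of "?B \<inter> ?C" ?J] by blast
  have least: "?J z \<le> ?J y" if "y \<in> ?C" for y
  proof (cases "?J y \<le> ?J (k, k)")
    case True then show ?thesis using z(2) inB that by blast
  next
    case False
    moreover have "?J z \<le> ?J (k, k)" using z(2) inB[OF kC] kC by blast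
    ultimately show ?thesis by linarith
  qed
  obtain \<alpha> \<gamma> where zz: "z = (\<alpha>, \<gamma>)" by (cases z)
  have maj: "majorant P N \<alpha> \<gamma>" using z(1) zz by simp
  obtain x1 where x1: "x1 \<in> {0..x0}" "N x1 = \<alpha> * P (1 - x1) + \<gamma> * P x1"
    using left_contact[OF P N(1) x0 maj] least zz by fastforce
  have flip: "majorant P (\<lambda>x. N (1 - x)) \<gamma>' \<alpha>' \<longleftrightarrow> majorant P N \<alpha>' \<gamma>'" for \<alpha>' \<gamma>'
  proof
    assume a: "majorant P (\<lambda>x. N (1 - x)) \<gamma>' \<alpha>'"
    show "majorant P N \<alpha>' \<gamma>'" unfolding majorant_def
    proof
      fix x :: real assume "x \<in> {0..1}"
      then have "1 - x \<in> {0..1}" by simp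
      with a have "N (1 - (1 - x)) \<le> \<gamma>' * P (1 - (1 - x)) + \<alpha>' * P (1 - x)" unfolding majorant_def by blast
      then show "N x \<le> \<alpha>' * P (1 - x) + \<gamma>' * P x" by simp
    qed
  next
    assume a: "majorant P N \<alpha>' \<gamma>'"
    show "majorant P (\<lambda>x. N (1 - x)) \<gamma>' \<alpha>'" unfolding majorant_def
    proof
      fix x :: real assume "x \<in> {0..1}"
      then have "1 - x \<in> {0..1}" by simp
      with a have "N (1 - x) \<le> \<alpha>' * P (1 - (1 - x)) + \<gamma>' * P (1 - x)" unfolding majorant_def by blast
      then show "N (1 - x) \<le> \<gamma>' * P (1 - x) + \<alpha>' * P x" by simp
    qed
  qed
  have "\<exists>x\<in>{0..1 - x0}. N (1 - x) = \<gamma> * P (1 - x) + \<alpha> * P x"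
  proof (rule left_contact[OF P])
    show "continuous_on {0..1} (\<lambda>x. N (1 - x))"
      by (rule continuous_on_compose2[OF N(1)]) (auto intro!: continuous_intros)
    show "majorant P (\<lambda>x. N (1 - x)) \<gamma> \<alpha>" using maj flip by simp
    fix \<gamma>' \<alpha>' assume "majorant P (\<lambda>x. N (1 - x)) \<gamma>' \<alpha>'"
    then have "(\<alpha>', \<gamma>') \<in> ?C" using flip by simp
    from least[OF this] show "\<gamma> * P (1 - (1 - x0)) + \<alpha> * P (1 - x0) \<le> \<gamma>' * P (1 - (1 - x0)) + \<alpha>' * P (1 - x0)"
      using zz by simp
  qed (use x0 in auto)
  then obtain y where y: "y \<in> {0..1 - x0}" "N (1 - y) = \<gamma> * P (1 - y) + \<alpha> * P y" by blast
  show ?thesis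
    using that[of \<alpha> \<gamma> x1 "1 - y"] nn[OF maj] maj x1 y by simp
qed

text \<open>Makes a function differentiable at a point from two touching comparison functions with
  equal derivatives. The inequalities of the difference quotients reverse to the left of the point,
  hence the bound by a sum of absolute values.\<close>

lemma DERIV_squeeze:
  fixes f g v :: "real \<Rightarrow> real"
  assumes f: "(f has_real_derivative D) (at x)" and g: "(g has_real_derivative D) (at x)"
    and eq: "f x = v x" "g x = v x"
    and le: "\<forall>\<^sub>F y in at x. f y \<le> v y \<and> v y \<le> g y"
  shows "(v has_real_derivative D) (at x)"
proof -
  let ?q = "\<lambda>h y. (h y - h x) / (y - x)"
  have qf: "(?q f \<longlongrightarrow> D) (at x)" and qg: "(?q g \<longlongrightarrow> D) (at x)"
    using f g by (auto simp: has_field_derivative_iff)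
  have "((\<lambda>y. ?q v y - D) \<longlongrightarrow> 0) (at x)"
  proof (rule Lim_null_comparison)
    have "((\<lambda>y. \<bar>?q f y - D\<bar> + \<bar>?q g y - D\<bar>) \<longlongrightarrow> \<bar>D - D\<bar> + \<bar>D - D\<bar>) (at x)"
      by (intro tendsto_intros qf qg)
    then show "((\<lambda>y. \<bar>?q f y - D\<bar> + \<bar>?q g y - D\<bar>) \<longlongrightarrow> 0) (at x)" by simp
    have "\<forall>\<^sub>F y in at x. y \<noteq> x" by (simp add: eventually_at_filter)
    with le show "\<forall>\<^sub>F y in at x. norm (?q v y - D) \<le> \<bar>?q f y - D\<bar> + \<bar>?q g y - D\<bar>"
    proof eventually_elim
      case (elim y)
      show ?case
      proof (cases "x < y")
        case True
        then have "?q f y \<le> ?q v y" "?q v y \<le> ?q g y" using elim eq by (auto intro!: divide_right_mono)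
        then show ?thesis unfolding real_norm_def by linarith
      next
        case False
        then have "?q v y \<le> ?q f y" "?q g y \<le> ?q v y" using elim eq by (auto intro!: divide_right_mono_neg)
        then show ?thesis unfolding real_norm_def by linarith
      qed
    qed
  qed
  then have "(?q v \<longlongrightarrow> D) (at x)" by (simp add: LIM_zero_iff)
  then show ?thesis by (simp add: has_field_derivative_iff)
qed

section \<open>The value function\<close>

lemma Rt_deriv: "(Rt R0 R1 a has_real_derivative R0 a - R1 a) (at x)"
  unfolding Rt_def[abs_def] by (auto intro!: derivative_eq_intros)

lemma Rt_cont: "continuous_on S (Rt R0 R1 a)"
  unfolding Rt_def[abs_def] by (intro continuous_intros)

lemma Rt_le_between:
  assumes "x1 \<le> x" "x \<le> x2" "Rt R0 R1 a x1 \<le> Rt R0 R1 c x1" "Rt R0 R1 a x2 \<le> Rt R0 R1 c x2"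
  shows "Rt R0 R1 a x \<le> Rt R0 R1 c x"
proof (cases "x1 = x2")
  case True then show ?thesis using assms by simp
next
  case False
  define f where "f y = Rt R0 R1 c y - Rt R0 R1 a y" for y
  have "0 \<le> (x2 - x) * f x1 + (x - x1) * f x2"
    using assms by (intro add_nonneg_nonneg mult_nonneg_nonneg) (auto simp: f_def)
  also have "\<dots> = (x2 - x1) * f x" by (simp add: f_def Rt_def algebra_simps)
  finally have "0 \<le> f x" using False assms(1,2) by (simp add: zero_le_mult_iff)
  then show ?thesis by (simp add: f_def)
qed

text \<open>Near belief \<open>0\<close> the reward that is best at \<open>0\<close> has tangents dominating all rewards, because
  their weight \<open>tan_lo\<close> on the solution increasing in the belief is unbounded.\<close>

lemma tangent_feasible_near_0:
  assumes fin: "finite A" "A \<noteq> {}" and nn: "\<And>a. a \<in> A \<Longrightarrow> 0 \<le> R0 a \<and> 0 \<le> R1 a"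
    and und: "\<And>a. a \<in> A \<Longrightarrow> \<exists>d\<in>{0<..<1}. \<forall>c\<in>A. Rt R0 R1 c d \<le> Rt R0 R1 a d"
    and b: "1 < b"
  shows "\<exists>a\<in>A. (\<forall>c\<in>A. R1 c \<le> R1 a) \<and> (\<exists>\<epsilon>>0. \<epsilon> < 1 \<and> (\<forall>y. 0 < y \<longrightarrow> y < \<epsilon> \<longrightarrow>
     (\<exists>\<alpha> \<gamma>. (\<forall>x c. 0 < x \<longrightarrow> x < 1 \<longrightarrow> c \<in> A \<longrightarrow> Rt R0 R1 c x \<le> harm b \<alpha> \<gamma> x) \<and> Rt R0 R1 a y = harm b \<alpha> \<gamma> y)))"
proof -
  have "Max (R1 ` A) \<in> R1 ` A" by (rule Max_in) (use fin in auto)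
  then obtain a where aA: "a \<in> A" and aM: "Max (R1 ` A) = R1 a" by blast
  have "R1 c \<le> R1 a" if "c \<in> A" for c
    unfolding aM[symmetric] by (rule Max_ge) (use fin that in auto)
  note a = aA this
  define al where "al y = R1 a * tan_hi b y + R0 a * tan_lo b (1 - y)" for y
  define ga where "ga y = R1 a * tan_lo b y + R0 a * tan_hi b (1 - y)" for y
  have tan: "Rt R0 R1 a x \<le> harm b (al y) (ga y) x" if "0 < x" "x < 1" "0 < y" "y < 1" for x y
    unfolding al_def ga_def by (rule Rt_tangent(1)[OF b]) (use that nn[OF a(1)] in auto)
  have tan_eq: "Rt R0 R1 a y = harm b (al y) (ga y) y" if "0 < y" "y < 1" for y
    unfolding al_def ga_def by (rule Rt_tangent(2)[OF b]) (use that nn[OF a(1)] in auto)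
  have "\<exists>\<epsilon>>0. \<epsilon> < 1 \<and> (\<forall>y. 0 < y \<longrightarrow> y < \<epsilon> \<longrightarrow> (\<forall>x. 0 < x \<longrightarrow> x < 1 \<longrightarrow> Rt R0 R1 c x \<le> harm b (al y) (ga y) x))"
    if c: "c \<in> A" for c
  proof (cases "R0 c \<le> R0 a")
    case True
    have "Rt R0 R1 c x \<le> Rt R0 R1 a x" if "0 < x" "x < 1" for x
      unfolding Rt_def using True a(2)[OF c] that by (intro add_mono mult_left_mono) auto
    then have "Rt R0 R1 c x \<le> harm b (al y) (ga y) x" if "0 < x" "x < 1" "0 < y" "y < 1 / 2" for x y
      using order_trans[OF _ tan[of x y]] that by simp
    then show ?thesis by (intro exI[of _ "1/2"]) simp
  next
    case False
    \<comment> \<open>If both were equally good at belief 0, then \<open>c\<close>, with the larger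
      \<open>R0\<close>, would beat \<open>a\<close> at every interior belief, against the
      assumption that \<open>a\<close> is somewhere maximal.\<close>
    have lt: "R1 c < R1 a"
    proof (rule ccontr)
      assume "\<not> R1 c < R1 a"
      then have e: "R1 c = R1 a" using a(2)[OF c] by simp
      obtain d where d: "0 < d" "d < 1" "Rt R0 R1 c d \<le> Rt R0 R1 a d" using und[OF a(1)] c by auto
      then show False using False e by (simp add: Rt_def)
    qed
    \<comment> \<open>The belief at which the two rewards cross. Up to \<open>s\<close>, the tangent
      dominates \<open>c\<close> because it dominates \<open>a\<close>; beyond \<open>s\<close>, the
      increasing solution with its large weight does.\<close>
    define s where "s = (R1 a - R1 c) / ((R1 a - R1 c) + (R0 c - R0 a))"
    have s: "0 < s" "s < 1" using lt False by (auto simp: s_def)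
    have s_le: "Rt R0 R1 c x \<le> Rt R0 R1 a x" if "0 < x" "x \<le> s" for x
    proof -
      have "x * ((R1 a - R1 c) + (R0 c - R0 a)) \<le> R1 a - R1 c"
        using that lt False by (simp add: s_def pos_le_divide_eq)
      then show ?thesis by (simp add: Rt_def algebra_simps)
    qed
    define K where "K = R0 c + R1 c"
    have K: "0 \<le> K" "Rt R0 R1 c x \<le> K" if "0 < x" "x < 1" for x
    proof -
      show "0 \<le> K" using nn[OF c] by (simp add: K_def)
      have "x * R0 c \<le> 1 * R0 c" "(1 - x) * R1 c \<le> 1 * R1 c" using nn[OF c] that by (auto intro!: mult_left_le_one_le)
      then show "Rt R0 R1 c x \<le> K" by (simp add: Rt_def K_def)
    qed
    have K0: "0 \<le> K" using K(1)[of "1/2"] by simp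
    \<comment> \<open>For \<open>y\<close> below \<open>1 / 2\<close> the odds of \<open>y\<close>
      are at most \<open>2 * y\<close> and at most 1, so \<open>tan_lo b y\<close> is at least
      \<open>(b - 1) / (2 * b - 1) / (2 * y)\<close>. Beyond \<open>s\<close> the tangent is
      therefore at least \<open>k / y\<close>, and \<open>\<epsilon>\<close> is chosen so that this
      exceeds the bound \<open>K\<close> on the reward of \<open>c\<close>.\<close>
    define k where "k = R1 a * ((b - 1) / (2 * b - 1)) / 2 * u b s"
    have k: "0 < k" using lt nn[OF c] b u_pos[OF s, of b] by (auto simp: k_def intro!: mult_pos_pos divide_pos_pos)
    define \<epsilon> where "\<epsilon> = min (1 / 2) (k / (K + 1))"
    have \<epsilon>: "0 < \<epsilon>" "\<epsilon> \<le> 1 / 2" "\<epsilon> * (K + 1) \<le> k"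
    proof -
      show "0 < \<epsilon>" using k K0 by (simp add: \<epsilon>_def)
      show "\<epsilon> \<le> 1 / 2" unfolding \<epsilon>_def by (rule min.cobounded1)
      have "\<epsilon> \<le> k / (K + 1)" by (simp add: \<epsilon>_def)
      then show "\<epsilon> * (K + 1) \<le> k" using K0 by (simp add: pos_le_divide_eq)
    qed
    show ?thesis
    proof (intro exI[of _ \<epsilon>] conjI allI impI)
      show "0 < \<epsilon>" "\<epsilon> < 1" using \<epsilon> by auto
      fix y x :: real assume y: "0 < y" "y < \<epsilon>" and x: "0 < x" "x < 1"
      have y1: "y < 1" using y \<epsilon> by simp
      show "Rt R0 R1 c x \<le> harm b (al y) (ga y) x"
      proof (cases "x \<le> s")
        case True then show ?thesis using s_le[OF x(1)] tan[OF x y(1) y1] by (meson order_trans)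
      next
        case False
        define z where "z = y / (1 - y)"
        have z: "0 < z" "z \<le> 2 * y" "z \<le> 1"
        proof -
          show "0 < z" using y y1 by (simp add: z_def)
          have "y * 1 \<le> y * (2 * (1 - y))" using y \<epsilon> by (intro mult_left_mono) auto
          then have "y \<le> 2 * y * (1 - y)" by (simp add: algebra_simps)
          then show "z \<le> 2 * y" using y1 by (simp add: z_def pos_divide_le_eq)
          then show "z \<le> 1" using y \<epsilon> by simp
        qed
        have "z powr b \<le> z powr 1" using z b by (intro powr_mono') auto
        then have "1 / z \<le> z powr (- b)" using z by (simp add: powr_minus divide_simps)
        moreover have "1 / (2 * y) \<le> 1 / z" using z y by (intro divide_left_mono) auto
        ultimately have zb: "1 / (2 * y) \<le> z powr (- b)" by linarith
        have pn: "0 \<le> al y" "0 \<le> R0 a * tan_hi b (1 - y)" "0 \<le> tan_lo b y"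
          using nn[OF a(1)] b by (auto simp: al_def tan_hi_def tan_lo_def)
        have "K * y \<le> k" 
        proof -
          have "K * y \<le> (K + 1) * \<epsilon>" using K0 y by (intro mult_mono) auto
          then show ?thesis using \<epsilon>(3) by (simp add: mult.commute)
        qed
        then have "K \<le> k / y" using y by (simp add: pos_le_divide_eq)
        also have "k / y = R1 a * ((b - 1) / (2 * b - 1) * (1 / (2 * y))) * u b s" by (simp add: k_def)
        also have "\<dots> \<le> R1 a * tan_lo b y * u b s"
          unfolding tan_lo_def z_def[symmetric] using zb b nn[OF a(1)] u_pos[OF s, of b]
          by (intro mult_right_mono mult_left_mono) auto
        also have "\<dots> \<le> R1 a * tan_lo b y * u b x"
          using False x s b pn nn[OF a(1)] by (intro mult_left_mono u_mono) auto
        also have "\<dots> \<le> ga y * u b x"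
          unfolding ga_def using pn u_pos[OF x, of b] by (intro mult_right_mono) auto
        also have "\<dots> \<le> harm b (al y) (ga y) x"
          using pn u_pos[of "1 - x" b] x by (simp add: harm_def)
        finally show ?thesis using K(2)[OF x] by linarith
      qed
    qed
  qed
  then have "\<forall>c\<in>A. \<exists>\<epsilon>. \<epsilon> > 0 \<and> \<epsilon> < 1 \<and> (\<forall>y. 0 < y \<longrightarrow> y < \<epsilon> \<longrightarrow> (\<forall>x. 0 < x \<longrightarrow> x < 1 \<longrightarrow> Rt R0 R1 c x \<le> harm b (al y) (ga y) x))"
    by blast
  from bchoice[OF this] obtain e where e0: "\<forall>c\<in>A. 0 < e c \<and> e c < 1 \<and> (\<forall>y. 0 < y \<longrightarrow> y < e c \<longrightarrow> (\<forall>x. 0 < x \<longrightarrow> x < 1 \<longrightarrow> Rt R0 R1 c x \<le> harm b (al y) (ga y) x))"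
    by (elim exE)
  note e = bspec[OF e0]
  define \<epsilon> where "\<epsilon> = Min (e ` A)"
  have \<epsilon>: "0 < \<epsilon>" "\<epsilon> < 1" "\<And>c. c \<in> A \<Longrightarrow> \<epsilon> \<le> e c"
    using fin e a(1) by (auto simp: \<epsilon>_def Min_gr_iff Min_less_iff)
  have "\<exists>\<alpha> \<gamma>. (\<forall>x c. 0 < x \<longrightarrow> x < 1 \<longrightarrow> c \<in> A \<longrightarrow> Rt R0 R1 c x \<le> harm b \<alpha> \<gamma> x) \<and> Rt R0 R1 a y = harm b \<alpha> \<gamma> y"
    if y: "0 < y" "y < \<epsilon>" for y
  proof (rule exI[of _ "al y"], rule exI[of _ "ga y"], intro conjI allI impI)
    show "Rt R0 R1 a y = harm b (al y) (ga y) y" using y \<epsilon> by (intro tan_eq) auto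
    fix x :: real and c assume "0 < x" "x < 1" "c \<in> A"
    then show "Rt R0 R1 c x \<le> harm b (al y) (ga y) x"
      using e[of c] less_le_trans[OF y(2) \<epsilon>(3)[of c]] y(1) by blast
  qed
  then show ?thesis using a \<epsilon>(1,2) by blast
qed

lemma hatC2_cong:
  assumes "\<And>x. x \<in> {0..1} \<Longrightarrow> f x = g x" "hatC2 f"
  shows "hatC2 g"
proof -
  obtain f' where f': "\<And>x. x \<in> {0..1} \<Longrightarrow> (f has_real_derivative f' x) (at x within {0..1})" "continuous_on {0..1} f'"
    "\<exists>N. finite N \<and> (\<forall>x\<in>{0..1} - N. f' differentiable (at x within {0..1}))"
    using assms(2) unfolding hatC2_def by blast
  have "(g has_real_derivative f' x) (at x within {0..1})" if "x \<in> {0..1}" for x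
    by (rule has_field_derivative_transform_within[OF f'(1)[OF that] zero_less_one that]) (use assms(1) in auto)
  then show ?thesis unfolding hatC2_def using f' by blast
qed

section \<open>The envelope on the open unit interval\<close>

locale payoffs =
  fixes A :: "'b set" and R0 R1 :: "'b \<Rightarrow> real" and b :: real
  assumes finA: "finite A" and ne: "A \<noteq> {}"
    and nn: "\<And>a. a \<in> A \<Longrightarrow> 0 \<le> R0 a \<and> 0 \<le> R1 a"
    and nz: "\<exists>a\<in>A. 0 < R0 a + R1 a"
    and und: "\<And>a. a \<in> A \<Longrightarrow> \<exists>d\<in>{0<..<1}. \<forall>c\<in>A. Rt R0 R1 c d \<le> Rt R0 R1 a d"
    and b: "1 < b"
begin

abbreviation "l \<equiv> Rt R0 R1"
abbreviation "G \<equiv> Gmax A R0 R1"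

lemma l_le_G: "a \<in> A \<Longrightarrow> l a x \<le> G x"
  unfolding Gmax_def using finA by (intro Max_ge) auto

lemma G_attained: "\<exists>a\<in>A. G x = l a x"
proof -
  have "G x \<in> (\<lambda>a. l a x) ` A" unfolding Gmax_def by (rule Max_in) (use finA ne in auto)
  then show ?thesis by blast
qed

lemma G_cont: "continuous_on S G"
  unfolding Gmax_def[abs_def] using finA ne
proof (induction A rule: finite_ne_induct)
  case (insert a B)
  have "(\<lambda>d. Max ((\<lambda>a. l a d) ` insert a B)) = (\<lambda>d. max (l a d) (Max ((\<lambda>a. l a d) ` B)))"
    using insert by auto
  then show ?case using insert Rt_cont[of S R0 R1 a] by (simp add: continuous_on_max)
qed (simp add: Rt_cont)

lemma G_nonneg: "x \<in> {0..1} \<Longrightarrow> 0 \<le> G x"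
  using G_attained[of x] nn by (auto simp: Rt_def)

definition feasible :: "real \<Rightarrow> real \<Rightarrow> bool" where
  "feasible \<alpha> \<gamma> \<longleftrightarrow> (\<forall>x. 0 < x \<longrightarrow> x < 1 \<longrightarrow> G x \<le> harm b \<alpha> \<gamma> x)"

lemma feasibleD: "feasible \<alpha> \<gamma> \<Longrightarrow> 0 < x \<Longrightarrow> x < 1 \<Longrightarrow> G x \<le> harm b \<alpha> \<gamma> x"
  by (simp add: feasible_def)

lemma feasible_iff: "feasible \<alpha> \<gamma> \<longleftrightarrow> (\<forall>x c. 0 < x \<longrightarrow> x < 1 \<longrightarrow> c \<in> A \<longrightarrow> l c x \<le> harm b \<alpha> \<gamma> x)"
proof
  assume "feasible \<alpha> \<gamma>"
  then show "\<forall>x c. 0 < x \<longrightarrow> x < 1 \<longrightarrow> c \<in> A \<longrightarrow> l c x \<le> harm b \<alpha> \<gamma> x"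
    unfolding feasible_def using order_trans[OF l_le_G] by blast
next
  assume a: "\<forall>x c. 0 < x \<longrightarrow> x < 1 \<longrightarrow> c \<in> A \<longrightarrow> l c x \<le> harm b \<alpha> \<gamma> x"
  show "feasible \<alpha> \<gamma>"
    unfolding feasible_def
  proof (intro allI impI)
    fix x :: real assume "0 < x" "x < 1"
    moreover obtain c where "c \<in> A" "G x = l c x" using G_attained by blast
    ultimately show "G x \<le> harm b \<alpha> \<gamma> x" using a by simp
  qed
qed

text \<open>The contact points may coincide with \<open>x\<close> itself, which is the case of
  immediate stopping; otherwise they bound an interval on which waiting is optimal once the
  combination is also feasible.\<close>

definition contact :: "real \<Rightarrow> real \<Rightarrow> real \<Rightarrow> bool" where
  "contact \<alpha> \<gamma> x \<longleftrightarrow> (\<exists>x1 x2. 0 < x1 \<and> x1 \<le> x \<and> x \<le> x2 \<and> x2 < 1 \<and> G x1 = harm b \<alpha> \<gamma> x1 \<and> G x2 = harm b \<alpha> \<gamma> x2)"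

text \<open>Multiplying by \<open>(x (1 - x)) powr (b - 1)\<close> turns the problem into one on the compact interval,
  with \<open>x powr (2 b - 1)\<close> in place of \<open>u b x\<close>. Contact at an end is impossible since rewards are of
  order at least \<open>x (1 - x)\<close>.\<close>

lemma harm_scaled:
  assumes "0 < x" "x < 1"
  shows "harm b \<alpha> \<gamma> x * (x * (1 - x)) powr (b - 1) = \<alpha> * (1 - x) powr (2 * b - 1) + \<gamma> * x powr (2 * b - 1)"
proof -
  have "u b y * (y * (1 - y)) powr (b - 1) = y powr (2 * b - 1)" if "0 < y" "y < 1" for y
  proof -
    have "u b y * (y * (1 - y)) powr (b - 1) = (y powr b * y powr (b - 1)) * ((1 - y) powr (1 - b) * (1 - y) powr (b - 1))"
      using that by (simp add: u_def powr_mult mult_ac)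
    also have "\<dots> = y powr (2 * b - 1)" using that by (simp add: powr_add[symmetric])
    finally show ?thesis .
  qed
  note e = this
  let ?w = "(x * (1 - x)) powr (b - 1)"
  have r: "(1 - x) * (1 - (1 - x)) = x * (1 - x)" by simp
  have "harm b \<alpha> \<gamma> x * ?w = \<alpha> * (u b (1 - x) * ?w) + \<gamma> * (u b x * ?w)"
    by (simp add: harm_def algebra_simps)
  also have "u b (1 - x) * ?w = (1 - x) powr (2 * b - 1)" using e[of "1 - x"] assms unfolding r by simp
  also have "u b x * ?w = x powr (2 * b - 1)" using e[of x] assms by simp
  finally show ?thesis .
qed

text \<open>Division by \<open>x powr b\<close> leaves a left side tending to \<open>c\<close> at 0
  and a right side tending to 0.\<close>

lemma no_boundary_contact:
  assumes c: "0 < c" and le: "\<And>x. 0 < x \<Longrightarrow> x < 1 \<Longrightarrow> c * (x * (1 - x)) * (x * (1 - x)) powr (b - 1) \<le> \<gamma> * x powr (2 * b - 1)"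
  shows False
proof -
  have key: "c * (1 - x) powr b \<le> \<gamma> * x powr (b - 1)" if x: "0 < x" "x < 1" for x
  proof -
    have "(x * (1 - x)) * (x * (1 - x)) powr (b - 1) = x powr b * (1 - x) powr b"
      using x by (simp add: powr_mult powr_diff)
    moreover have "x powr (2 * b - 1) = x powr b * x powr (b - 1)" using x by (simp add: powr_add[symmetric])
    ultimately have "x powr b * (c * (1 - x) powr b) \<le> x powr b * (\<gamma> * x powr (b - 1))"
      using le[OF x] by (simp add: mult_ac)
    then show ?thesis using x by simp
  qed
  have "((\<lambda>x. c * (1 - x) powr b) \<longlongrightarrow> c * (1 - 0) powr b) (at_right 0)"
    by (intro tendsto_intros) auto
  moreover have "((\<lambda>x::real. x powr (b - 1)) \<longlongrightarrow> 0 powr (b - 1)) (at_right 0)"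
    by (rule tendsto_powr'[OF tendsto_ident_at tendsto_const]) (use b in \<open>auto intro!: eventually_mono[OF eventually_at_right_less[of 0]]\<close>)
  then have "((\<lambda>x. \<gamma> * x powr (b - 1)) \<longlongrightarrow> \<gamma> * 0) (at_right 0)"
    using b by (intro tendsto_intros) simp
  moreover have "\<forall>\<^sub>F x in at_right 0. c * (1 - x) powr b \<le> \<gamma> * x powr (b - 1)"
    using key by (intro eventually_at_rightI[of 0 1]) auto
  ultimately have "c * (1 - 0) powr b \<le> \<gamma> * 0" by (intro tendsto_le[of "at_right 0"]) auto
  then show False using c by simp
qed

text \<open>The scaled payoff vanishes at both ends, so contact at one end kills the weight of the
  solution that is positive there. A single solution cannot dominate the scaled payoff near the end
  where it vanishes, so both contacts are interior.\<close>

lemma ex_support: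
  assumes d: "0 < d" "d < 1"
  shows "\<exists>\<alpha> \<gamma>. 0 \<le> \<alpha> \<and> 0 \<le> \<gamma> \<and> feasible \<alpha> \<gamma> \<and> contact \<alpha> \<gamma> d"
proof -
  let ?P = "\<lambda>x::real. x powr (2 * b - 1)"
  let ?w = "\<lambda>x::real. (x * (1 - x)) powr (b - 1)"
  let ?N = "\<lambda>x. G x * ?w x"
  have P: "continuous_on {0..1} ?P" "strict_mono_on {0..1} ?P" "?P 0 = 0"
  proof -
    show "continuous_on {0..1} ?P" by (intro continuous_on_powr' continuous_intros) (use b in auto)
    show "strict_mono_on {0..1} ?P" using b by (intro strict_mono_onI powr_less_mono2) auto
    show "?P 0 = 0" by simp
  qed
  have w: "continuous_on {0..1} ?w"
    using b by (intro continuous_on_powr' continuous_intros) auto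
  have N: "continuous_on {0..1} ?N" by (intro continuous_on_mult G_cont w)
  have N0: "0 \<le> ?N x" if "x \<in> {0..1}" for x using G_nonneg[OF that] by simp
  obtain \<alpha> \<gamma> x1 x2 where nn': "0 \<le> \<alpha>" "0 \<le> \<gamma>" and maj: "majorant ?P ?N \<alpha> \<gamma>"
    and x: "0 \<le> x1" "x1 \<le> d" "d \<le> x2" "x2 \<le> 1"
    and c1: "?N x1 = \<alpha> * ?P (1 - x1) + \<gamma> * ?P x1" and c2: "?N x2 = \<alpha> * ?P (1 - x2) + \<gamma> * ?P x2"
    by (rule least_majorant[OF P N N0 d])
  have wpos: "0 < ?w x" if "0 < x" "x < 1" for x using that by simp
  have feas: "feasible \<alpha> \<gamma>"
    unfolding feasible_def
  proof (intro allI impI)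
    fix x :: real assume x: "0 < x" "x < 1"
    have "?N x \<le> harm b \<alpha> \<gamma> x * ?w x" using maj x unfolding majorant_def harm_scaled[OF x] by auto
    then show "G x \<le> harm b \<alpha> \<gamma> x" using wpos[OF x] by simp
  qed
  obtain a where a: "a \<in> A" "0 < R0 a + R1 a" using nz by blast
  define k where "k = R0 a + R1 a"
  \<comment> \<open>Both \<open>x\<close> and \<open>1 - x\<close> are at least
    \<open>x * (1 - x)\<close>, which bounds a nonnegative linear reward from below.\<close>
  have Gk: "k * (x * (1 - x)) \<le> G x" if "0 < x" "x < 1" for x
  proof -
    have "x * (1 - x) * R0 a \<le> x * R0 a" "(1 - x) * x * R1 a \<le> (1 - x) * R1 a"
      using that nn[OF a(1)] mult_left_le[of "1 - x" x] mult_left_le[of x "1 - x"] by (intro mult_right_mono; simp)+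
    then have "k * (x * (1 - x)) \<le> l a x" by (simp add: k_def Rt_def algebra_simps)
    then show ?thesis using l_le_G[OF a(1), of x] by linarith
  qed
  have maj': "k * (x * (1 - x)) * ?w x \<le> \<alpha> * ?P (1 - x) + \<gamma> * ?P x" if x: "0 < x" "x < 1" for x
  proof -
    have "k * (x * (1 - x)) * ?w x \<le> ?N x" using Gk[OF x] wpos[OF x] by simp
    moreover have "?N x \<le> \<alpha> * ?P (1 - x) + \<gamma> * ?P x" using maj x unfolding majorant_def by auto
    ultimately show ?thesis by linarith
  qed
  have k: "0 < k" using a by (simp add: k_def)
  have x10: "x1 \<noteq> 0"
  proof
    assume "x1 = 0"
    then have "\<alpha> = 0" using c1 b by simp
    then show False using no_boundary_contact[OF k, of \<gamma>] maj' by simp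
  qed
  have x21: "x2 \<noteq> 1"
  proof
    assume "x2 = 1"
    then have "\<gamma> = 0" using c2 b by simp
    have r: "(1 - x) * (1 - (1 - x)) = x * (1 - x)" for x :: real by simp
    have "k * (x * (1 - x)) * ?w x \<le> \<alpha> * ?P x" if "0 < x" "x < 1" for x
      using maj'[of "1 - x"] that \<open>\<gamma> = 0\<close> unfolding r by simp
    then show False using no_boundary_contact[OF k, of \<alpha>] by simp
  qed
  have eq: "G y = harm b \<alpha> \<gamma> y" if "0 < y" "y < 1" "?N y = \<alpha> * ?P (1 - y) + \<gamma> * ?P y" for y
    using that(3) wpos[OF that(1,2)] unfolding harm_scaled[OF that(1,2), symmetric] by simp
  have "contact \<alpha> \<gamma> d"
    unfolding contact_def
    by (rule exI[of _ x1], rule exI[of _ x2]) (use x x10 x21 d eq c1 c2 in auto)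
  then show ?thesis using nn' feas by blast
qed

text \<open>Weights are picked by choice. That they are unique, and hence depend on \<open>d\<close>
  in a controlled way, emerges only after the envelope is known to be differentiable.\<close>

definition al :: "real \<Rightarrow> real" where
  "al d = fst (SOME z. 0 \<le> fst z \<and> 0 \<le> snd z \<and> feasible (fst z) (snd z) \<and> contact (fst z) (snd z) d)"

definition ga :: "real \<Rightarrow> real" where
  "ga d = snd (SOME z. 0 \<le> fst z \<and> 0 \<le> snd z \<and> feasible (fst z) (snd z) \<and> contact (fst z) (snd z) d)"

lemma support:
  assumes "0 < d" "d < 1"
  shows "0 \<le> al d" "0 \<le> ga d" "feasible (al d) (ga d)" "contact (al d) (ga d) d"
proof -
  let ?Q = "\<lambda>z. 0 \<le> fst z \<and> 0 \<le> snd z \<and> feasible (fst z) (snd z) \<and> contact (fst z) (snd z) d"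
  have "\<exists>z. ?Q z" using ex_support[OF assms] by auto
  from someI_ex[OF this] show "0 \<le> al d" "0 \<le> ga d" "feasible (al d) (ga d)" "contact (al d) (ga d) d"
    unfolding al_def ga_def by auto
qed

definition V :: "real \<Rightarrow> real" where
  "V d = harm b (al d) (ga d) d"

text \<open>At its contact points the chosen combination equals \<open>G\<close>, so any feasible
  one is at least as large there and therefore in between. Thus \<open>V\<close> is the infimum of
  all feasible combinations, independent of the choice.\<close>

lemma V_le_feasible:
  assumes d: "0 < d" "d < 1" and f: "feasible \<alpha> \<gamma>"
  shows "V d \<le> harm b \<alpha> \<gamma> d"
proof -
  obtain x1 x2 where x: "0 < x1" "x1 \<le> d" "d \<le> x2" "x2 < 1"
    and c: "G x1 = harm b (al d) (ga d) x1" "G x2 = harm b (al d) (ga d) x2"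
    using support(4)[OF d] unfolding contact_def by blast
  show ?thesis unfolding V_def
    by (rule harm_le_between[OF less_imp_le[OF b] x])
      (use feasibleD[OF f, of x1] feasibleD[OF f, of x2] x c in auto)
qed

lemma V_le: "0 < d \<Longrightarrow> d < 1 \<Longrightarrow> 0 < x \<Longrightarrow> x < 1 \<Longrightarrow> V x \<le> harm b (al d) (ga d) x"
  using V_le_feasible support(3) by blast

lemma G_le_V: "0 < d \<Longrightarrow> d < 1 \<Longrightarrow> G d \<le> V d"
  unfolding V_def using feasibleD[OF support(3)] by blast

lemma V_concave:
  assumes x: "0 < x1" "x1 \<le> x" "x \<le> x2" "x2 < 1"
    and le: "harm b \<alpha> \<gamma> x1 \<le> V x1" "harm b \<alpha> \<gamma> x2 \<le> V x2"
  shows "harm b \<alpha> \<gamma> x \<le> V x"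
  unfolding V_def
  by (rule harm_le_between[OF less_imp_le[OF b] x])
    (use le V_le[of x x1] V_le[of x x2] x in auto)

text \<open>A single combination serves the whole stretch between two contact points: it bounds
  \<open>V\<close> from above everywhere, and relative concavity bounds \<open>V\<close> from below
  there.\<close>

lemma V_eq_on_contact:
  assumes d: "0 < d" "d < 1" and x: "0 < x1" "x1 \<le> x" "x \<le> x2" "x2 < 1"
    and c: "G x1 = harm b (al d) (ga d) x1" "G x2 = harm b (al d) (ga d) x2"
  shows "V x = harm b (al d) (ga d) x"
proof (rule antisym)
  show "V x \<le> harm b (al d) (ga d) x" by (rule V_le[OF d]) (use x in auto)
  show "harm b (al d) (ga d) x \<le> V x"
    by (rule V_concave[OF x]) (use c G_le_V[of x1] G_le_V[of x2] x in auto)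
qed

lemma eventually_unit: "0 < x \<Longrightarrow> x < 1 \<Longrightarrow> \<forall>\<^sub>F y in at x. 0 < y \<and> y < (1::real)"
  using eventually_at_in_open'[of "{0<..<1::real}" x] by (auto elim!: eventually_mono)

text \<open>Strictly between contact points \<open>V\<close> is locally harmonic. At a contact point
  the best reward touches the combination from below, so their difference has a local minimum and
  the slopes agree; \<open>V\<close> lies between the two. This is smooth fit.\<close>

lemma V_deriv:
  assumes d: "0 < d" "d < 1"
  shows "(V has_real_derivative harm' b (al d) (ga d) d) (at d)"
proof -
  obtain x1 x2 where x: "0 < x1" "x1 \<le> d" "d \<le> x2" "x2 < 1"
    and c: "G x1 = harm b (al d) (ga d) x1" "G x2 = harm b (al d) (ga d) x2"
    using support(4)[OF d] unfolding contact_def by blast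
  note hd = harm_derivs(1)[OF d, of b "al d" "ga d"]
  have up: "\<forall>\<^sub>F y in at d. V y \<le> harm b (al d) (ga d) y"
    using eventually_unit[OF d] by eventually_elim (use V_le[OF d] in auto)
  have Vd: "harm b (al d) (ga d) d = V d" by (simp add: V_def)
  show ?thesis
  proof (cases "x1 < d \<and> d < x2")
    case True
    have "\<forall>\<^sub>F y in at d. y \<in> {x1<..<x2}" by (rule eventually_at_in_open') (use True in auto)
    then have "\<forall>\<^sub>F y in at d. harm b (al d) (ga d) y \<le> V y \<and> V y \<le> harm b (al d) (ga d) y"
    proof eventually_elim
      case (elim y)
      then have "V y = harm b (al d) (ga d) y" by (intro V_eq_on_contact[OF d x(1) _ _ x(4) c]) auto
      then show ?case by simp
    qed
    then show ?thesis by (intro DERIV_squeeze[where v = V, OF hd hd Vd Vd])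
  next
    case False
    then have "G d = harm b (al d) (ga d) d" using x c by (cases "x1 = d") auto
    then obtain a where a: "a \<in> A" "l a d = harm b (al d) (ga d) d" using G_attained[of d] by auto
    have low: "\<forall>\<^sub>F y in at d. l a y \<le> V y"
      using eventually_unit[OF d]
    proof eventually_elim
      case (elim y) then show ?case using l_le_G[OF a(1), of y] G_le_V[of y] by linarith
    qed
    let ?f = "\<lambda>y. harm b (al d) (ga d) y - l a y"
    have "(?f has_real_derivative harm' b (al d) (ga d) d - (R0 a - R1 a)) (at d)"
      by (rule DERIV_diff[OF hd Rt_deriv])
    moreover have "\<forall>y. \<bar>d - y\<bar> < min d (1 - d) \<longrightarrow> ?f d \<le> ?f y"
    proof (intro allI impI)
      fix y assume "\<bar>d - y\<bar> < min d (1 - d)"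
      then have y: "0 < y" "y < 1" by auto
      show "?f d \<le> ?f y" using a(2) l_le_G[OF a(1), of y] feasibleD[OF support(3)[OF d] y] by linarith
    qed
    ultimately have "harm' b (al d) (ga d) d - (R0 a - R1 a) = 0"
      using d by (intro DERIV_local_min[where d = "min d (1 - d)"]) auto
    then have la: "(l a has_real_derivative harm' b (al d) (ga d) d) (at d)" using Rt_deriv[of R0 R1 a d] by simp
    show ?thesis
      by (rule DERIV_squeeze[where v = V, OF la hd _ Vd]) (use a(2) Vd up low in \<open>auto elim: eventually_elim2\<close>)
  qed
qed

text \<open>A combination above \<open>V\<close> with equality at \<open>d\<close> must share the
  derivative of \<open>V\<close> there, and value and derivative determine the weights.\<close>

lemma support_unique:
  assumes d: "0 < d" "d < 1" and le: "\<And>x. 0 < x \<Longrightarrow> x < 1 \<Longrightarrow> V x \<le> harm b \<alpha> \<gamma> x"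
    and eq: "V d = harm b \<alpha> \<gamma> d"
  shows "\<alpha> = al d" "\<gamma> = ga d"
proof -
  let ?f = "\<lambda>y. harm b \<alpha> \<gamma> y - V y"
  have "(?f has_real_derivative harm' b \<alpha> \<gamma> d - harm' b (al d) (ga d) d) (at d)"
    by (rule DERIV_diff[OF harm_derivs(1)[OF d] V_deriv[OF d]])
  moreover have "\<forall>y. \<bar>d - y\<bar> < min d (1 - d) \<longrightarrow> ?f d \<le> ?f y"
    using le eq by auto
  ultimately have "harm' b \<alpha> \<gamma> d - harm' b (al d) (ga d) d = 0"
    using d by (intro DERIV_local_min[where d = "min d (1 - d)"]) auto
  then have "harm' b \<alpha> \<gamma> d = harm' b (al d) (ga d) d" "harm b \<alpha> \<gamma> d = harm b (al d) (ga d) d"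
    using eq by (auto simp: V_def)
  from harm_determined[OF less_imp_le[OF b] d this(2,1)] show "\<alpha> = al d" "\<gamma> = ga d" by auto
qed

lemma V_cont: "0 < lo \<Longrightarrow> hi < 1 \<Longrightarrow> continuous_on {lo..hi} V"
  by (intro continuous_at_imp_continuous_on ballI DERIV_isCont[OF V_deriv]) auto

lemma u_cont: "0 < lo \<Longrightarrow> hi < 1 \<Longrightarrow> continuous_on {lo..hi} (u b)"
  by (intro continuous_at_imp_continuous_on ballI DERIV_isCont[OF u_deriv]) auto

lemma u_reflect_cont: "0 < lo \<Longrightarrow> hi < 1 \<Longrightarrow> continuous_on {lo..hi} (\<lambda>x. u b (1 - x))"
  by (rule continuous_on_compose2[OF u_cont[of "1 - hi" "1 - lo"]]) (auto intro!: continuous_intros)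

text \<open>By uniqueness, the graph of the weights is cut out by conditions that are closed in the
  belief and the weights together. The weights are bounded on compact subintervals, and a closed
  graph with compact range gives continuity.\<close>

lemma support_cont:
  assumes lo: "0 < lo" "hi < 1"
  shows "continuous_on {lo..hi} (\<lambda>x. (al x, ga x))"
proof (cases "lo \<le> hi")
  case True
  obtain K where K: "\<And>x. x \<in> {lo..hi} \<Longrightarrow> \<bar>V x\<bar> \<le> K"
    using compact_imp_bounded[OF compact_continuous_image[OF V_cont[OF lo] compact_Icc]]
    unfolding bounded_iff real_norm_def by blast
  define T where "T = {0..K / u b (1 - hi)} \<times> {0..K / u b lo}"
  have up: "0 < u b lo" "0 < u b (1 - hi)" using u_pos[of lo b] u_pos[of "1 - hi" b] lo True by auto
  have im: "(\<lambda>x. (al x, ga x)) \<in> {lo..hi} \<rightarrow> T"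
  proof
    fix x assume x: "x \<in> {lo..hi}"
    then have x01: "0 < x" "x < 1" using lo by auto
    note s = support(1,2)[OF x01]
    have "al x * u b (1 - hi) \<le> al x * u b (1 - x)" "ga x * u b lo \<le> ga x * u b x"
      using s x lo b by (auto intro!: mult_left_mono u_mono)
    moreover have "al x * u b (1 - x) + ga x * u b x \<le> K" using K[OF x] by (simp add: V_def harm_def)
    moreover have "0 \<le> al x * u b (1 - x)" "0 \<le> ga x * u b x"
      using s u_pos[of x b] u_pos[of "1 - x" b] x01 by auto
    ultimately have "al x * u b (1 - hi) \<le> K" "ga x * u b lo \<le> K" by linarith+
    then show "(al x, ga x) \<in> T" using s up by (simp add: T_def pos_le_divide_eq)
  qed
  have cT: "compact T" unfolding T_def by (intro compact_Times compact_Icc)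
  let ?H = "\<lambda>z::real \<times> real \<times> real. harm b (fst (snd z)) (snd (snd z))"
  let ?S = "{lo..hi} \<times> (UNIV :: (real \<times> real) set)"
  have "(\<lambda>x. (x, al x, ga x)) ` {lo..hi} =
    (\<Inter>y\<in>{0<..<1}. {z \<in> ?S. V y \<le> ?H z y}) \<inter> {z \<in> ?S. V (fst z) = ?H z (fst z)}" (is "?L = ?R")
  proof
    show "?L \<subseteq> ?R"
    proof
      fix z assume "z \<in> ?L"
      then obtain x where x: "x \<in> {lo..hi}" "z = (x, al x, ga x)" by blast
      then have x01: "0 < x" "x < 1" using lo by auto
      show "z \<in> ?R" using x V_le[OF x01] by (auto simp: V_def)
    qed
    show "?R \<subseteq> ?L"
    proof
      fix z assume z: "z \<in> ?R"
      obtain x \<alpha> \<gamma> where zz: "z = (x, \<alpha>, \<gamma>)" by (cases z)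
      have x: "x \<in> {lo..hi}" using z zz by auto
      then have x01: "0 < x" "x < 1" using lo by auto
      have "\<alpha> = al x" "\<gamma> = ga x"
        using support_unique[OF x01, of \<alpha> \<gamma>] z zz by auto
      then show "z \<in> ?L" using zz x by blast
    qed
  qed
  moreover have "closed ?R"
  proof (intro closed_Int closed_INT ballI)
    have S: "closed ?S" by (intro closed_Times) auto
    show "closed {z \<in> ?S. V y \<le> ?H z y}" for y
      by (intro continuous_on_closed_Collect_le S continuous_intros; unfold harm_def) (intro continuous_intros)
    have V: "continuous_on ?S (\<lambda>z. V (fst z))"
      by (rule continuous_on_compose2[OF V_cont[OF lo]]) (auto intro!: continuous_intros)
    have U: "continuous_on ?S (\<lambda>z. u b (fst z))" "continuous_on ?S (\<lambda>z. u b (1 - fst z))"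
      by (rule continuous_on_compose2[OF u_cont[OF lo]], auto intro!: continuous_intros)
        (rule continuous_on_compose2[OF u_reflect_cont[OF lo]], auto intro!: continuous_intros)
    have H: "continuous_on ?S (\<lambda>z. ?H z (fst z))"
      unfolding harm_def by (intro continuous_intros U)
    have "{z \<in> ?S. V (fst z) = ?H z (fst z)} = {z \<in> ?S. V (fst z) \<le> ?H z (fst z)} \<inter> {z \<in> ?S. ?H z (fst z) \<le> V (fst z)}"
      by auto
    then show "closed {z \<in> ?S. V (fst z) = ?H z (fst z)}"
      using continuous_on_closed_Collect_le[OF V H S] continuous_on_closed_Collect_le[OF H V S] by auto
  qed
  ultimately have "closed ((\<lambda>x. (x, al x, ga x)) ` {lo..hi})" by simp
  then show ?thesis by (intro continuous_from_closed_graph[OF cT]) (use im in auto)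
qed simp

lemma V'_cont:
  assumes d: "0 < d" "d < 1"
  shows "isCont (\<lambda>x. harm' b (al x) (ga x) x) d"
proof -
  let ?lo = "d / 2" and ?hi = "(d + 1) / 2"
  have lo: "0 < ?lo" "?hi < 1" "?lo < d" "d < ?hi" using d by auto
  note c = support_cont[OF lo(1,2)]
  have a: "continuous_on {?lo..?hi} al" "continuous_on {?lo..?hi} ga"
    using continuous_on_fst[OF c] continuous_on_snd[OF c] by auto
  have u': "continuous_on {lo..hi} (u' b)" if "0 < lo" "hi < 1" for lo hi
    using that by (intro continuous_at_imp_continuous_on ballI DERIV_isCont[OF u'_deriv]) auto
  have u'r: "continuous_on {?lo..?hi} (\<lambda>x. u' b (1 - x))"
    by (rule continuous_on_compose2[OF u'[of "1 - ?hi" "1 - ?lo"]]) (use lo in \<open>auto intro!: continuous_intros\<close>)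
  have "continuous_on {?lo..?hi} (\<lambda>x. harm' b (al x) (ga x) x)"
    unfolding harm'_def by (intro continuous_intros a u' u'r lo)
  then show ?thesis using lo by (intro continuous_on_interior) auto
qed

section \<open>Optimal intervals and the finitely many exceptional points\<close>

definition optimal_set :: "'b \<Rightarrow> real set" where
  "optimal_set a = {x. 0 < x \<and> x < 1 \<and> V x = l a x}"

text \<open>Each reward is optimal on an interval: a competitor that is strictly better in between would
  make the difference of two linear functions change sign twice.\<close>

lemma optimal_set_convex:
  assumes a: "a \<in> A" and x: "x1 \<in> optimal_set a" "x2 \<in> optimal_set a" "x1 \<le> w" "w \<le> x2"
  shows "w \<in> optimal_set a"
proof -
  have x01: "0 < x1" "x1 < 1" "0 < x2" "x2 < 1" and V: "V x1 = l a x1" "V x2 = l a x2"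
    using x by (auto simp: optimal_set_def)
  have w: "0 < w" "w < 1" using x x01 by auto
  let ?L = "harm b (al w) (ga w)"
  obtain w1 w2 where c: "0 < w1" "w1 \<le> w" "w \<le> w2" "w2 < 1" "G w1 = ?L w1" "G w2 = ?L w2"
    using support(4)[OF w] unfolding contact_def by blast
  \<comment> \<open>Every reward is at most \<open>V\<close>, hence at most the reward of
    \<open>a\<close>, at both \<open>x1\<close> and \<open>x2\<close>, and by linearity also between
    them. So a contact inside this range is a contact with \<open>a\<close>.\<close>
  have inside: "?L y = l a y" if y: "x1 \<le> y" "y \<le> x2" "G y = ?L y" for y
  proof -
    have y01: "0 < y" "y < 1" using y x01 by auto
    obtain c where c: "c \<in> A" "G y = l c y" using G_attained by blast
    have "l c y \<le> l a y"
    proof (rule Rt_le_between[OF y(1,2)])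
      show "l c x1 \<le> l a x1" using l_le_G[OF c(1), of x1] G_le_V[OF x01(1,2)] V by linarith
      show "l c x2 \<le> l a x2" using l_le_G[OF c(1), of x2] G_le_V[OF x01(3,4)] V by linarith
    qed
    then show ?thesis using c y(3) l_le_G[OF a, of y] by linarith
  qed
  \<comment> \<open>If the left contact point lies beyond \<open>x1\<close>, then \<open>x1\<close>
    itself is between the contact points, where the combination equals \<open>V\<close>.\<close>
  have "\<exists>s. x1 \<le> s \<and> s \<le> w \<and> ?L s = l a s"
  proof (cases "x1 \<le> w1")
    case True
    then show ?thesis using inside[of w1] c x by (intro exI[of _ w1]) auto
  next
    case False
    then have "V x1 = ?L x1" using c x by (intro V_eq_on_contact[OF w c(1) _ _ c(4)]) auto
    then show ?thesis using V x by (intro exI[of _ x1]) auto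
  qed
  then obtain s1 where s1: "x1 \<le> s1" "s1 \<le> w" "?L s1 = l a s1" by blast
  have "\<exists>s. w \<le> s \<and> s \<le> x2 \<and> ?L s = l a s"
  proof (cases "w2 \<le> x2")
    case True
    then show ?thesis using inside[of w2] c x by (intro exI[of _ w2]) auto
  next
    case False
    then have "V x2 = ?L x2" using c x by (intro V_eq_on_contact[OF w c(1) _ _ c(4)]) auto
    then show ?thesis using V x by (intro exI[of _ x2]) auto
  qed
  then obtain s2 where s2: "w \<le> s2" "s2 \<le> x2" "?L s2 = l a s2" by blast
  have s01: "0 < s1" "s1 < 1" "0 < s2" "s2 < 1" using s1 s2 x01 w by auto
  \<comment> \<open>The tangent to the reward at \<open>w\<close> dominates it at \<open>s1\<close>
    and \<open>s2\<close>, hence dominates \<open>?L\<close> there and so at \<open>w\<close>, where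
    the tangent equals the reward.\<close>
  note t = Rt_tangent[OF b w, of R0 a R1] 
  have "?L w \<le> l a w"
    unfolding t(2)[OF conjunct1[OF nn[OF a]] conjunct2[OF nn[OF a]]]
    by (rule harm_le_between[OF less_imp_le[OF b] s01(1) s1(2) s2(1) s01(4)])
      (use t(1) nn[OF a] s1(3) s2(3) s01 in auto)
  moreover have "l a w \<le> V w" using l_le_G[OF a, of w] G_le_V[OF w] by linarith
  ultimately show ?thesis using w by (auto simp: optimal_set_def V_def)
qed

text \<open>The end points of the optimal intervals. For an empty interval \<open>Inf\<close> and
  \<open>Sup\<close> are unspecified reals, which merely add points to a finite set.\<close>

definition kinks :: "real set" where
  "kinks = (\<Union>a\<in>A. {Inf (optimal_set a), Sup (optimal_set a)})"

text \<open>Away from the end points there are two cases: either one reward is optimal around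
  \<open>d\<close> and \<open>V'\<close> is constant, or no reward is optimal at \<open>d\<close>,
  which then lies strictly between its contact points, where \<open>V\<close> is harmonic.\<close>

lemma V'_differentiable:
  assumes d: "0 < d" "d < 1" "d \<notin> kinks"
  shows "(\<lambda>x. harm' b (al x) (ga x) x) differentiable (at d)"
proof (cases "\<exists>a\<in>A. d \<in> optimal_set a")
  case True
  then obtain a where a: "a \<in> A" "d \<in> optimal_set a" by blast
  have ne: "d \<noteq> Inf (optimal_set a)" "d \<noteq> Sup (optimal_set a)" using d(3) a(1) by (auto simp: kinks_def)
  have bdd: "bdd_below (optimal_set a)" "bdd_above (optimal_set a)"
    by (auto simp: optimal_set_def intro!: bdd_belowI[of _ 0] bdd_aboveI[of _ 1])
  have "Inf (optimal_set a) < d" using cInf_lower[OF a(2) bdd(1)] ne by simp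
  then obtain x1 where x1: "x1 \<in> optimal_set a" "x1 < d" using cInf_lessD[of "optimal_set a" d] a(2) by blast
  have "d < Sup (optimal_set a)" using cSup_upper[OF a(2) bdd(2)] ne by simp
  then obtain x2 where x2: "x2 \<in> optimal_set a" "d < x2" using less_cSupD[of "optimal_set a" d] a(2) by blast
  have V': "harm' b (al x) (ga x) x = R0 a - R1 a" if x: "x1 < x" "x < x2" for x
  proof -
    have x01: "0 < x" "x < 1" using x x1 x2 by (auto simp: optimal_set_def)
    have "(V has_real_derivative R0 a - R1 a) (at x)"
    proof (rule has_field_derivative_transform_within_open[OF Rt_deriv[of R0 R1 a]])
      show "open {x1<..<x2}" "x \<in> {x1<..<x2}" using x by auto
      fix y assume "y \<in> {x1<..<x2}"
      then have "y \<in> optimal_set a" using optimal_set_convex[OF a(1) x1(1) x2(1)] by auto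
      then show "l a y = V y" by (simp add: optimal_set_def)
    qed
    from DERIV_unique[OF V_deriv[OF x01] this] show ?thesis .
  qed
  have "((\<lambda>x. harm' b (al x) (ga x) x) has_real_derivative 0) (at d)"
    by (rule has_field_derivative_transform_within_open[OF DERIV_const[of "R0 a - R1 a"], where S = "{x1<..<x2}"])
      (use V' x1 x2 in auto)
  then show ?thesis by (auto simp: real_differentiable_def)
next
  case False
  obtain x1 x2 where x: "0 < x1" "x1 \<le> d" "d \<le> x2" "x2 < 1"
    and c: "G x1 = harm b (al d) (ga d) x1" "G x2 = harm b (al d) (ga d) x2"
    using support(4)[OF d(1,2)] unfolding contact_def by blast
  have "V d \<noteq> G d" using False G_attained[of d] d by (auto simp: optimal_set_def)
  then have "x1 \<noteq> d" "x2 \<noteq> d" using c by (auto simp: V_def)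
  then have lt: "x1 < d" "d < x2" using x by auto
  have V': "harm' b (al d) (ga d) x = harm' b (al x) (ga x) x" if y: "x1 < x" "x < x2" for x
  proof -
    have x01: "0 < x" "x < 1" using x y by auto
    have "(V has_real_derivative harm' b (al d) (ga d) x) (at x)"
    proof (rule has_field_derivative_transform_within_open[OF harm_derivs(1)[OF x01]])
      show "open {x1<..<x2}" "x \<in> {x1<..<x2}" using y by auto
      fix z assume "z \<in> {x1<..<x2}"
      then show "harm b (al d) (ga d) z = V z" by (intro V_eq_on_contact[symmetric, OF d(1,2) x(1) _ _ x(4) c]) auto
    qed
    from DERIV_unique[OF this V_deriv[OF x01]] show ?thesis .
  qed
  have "((\<lambda>x. harm' b (al x) (ga x) x) has_real_derivative harm'' b (al d) (ga d) d) (at d)"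
    by (rule has_field_derivative_transform_within_open[OF harm_derivs(2)[OF d(1,2)], where S = "{x1<..<x2}"])
      (use V' lt in auto)
  then show ?thesis by (auto simp: real_differentiable_def)
qed

section \<open>Linearity near the ends\<close>

lemma V_near_0: "\<exists>a\<in>A. \<exists>\<epsilon>>0. \<epsilon> < 1 \<and> G 0 = l a 0 \<and> (\<forall>y. 0 < y \<longrightarrow> y < \<epsilon> \<longrightarrow> V y = l a y)"
proof -
  from tangent_feasible_near_0[where A = A and ?R0.0 = R0 and ?R1.0 = R1, OF finA ne nn und b]
  obtain a \<epsilon> where a: "a \<in> A" "\<And>c. c \<in> A \<Longrightarrow> R1 c \<le> R1 a" and \<epsilon>: "0 < \<epsilon>" "\<epsilon> < 1"
    and t: "\<And>y. 0 < y \<Longrightarrow> y < \<epsilon> \<Longrightarrow> \<exists>\<alpha> \<gamma>. feasible \<alpha> \<gamma> \<and> l a y = harm b \<alpha> \<gamma> y"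
    unfolding feasible_iff by blast
  have "V y = l a y" if y: "0 < y" "y < \<epsilon>" for y
  proof (rule antisym)
    obtain \<alpha> \<gamma> where "feasible \<alpha> \<gamma>" "l a y = harm b \<alpha> \<gamma> y" using t[OF y] by blast
    then show "V y \<le> l a y" using V_le_feasible[of y \<alpha> \<gamma>] y \<epsilon> by simp
    show "l a y \<le> V y" using l_le_G[OF a(1), of y] G_le_V[of y] y \<epsilon> by simp
  qed
  moreover have "G 0 = l a 0"
    using l_le_G[OF a(1), of 0] G_attained[of 0] a(2) by (auto simp: Rt_def intro: antisym)
  ultimately show ?thesis using a(1) \<epsilon> by blast
qed

text \<open>Reflecting the belief exchanges the two states, hence \<open>R0\<close> with
  \<open>R1\<close> and the two weights with each other.\<close>

lemma V_near_1: "\<exists>a\<in>A. \<exists>\<epsilon>>0. \<epsilon> < 1 \<and> G 1 = l a 1 \<and> (\<forall>y. 1 - \<epsilon> < y \<longrightarrow> y < 1 \<longrightarrow> V y = l a y)"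
proof -
  have und': "\<exists>d\<in>{0<..<1}. \<forall>c\<in>A. Rt R1 R0 c d \<le> Rt R1 R0 a d" if a: "a \<in> A" for a
  proof -
    obtain d where d: "d \<in> {0<..<1}" "\<forall>c\<in>A. l c d \<le> l a d" using und[OF a] by blast
    show ?thesis by (rule bexI[of _ "1 - d"]) (use d in \<open>auto simp: Rt_reflect\<close>)
  qed
  have nn': "0 \<le> R1 a \<and> 0 \<le> R0 a" if "a \<in> A" for a using nn[OF that] by simp
  from tangent_feasible_near_0[where A = A and ?R0.0 = R1 and ?R1.0 = R0, OF finA ne nn' und' b]
  obtain a \<epsilon> where a: "a \<in> A" "\<And>c. c \<in> A \<Longrightarrow> R0 c \<le> R0 a" and \<epsilon>: "0 < \<epsilon>" "\<epsilon> < 1"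
    and t: "\<And>y. 0 < y \<Longrightarrow> y < \<epsilon> \<Longrightarrow> \<exists>\<alpha> \<gamma>. (\<forall>x c. 0 < x \<longrightarrow> x < 1 \<longrightarrow> c \<in> A \<longrightarrow> Rt R1 R0 c x \<le> harm b \<alpha> \<gamma> x)
       \<and> Rt R1 R0 a y = harm b \<alpha> \<gamma> y"
    by blast
  have "V y = l a y" if y: "1 - \<epsilon> < y" "y < 1" for y
  proof (rule antisym)
    obtain \<alpha> \<gamma> where f: "\<And>x c. 0 < x \<Longrightarrow> x < 1 \<Longrightarrow> c \<in> A \<Longrightarrow> Rt R1 R0 c x \<le> harm b \<alpha> \<gamma> x"
      and e: "Rt R1 R0 a (1 - y) = harm b \<alpha> \<gamma> (1 - y)" using t[of "1 - y"] y by auto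
    have "l c x \<le> harm b \<gamma> \<alpha> x" if "0 < x" "x < 1" "c \<in> A" for x c
      using f[of "1 - x" c] that by (simp add: Rt_reflect reflect_harm)
    then have "feasible \<gamma> \<alpha>" unfolding feasible_iff by blast
    moreover have "l a y = harm b \<gamma> \<alpha> y" using e by (simp add: Rt_reflect reflect_harm)
    ultimately show "V y \<le> l a y" using V_le_feasible[of y \<gamma> \<alpha>] y \<epsilon> by simp
    show "l a y \<le> V y" using l_le_G[OF a(1), of y] G_le_V[of y] y \<epsilon> by simp
  qed
  moreover have "G 1 = l a 1"
    using l_le_G[OF a(1), of 1] G_attained[of 1] a(2) by (auto simp: Rt_def intro: antisym)
  ultimately show ?thesis using a(1) \<epsilon> by blast
qed

text \<open>Supports exist for interior beliefs only; at the ends the belief never moves, and the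
  value is the payoff itself.\<close>

definition Vbar :: "real \<Rightarrow> real" where
  "Vbar x = (if x = 0 \<or> x = 1 then G x else V x)"

text \<open>Near each end the function is a single linear reward, whose slope serves as the missing
  value of the derivative; \<open>V_deriv\<close> and \<open>V'_cont\<close> cover the
  interior.\<close>

lemma hatC2_Vbar: "hatC2 Vbar"
proof -
  obtain a0 e0 where a0: "a0 \<in> A" "0 < e0" "e0 < 1" "G 0 = l a0 0" "\<And>y. 0 < y \<Longrightarrow> y < e0 \<Longrightarrow> V y = l a0 y"
    using V_near_0 by blast
  obtain a1 e1 where a1: "a1 \<in> A" "0 < e1" "e1 < 1" "G 1 = l a1 1" "\<And>y. 1 - e1 < y \<Longrightarrow> y < 1 \<Longrightarrow> V y = l a1 y"
    using V_near_1 by blast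
  let ?V' = "\<lambda>x. harm' b (al x) (ga x) x"
  define f' where "f' x = (if x = 0 then R0 a0 - R1 a0 else if x = 1 then R0 a1 - R1 a1 else ?V' x)" for x
  have Vbar0: "Vbar x = l a0 x" if "x \<in> {0..1}" "x < e0" for x
    using that a0 by (auto simp: Vbar_def)
  have Vbar1: "Vbar x = l a1 x" if "x \<in> {0..1}" "1 - e1 < x" for x
    using that a1 by (auto simp: Vbar_def)
  have f'0: "f' x = R0 a0 - R1 a0" if "x \<in> {0..1}" "x < e0" for x
  proof (cases "x = 0")
    case False
    then have x: "0 < x" "x < 1" using that a0 by auto
    have "(V has_real_derivative R0 a0 - R1 a0) (at x)"
      by (rule has_field_derivative_transform_within_open[OF Rt_deriv[of R0 R1 a0], where S = "{0<..<e0}"]) (use x that a0 in auto)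
    from DERIV_unique[OF V_deriv[OF x] this] show ?thesis using x by (simp add: f'_def)
  qed (simp add: f'_def)
  have f'1: "f' x = R0 a1 - R1 a1" if "x \<in> {0..1}" "1 - e1 < x" for x
  proof (cases "x = 1")
    case False
    then have x: "0 < x" "x < 1" using that a1 by auto
    have "(V has_real_derivative R0 a1 - R1 a1) (at x)"
      by (rule has_field_derivative_transform_within_open[OF Rt_deriv[of R0 R1 a1], where S = "{1 - e1<..<1}"]) (use x that a1 in auto)
    from DERIV_unique[OF V_deriv[OF x] this] show ?thesis using x by (simp add: f'_def)
  qed (simp add: f'_def)
  have f'V: "\<And>y. y \<in> {0<..<1} \<Longrightarrow> ?V' y = f' y" by (auto simp: f'_def)
  have deriv: "(Vbar has_real_derivative f' x) (at x within {0..1})" if x: "x \<in> {0..1}" for x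
  proof -
    consider "x = 0" | "x = 1" | "0 < x" "x < 1" using x by force
    then show ?thesis
    proof cases
      case 1
      then have "(l a0 has_real_derivative f' x) (at x within {0..1})"
        using Rt_deriv[of R0 R1 a0 x] by (simp add: f'_def has_field_derivative_at_within)
      then show ?thesis
        by (rule has_field_derivative_transform_within[OF _ a0(2) x]) (use 1 a0 Vbar0 in \<open>auto simp: dist_real_def\<close>)
    next
      case 2
      then have "(l a1 has_real_derivative f' x) (at x within {0..1})"
        using Rt_deriv[of R0 R1 a1 x] by (simp add: f'_def has_field_derivative_at_within)
      then show ?thesis
        by (rule has_field_derivative_transform_within[OF _ a1(2) x]) (use 2 a1 Vbar1 in \<open>auto simp: dist_real_def\<close>)
    next
      case 3
      have "(Vbar has_real_derivative ?V' x) (at x)"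
        by (rule has_field_derivative_transform_within_open[OF V_deriv[OF 3], where S = "{0<..<1}"]) (use 3 in \<open>auto simp: Vbar_def\<close>)
      moreover have "f' x = ?V' x" using 3 by (simp add: f'_def)
      ultimately show ?thesis by (simp add: has_field_derivative_at_within)
    qed
  qed
  have cont: "continuous_on {0..1} f'"
    unfolding continuous_on_eq_continuous_within
  proof
    fix x :: real assume x: "x \<in> {0..1}"
    consider "x = 0" | "x = 1" | "0 < x" "x < 1" using x by force
    then show "continuous (at x within {0..1}) f'"
    proof cases
      case 1
      show ?thesis
        by (rule continuous_transform_within[OF continuous_const[of _ "R0 a0 - R1 a0"] a0(2) x])
          (use 1 a0 f'0 in \<open>auto simp: dist_real_def\<close>)
    next
      case 2
      show ?thesis
        by (rule continuous_transform_within[OF continuous_const[of _ "R0 a1 - R1 a1"] a1(2) x])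
          (use 2 a1 f'1 in \<open>auto simp: dist_real_def\<close>)
    next
      case 3
      have "continuous (at x within {0..1}) ?V'" using V'_cont[OF 3] by (rule continuous_at_imp_continuous_at_within)
      then show ?thesis
      proof (rule continuous_transform_within[where \<delta> = "min x (1 - x)"])
        fix y assume "y \<in> {0..1}" "dist y x < min x (1 - x)"
        then have "0 < y" "y < 1" unfolding dist_real_def by linarith+
        then show "?V' y = f' y" using f'V by simp
      qed (use 3 in auto)
    qed
  qed
  have "f' differentiable (at x within {0..1})" if x: "x \<in> {0..1} - (kinks \<union> {0, 1})" for x
  proof -
    have x01: "0 < x" "x < 1" "x \<notin> kinks" using x by auto
    from V'_differentiable[OF this] obtain D where "(?V' has_real_derivative D) (at x)"
      by (auto simp: real_differentiable_def)
    then have "(f' has_real_derivative D) (at x)"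
      by (rule has_field_derivative_transform_within_open[where S = "{0<..<1}"]) (use x01 f'V in auto)
    then have "(f' has_real_derivative D) (at x within {0..1})" by (rule has_field_derivative_at_within)
    then show ?thesis by (auto simp: real_differentiable_def)
  qed
  moreover have "finite (kinks \<union> {0, 1})" using finA by (simp add: kinks_def)
  ultimately show ?thesis unfolding hatC2_def using deriv cont by blast
qed

end

section \<open>Identification of the stopping values\<close>

locale stopping_problem = belief M F W X \<sigma> r b + payoffs A R0 R1 b
  for M :: "'a measure" and F W X \<sigma> r b and A :: "'b set" and R0 R1 +
  assumes card: "2 \<le> card A"
begin

abbreviation "pair a c \<equiv> (\<lambda>x. max (l a x) (l c x))"

lemma pair_cont: "continuous_on UNIV (pair a c)"
  by (intro continuous_on_max Rt_cont)

lemma pair_le_G: "a \<in> A \<Longrightarrow> c \<in> A \<Longrightarrow> pair a c x \<le> G x"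
  using l_le_G by simp

lemma ex_other: "\<exists>c\<in>A. c \<noteq> a"
proof (rule ccontr)
  assume "\<not> ?thesis"
  then have "A \<subseteq> {a}" by blast
  then have "card A \<le> card {a}" by (intro card_mono) auto
  then show False using card by simp
qed

text \<open>When one action is best at both points, any other action completes the pair, since its
  reward cannot exceed \<open>G\<close>.\<close>

lemma pair_attains: "\<exists>a\<in>A. \<exists>c\<in>A. a \<noteq> c \<and> pair a c x = G x \<and> pair a c y = G y"
proof -
  obtain a where a: "a \<in> A" "G x = l a x" using G_attained by blast
  obtain c where c: "c \<in> A" "G y = l c y" using G_attained by blast
  show ?thesis
  proof (cases "a = c")
    case True
    obtain c' where c': "c' \<in> A" "c' \<noteq> a" using ex_other by blast
    have "pair a c' x = G x" "pair a c' y = G y"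
      using a c True l_le_G[OF c'(1), of x] l_le_G[OF c'(1), of y] by (auto simp: max_absorb1)
    then show ?thesis using a(1) c' by metis
  next
    case False
    have "pair a c x = G x" "pair a c y = G y"
      using a c l_le_G[of c x] l_le_G[of a y] by (auto simp: max_absorb1 max_absorb2)
    then show ?thesis using False a(1) c(1) by blast
  qed
qed

lemma stop_value_le_Vbar:
  assumes d: "d \<in> {0..1}" and g: "continuous_on UNIV g" "\<And>x. g x \<le> G x" "\<And>x. x \<in> {0..1} \<Longrightarrow> 0 \<le> g x"
  shows "stop_value M F X r g d \<le> Vbar d"
proof (cases "d = 0 \<or> d = 1")
  case True
  then show ?thesis using stop_value_boundary[OF True g(1) g(3)[OF d]] g(2)[of d] by (simp add: Vbar_def)
next
  case False
  then have d': "0 < d" "d < 1" using d by auto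
  have "stop_value M F X r g d \<le> harm b (al d) (ga d) d"
    by (rule stop_value_le_harm[OF d' g(1)]) (use g(2) feasibleD[OF support(3)[OF d']] order_trans in blast)
  then show ?thesis using False by (simp add: Vbar_def V_def)
qed

lemma V_le_stop_value:
  assumes x: "0 < x1" "x1 \<le> d" "d \<le> x2" "x2 < 1"
    and c: "G x1 = harm b (al d) (ga d) x1" "G x2 = harm b (al d) (ga d) x2"
    and g: "continuous_on UNIV g" "g x1 = G x1" "g x2 = G x2"
  shows "V d \<le> stop_value M F X r g d"
proof (cases "x1 < d \<and> d < x2")
  case True
  then show ?thesis unfolding V_def by (intro harm_le_stop_value[OF x(1) _ _ x(4) g(1)]) (use c g in auto)
next
  case False
  then have "g d = V d" using x c g by (cases "x1 = d") (auto simp: V_def)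
  then show ?thesis using stop_value_ge[OF _ g(1), of d] x by simp
qed

text \<open>The two points are fixed before the payoff: every continuous payoff that agrees with
  \<open>G\<close> at them earns at least the envelope. This covers \<open>G\<close> itself and a
  suitable pair in one statement.\<close>

lemma Vbar_le_stop_value:
  assumes d: "d \<in> {0..1}"
  shows "\<exists>x1 x2. \<forall>g. continuous_on UNIV g \<longrightarrow> g x1 = G x1 \<longrightarrow> g x2 = G x2 \<longrightarrow> Vbar d \<le> stop_value M F X r g d"
proof (cases "d = 0 \<or> d = 1")
  case True
  have "Vbar d \<le> stop_value M F X r g d" if "continuous_on UNIV g" "g d = G d" for g
    using stop_value_ge[OF d that(1)] that(2) True by (simp add: Vbar_def)
  then show ?thesis by blast
next
  case False
  then have d': "0 < d" "d < 1" using d by auto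
  obtain x1 x2 where "0 < x1" "x1 \<le> d" "d \<le> x2" "x2 < 1"
    "G x1 = harm b (al d) (ga d) x1" "G x2 = harm b (al d) (ga d) x2"
    using support(4)[OF d'] unfolding contact_def by blast
  from V_le_stop_value[OF this] show ?thesis using False by (auto simp: Vbar_def)
qed

lemma pair_nonneg: "a \<in> A \<Longrightarrow> x \<in> {0..1} \<Longrightarrow> 0 \<le> pair a c x"
  using nn[of a] by (auto simp: Rt_def le_max_iff_disj)

lemma stop_value_G:
  assumes d: "d \<in> {0..1}"
  shows "stop_value M F X r G d = Vbar d"
proof (rule antisym)
  show "stop_value M F X r G d \<le> Vbar d" by (rule stop_value_le_Vbar[OF d G_cont]) (use G_nonneg in auto)
  obtain x1 x2 where x: "\<And>g. continuous_on UNIV g \<Longrightarrow> g x1 = G x1 \<Longrightarrow> g x2 = G x2 \<Longrightarrow> Vbar d \<le> stop_value M F X r g d"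
    using Vbar_le_stop_value[OF d] by blast
  show "Vbar d \<le> stop_value M F X r G d" by (rule x[OF G_cont refl refl])
qed

lemma Max_pairs:
  assumes d: "d \<in> {0..1}"
  shows "Max {stop_value M F X r (pair a c) d | a c. a \<in> A \<and> c \<in> A \<and> a \<noteq> c} = Vbar d"
proof (rule Max_eqI)
  let ?S = "{stop_value M F X r (pair a c) d | a c. a \<in> A \<and> c \<in> A \<and> a \<noteq> c}"
  have "?S \<subseteq> (\<lambda>(a, c). stop_value M F X r (pair a c) d) ` (A \<times> A)" by auto
  then show "finite ?S" by (rule finite_subset) (use finA in auto)
  have le: "stop_value M F X r (pair a c) d \<le> Vbar d" if "a \<in> A" "c \<in> A" for a c
    by (rule stop_value_le_Vbar[OF d pair_cont pair_le_G[OF that] pair_nonneg[OF that(1)]])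
  then show "\<And>y. y \<in> ?S \<Longrightarrow> y \<le> Vbar d" by blast
  obtain x1 x2 where x: "\<And>g. continuous_on UNIV g \<Longrightarrow> g x1 = G x1 \<Longrightarrow> g x2 = G x2 \<Longrightarrow> Vbar d \<le> stop_value M F X r g d"
    using Vbar_le_stop_value[OF d] by blast
  obtain a c where ac: "a \<in> A" "c \<in> A" "a \<noteq> c" "pair a c x1 = G x1" "pair a c x2 = G x2"
    using pair_attains[of x1 x2] by blast
  have "Vbar d \<le> stop_value M F X r (pair a c) d"
    by (rule x[OF pair_cont ac(4,5)])
  then have "Vbar d = stop_value M F X r (pair a c) d" using le[OF ac(1,2)] by simp
  then show "Vbar d \<in> ?S" using ac(1-3) by blast
qed

end

lemma hatC2_zero: "hatC2 (\<lambda>_. 0)"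
  unfolding hatC2_def by (rule exI[of _ "\<lambda>_. 0"]) (auto intro: exI[of _ "{}"])

theorem theorem2:
  fixes A :: "'b set" and R0 R1 :: "'b \<Rightarrow> real"
    and M :: "'a measure" and F :: "real \<Rightarrow> 'a measure" and W :: "real \<Rightarrow> 'a \<Rightarrow> real"
    and X :: "real \<Rightarrow> real \<Rightarrow> 'a \<Rightarrow> real" and \<sigma> r :: real
  assumes finA: "finite A" and cardA: "card A \<ge> 2"
    and nonneg: "\<forall>a\<in>A. R0 a \<ge> 0 \<and> R1 a \<ge> 0"
    and undominated: "\<forall>a\<in>A. \<exists>d\<in>{0<..<1}. \<forall>b\<in>A. Rt R0 R1 b d \<le> Rt R0 R1 a d"
    and sigma_pos: "\<sigma> > 0" and r_pos: "r > 0"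
    and BM: "brownian_motion M F W"
    and sol: "\<forall>d\<in>{0..1}. solves_belief_sde M F W \<sigma> d (X d)"
  shows "hatC2 (\<lambda>d. Max {stop_value M F X r (\<lambda>x. max (Rt R0 R1 a x) (Rt R0 R1 b x)) d
                         | a b. a \<in> A \<and> b \<in> A \<and> a \<noteq> b})
    \<and> (\<forall>d\<in>{0..1}. stop_value M F X r (Gmax A R0 R1) d
         = Max {stop_value M F X r (\<lambda>x. max (Rt R0 R1 a x) (Rt R0 R1 b x)) d
                | a b. a \<in> A \<and> b \<in> A \<and> a \<noteq> b})"
proof -
  \<comment> \<open>With \<open>\<beta> = (1 + s) / 2\<close> one has
    \<open>\<beta> * (\<beta> - 1) = (s\<^sup>2 - 1) / 4\<close>, so the indicial equation becomes
    \<open>s\<^sup>2 = 1 + 8 * r / \<sigma>\<^sup>2\<close>.\<close>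
  define s where "s = sqrt (1 + 8 * r / \<sigma>\<^sup>2)"
  define \<beta> where "\<beta> = (1 + s) / 2"
  have pos: "0 < 8 * r / \<sigma>\<^sup>2" using r_pos sigma_pos by simp
  have s: "1 < s" "s\<^sup>2 = 1 + 8 * r / \<sigma>\<^sup>2" using pos by (auto simp: s_def)
  have \<beta>1: "1 < \<beta>" using s by (simp add: \<beta>_def)
  have "\<beta> * (\<beta> - 1) = (s\<^sup>2 - 1) / 4" by (simp add: \<beta>_def power2_eq_square field_simps)
  then have \<beta>2: "\<beta> * (\<beta> - 1) * \<sigma>\<^sup>2 / 2 = r" using s(2) sigma_pos by (simp add: field_simps)
  interpret belief M F W X \<sigma> r \<beta>
    by unfold_locales (use BM r_pos \<beta>1 \<beta>2 sol in auto)
  have ne: "A \<noteq> {}" using cardA by auto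
  let ?S = "\<lambda>d. {stop_value M F X r (\<lambda>x. max (Rt R0 R1 a x) (Rt R0 R1 b x)) d | a b. a \<in> A \<and> b \<in> A \<and> a \<noteq> b}"
  show ?thesis
  proof (cases "\<exists>a\<in>A. 0 < R0 a + R1 a")
    case True
    interpret stopping_problem M F W X \<sigma> r \<beta> A R0 R1
      by unfold_locales (use finA ne nonneg True undominated \<beta>1 cardA in auto)
    show ?thesis
      using hatC2_cong[of Vbar "\<lambda>d. Max (?S d)"] hatC2_Vbar Max_pairs stop_value_G by simp
  next
    \<comment> \<open>With all rewards zero there is no positive multiple of
      \<open>x * (1 - x)\<close> below the payoff, on which the exclusion of boundary contact rests;
      here every stopping value is 0.\<close>
    case False
    then have zero: "R0 a = 0" "R1 a = 0" if "a \<in> A" for a using nonneg that by force+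
    have pair: "(\<lambda>x. max (Rt R0 R1 a x) (Rt R0 R1 b x)) = (\<lambda>_. 0)" if "a \<in> A" "b \<in> A" for a b
      using zero that by (simp add: Rt_def)
    have G: "Gmax A R0 R1 = (\<lambda>_. 0)"
    proof
      fix x
      have "(\<lambda>a. Rt R0 R1 a x) ` A = {0}" using zero ne by (auto simp: Rt_def)
      then show "Gmax A R0 R1 x = 0" by (simp add: Gmax_def)
    qed
    have "nn_stopping_time M F (\<lambda>_. 0)" by (rule stopping_const) simp
    then have "{\<tau>. nn_stopping_time M F \<tau>} \<noteq> {}" by blast
    then have val: "stop_value M F X r (\<lambda>_. 0) d = 0" for d
      by (simp add: stop_value_def)
    obtain a where a: "a \<in> A" using ne by blast
    have "\<exists>b\<in>A. b \<noteq> a"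
    proof (rule ccontr)
      assume "\<not> ?thesis"
      then have "A \<subseteq> {a}" by blast
      then have "card A \<le> card {a}" by (intro card_mono) auto
      then show False using cardA by simp
    qed
    then obtain c where c: "c \<in> A" "c \<noteq> a" by blast
    have S: "?S d = {0}" for d
    proof
      show "?S d \<subseteq> {0}" using pair val by auto
      have "stop_value M F X r (\<lambda>x. max (Rt R0 R1 a x) (Rt R0 R1 c x)) d = 0"
        unfolding pair[OF a c(1)] by (rule val)
      then show "{0} \<subseteq> ?S d" using a c by force
    qed
    show ?thesis unfolding S G val using hatC2_zero by simp
  qed
qed

end
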